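(* Let $\rho>1$, $r>\frac12$, $\delta\in(0,\frac12]$ and $0<p<\infty$. Let the univariate Sobolev space $W_2^r(\mathbb{T})$ be equipped with the Gaussian measure $\mu$ (with parameter $\rho$) described in the context. Then, as $n\to\infty$, the Gel'fand widths of $W_2^r(\mathbb{T})$ in $S_\infty(\mathbb{T})$ satisfy: (1) (probabilistic Gel'fand width) $$d^n_\delta(W_2^r(\mathbb{T}),\mu,S_\infty(\mathbb{T}))\asymp n^{-(r+\frac{\rho}{2})}\sqrt{\ln\frac{n}{\delta}};$$ (2) ($p$-average Gel'fand width) $$d^n_{(a)}(W_2^r(\mathbb{T}),\mu,S_\infty(\mathbb{T}))_p\asymp n^{-(r+\frac{\rho}{2})}\sqrt{\ln n}.$$ Here the constants implied by $\asymp$ are independent of $n$ and $\delta$.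
   Context: Notation: for positive functions $a,b$ on a set $D$, $a(y)\asymp b(y)$ means that there are constants $c_1,c_2>0$ with $c_1b(y)\le a(y)\le c_2b(y)$ for all $y\in D$. Function spaces. $\mathbb{T}=[0,2\pi]$ is the one-dimensional torus; functions are $2\pi$-periodic. $e_k(t)=\exp(ikt)$, $\hat x(k)=\frac1{2\pi}\int_{\mathbb{T}}x(t)e^{-ikt}\,dt$, and $\langle x,y\rangle=\frac{1}{2\pi}\int_{\mathbb{T}}x(t)\overline{y(t)}\,dt$ on $L_2(\mathbb{T})$. For $r\in\mathbb{R}$ the Weyl $r$-fractional derivative of $x=\sum_k\hat x(k)e_k$ is $x^{(r)}=\sum_k(ik)^r\hat x(k)e_k$, where $(ik)^r=|k|^r\exp(\frac{\pi i}{2}\operatorname{sgn}r)$. For $r>0$, $$W_2^r(\mathbb{T})=\{x\in L_2(\mathbb{T}): x^{(r)}\in L_2(\mathbb{T}),\ \hat x(0)=0\},$$ a Hilbert space with inner product $\langle x,y\rangle_1=\langle x^{(r)},y^{(r)}\rangle$. The space $$S_\infty(\mathbb{T})=\{x\in L_1(\mathbb{T}): \{\hat x(k)\}_{k\in\mathbb{Z}}\in l_\infty\},\qquad \|x\|_{S_\infty}=\sup_{k\in\mathbb{Z}}|\hat x(k)|.$$ For $r>\frac12$, $W_2^r(\mathbb{T})$ is continuously embedded into $S_\infty(\mathbb{T})$. Gaussian measure. $\mu$ is the Gaussian measure on $W_2^r(\mathbb{T})$ with mean $0$ whose correlation operator $C_\mu$ has eigenfunctions $e_k=\exp(ik(\cdot))$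 and eigenvalues $\lambda_k=|k|^{-\rho}$, $k\in\mathbb{Z}\setminus\{0\}$, i.e. $C_\mu e_k=\lambda_ke_k$. On cylindrical sets: for an orthonormal system $y_1,\dots,y_m$ in $L_2(\mathbb{T})$, a Borel set $\mathscr{B}\subset\mathbb{R}^m$, $\sigma_j=\langle C_\mu y_j,y_j\rangle$ and $S=\{x\in W_2^r(\mathbb{T}): (\langle x,y_1^{(-r)}\rangle_1,\dots,\langle x,y_m^{(-r)}\rangle_1)\in\mathscr{B}\}$, $$\mu(S)=\prod_{j=1}^m(2\pi\sigma_j)^{-1/2}\int_{\mathscr{B}}\exp\Big(-\sum_{j=1}^m\frac{|u_j|^2}{2\sigma_j}\Big)\,du_1\cdots du_m.$$ Widths. Let $W=W_2^r(\mathbb{T})$ and $X=S_\infty(\mathbb{T})$, with $\|\cdot\|$ the norm of $X$, and let $F^n$ range over closed linear subspaces of $X$ of codimension $n$. - Probabilistic Gel'fand $(n,\delta)$-width: $d^n_\delta(W,\mu,X)=\inf_{G_\delta}\inf_{F^n}\sup_{x\in(W\setminus G_\delta)\cap F^n}\|x\|$, where $G_\delta$ runs over all Borel subsets of $W$ with $\mu(G_\delta)\le\delta$, with $0\notin G_\delta$, and such that $\mu_M(G_\delta\cap M)\le\delta$ for every closed subspace $M$ of $W$. Here, with $P$ the orthogonal projection of the Hilbert space $W$ onto $M$, $\mu_M(G_M)=\mu(\{x\in W: Px\in G_M\})$ for Borel $G_M\subset M$. - $p$-average Gel'fand $n$-width: $d^n_{(a)}(W,\mu,X)_p=\inf_{F^n}\big(\int_{W\cap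 F^n}\|x\|^p\,d\mu(x)\big)^{1/p}$.
   Formalization: In the average width the integral over W∩F^n is taken against the induced measure μ_M, M=W∩F^n (against μ it is 0 for n≥2, so (2) would fail); functions are real-valued; the cylinder formula is required only for mean-zero orthonormal systems that diagonalize C_μ. *)

theory Defs
  imports "HOL-Analysis.Analysis"
begin

section \<open>Functions on the torus\<close>

definition torus_measure :: "real measure" where
  "torus_measure = lebesgue_on {0..2 * pi}"

text \<open>
  The real-valued functions in \<open>L\<^sub>1(\<T>)\<close>, modulo equality almost everywhere. The scalar field is
  \<open>\<real>\<close> because the formula for the Gaussian measure evaluates functionals \<open>\<langle>x, y\<^sup>(\<^sup>-\<^sup>r\<^sup>)\<rangle>\<^sub>1\<close>
  in Borel subsets of \<open>\<real>\<^sup>m\<close>; Fourier coefficients remain complex numbers.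
\<close>

definition torus_fun :: "(real \<Rightarrow> real) \<Rightarrow> bool" where
  "torus_fun f \<longleftrightarrow> (\<forall>t. f (t + 2 * pi) = f t) \<and> integrable torus_measure f"

definition torus_eq :: "(real \<Rightarrow> real) \<Rightarrow> (real \<Rightarrow> real) \<Rightarrow> bool" where
  "torus_eq f g \<longleftrightarrow> torus_fun f \<and> torus_fun g \<and> (AE t in torus_measure. f t = g t)"

quotient_type torus = "real \<Rightarrow> real" / partial: torus_eq
proof (rule part_equivpI)
  show "\<exists>f. torus_eq f f"
    by (rule exI[of _ "\<lambda>_. 0"]) (simp add: torus_eq_def torus_fun_def)
  show "symp torus_eq"
    by (auto simp: symp_def torus_eq_def elim: AE_mp)
  show "transp torus_eq"
    unfolding transp_def torus_eq_def by (auto elim: AE_mp)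
qed

instantiation torus :: real_vector
begin

lift_definition zero_torus :: torus is "\<lambda>_. 0"
  by (simp add: torus_eq_def torus_fun_def)

lift_definition plus_torus :: "torus \<Rightarrow> torus \<Rightarrow> torus" is "\<lambda>f g t. f t + g t"
  unfolding torus_eq_def torus_fun_def by (auto elim: AE_mp)

lift_definition uminus_torus :: "torus \<Rightarrow> torus" is "\<lambda>f t. - f t"
  unfolding torus_eq_def torus_fun_def by auto

lift_definition minus_torus :: "torus \<Rightarrow> torus \<Rightarrow> torus" is "\<lambda>f g t. f t - g t"
  unfolding torus_eq_def torus_fun_def by (auto elim: AE_mp)

lift_definition scaleR_torus :: "real \<Rightarrow> torus \<Rightarrow> torus" is "\<lambda>c f t. c * f t"
  unfolding torus_eq_def torus_fun_def by (auto elim: AE_mp)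

instance
  by standard (transfer; auto simp: torus_eq_def torus_fun_def algebra_simps)+

end

lemma fourier_integrand_measurable:
  assumes "integrable torus_measure f"
  shows "(\<lambda>t. complex_of_real (f t) * exp (- (\<i> * of_int k * of_real t)))
           \<in> borel_measurable torus_measure"
proof (rule borel_measurable_times)
  show "(\<lambda>t. complex_of_real (f t)) \<in> borel_measurable torus_measure"
    using assms by measurable
  show "(\<lambda>t. exp (- (\<i> * of_int k * complex_of_real t))) \<in> borel_measurable torus_measure"
    unfolding torus_measure_def
    by (rule continuous_imp_measurable_on_sets_lebesgue) (auto intro!: continuous_intros)
qed

lift_definition fourier_coeff :: "torus \<Rightarrow> int \<Rightarrow> complex" is
  "\<lambda>f k. (LINT t|torus_measure. of_real (f t) * exp (- (\<i> * of_int k * of_real t))) / (2 * pi)"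
  unfolding torus_eq_def torus_fun_def
  by (intro ext arg_cong2[where f = "(/)"] refl integral_cong_AE)
     (auto elim: AE_mp intro: fourier_integrand_measurable)

lift_definition in_L2 :: "torus \<Rightarrow> bool" is "\<lambda>f. integrable torus_measure (\<lambda>t. (f t)\<^sup>2)"
  unfolding torus_eq_def torus_fun_def
  by (intro integrable_cong_AE) (auto elim: AE_mp)

lift_definition inner_L2 :: "torus \<Rightarrow> torus \<Rightarrow> real" is
  "\<lambda>f g. (LINT t|torus_measure. f t * g t) / (2 * pi)"
  unfolding torus_eq_def torus_fun_def
  by (intro arg_cong2[where f = "(/)"] refl integral_cong_AE) (auto elim: AE_mp)


section \<open>Fourier multipliers and Sobolev spaces\<close>

definition is_multiplier :: "(int \<Rightarrow> complex) \<Rightarrow> torus \<Rightarrow> torus \<Rightarrow> bool" where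
  "is_multiplier m x y \<longleftrightarrow> in_L2 y \<and> (\<forall>k. fourier_coeff y k = m k * fourier_coeff x k)"

text \<open>
  The \<open>L\<^sub>2\<close> function \<open>\<Sum>\<^sub>k m(k) x\<^sup>^(k) e\<^sub>k\<close>, meaningful when it exists; it is then unique.
\<close>

definition multiplier :: "(int \<Rightarrow> complex) \<Rightarrow> torus \<Rightarrow> torus" where
  "multiplier m x = (THE y. is_multiplier m x y)"

text \<open>
  \<open>(ik)\<^sup>r = |k|\<^sup>r exp((\<pi>i/2) r sgn k)\<close>. For \<open>k = 0\<close> this is \<open>0\<close> whatever the sign of \<open>r\<close>, because
  \<open>0 powr r = 0\<close>; only functions with mean value zero are differentiated below.
\<close>

definition weyl_symbol :: "real \<Rightarrow> int \<Rightarrow> complex" where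
  "weyl_symbol r k =
     of_real (\<bar>real_of_int k\<bar> powr r) * exp (pi * \<i> / 2 * of_real (r * sgn (real_of_int k)))"

definition weyl :: "real \<Rightarrow> torus \<Rightarrow> torus" where
  "weyl r = multiplier (weyl_symbol r)"

definition W2 :: "real \<Rightarrow> torus set" where
  "W2 r = {x. in_L2 x \<and> (\<exists>y. is_multiplier (weyl_symbol r) x y) \<and> fourier_coeff x 0 = 0}"

definition inner_W2 :: "real \<Rightarrow> torus \<Rightarrow> torus \<Rightarrow> real" where
  "inner_W2 r x y = inner_L2 (weyl r x) (weyl r y)"

definition top_W2 :: "real \<Rightarrow> torus topology" where
  "top_W2 r = Metric_space.mtopology (W2 r) (\<lambda>x y. sqrt (inner_W2 r (x - y) (x - y)))"

definition borel_W2 :: "real \<Rightarrow> torus measure" where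
  "borel_W2 r = sigma (W2 r) {U. openin (top_W2 r) U}"

definition S_inf :: "torus set" where
  "S_inf = {x. bounded (range (fourier_coeff x))}"

definition norm_S :: "torus \<Rightarrow> real" where
  "norm_S x = (SUP k. cmod (fourier_coeff x k))"

definition top_S :: "torus topology" where
  "top_S = Metric_space.mtopology S_inf (\<lambda>x y. norm_S (x - y))"


section \<open>The Gaussian measure\<close>

text \<open>
  The operator with \<open>C e\<^sub>k = |k|\<^sup>-\<^sup>\<rho> e\<^sub>k\<close> for \<open>k \<noteq> 0\<close>, applied only to functions with mean value zero.
\<close>

definition corr_op :: "real \<Rightarrow> torus \<Rightarrow> torus" where
  "corr_op \<rho> = multiplier (\<lambda>k. of_real (\<bar>real_of_int k\<bar> powr - \<rho>))"

text \<open>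
  The values of \<open>\<mu>\<close> on cylindrical sets. The coordinates of a Gaussian vector are independent, as
  the product formula says, exactly if they are uncorrelated; so the orthonormal systems admitted
  here are those that also diagonalise the correlation operator. (A single function always does,
  hence the formula fixes the law of every continuous linear functional.) Their members have mean
  value zero, since neither \<open>C\<close> nor \<open>y\<^sup>(\<^sup>-\<^sup>r\<^sup>)\<close> is defined on constants.
\<close>

definition gaussian_system :: "real \<Rightarrow> nat \<Rightarrow> (nat \<Rightarrow> torus) \<Rightarrow> bool" where
  "gaussian_system \<rho> m y \<longleftrightarrow>
     (\<forall>j<m. in_L2 (y j) \<and> fourier_coeff (y j) 0 = 0) \<and>
     (\<forall>i<m. \<forall>j<m. inner_L2 (y i) (y j) = (if i = j then 1 else 0)) \<and>
     (\<forall>i<m. \<forall>j<m. i \<noteq> j \<longrightarrow> inner_L2 (corr_op \<rho> (y i)) (y j) = 0)"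

definition gaussian_W2 :: "real \<Rightarrow> real \<Rightarrow> torus measure \<Rightarrow> bool" where
  "gaussian_W2 r \<rho> \<mu> \<longleftrightarrow>
     sets \<mu> = sets (borel_W2 r) \<and>
     (\<forall>m y B. gaussian_system \<rho> m y \<and> B \<in> sets (PiM {..<m} (\<lambda>_. borel)) \<longrightarrow>
        (let \<sigma> = (\<lambda>j. inner_L2 (corr_op \<rho> (y j)) (y j)) in
          emeasure \<mu> {x \<in> W2 r. (\<lambda>j\<in>{..<m}. inner_W2 r x (weyl (- r) (y j))) \<in> B} =
          ennreal (\<Prod>j<m. (2 * pi * \<sigma> j) powr (- 1 / 2)) *
            (\<integral>\<^sup>+ u\<in>B. ennreal (exp (- (\<Sum>j<m. \<bar>u j\<bar>\<^sup>2 / (2 * \<sigma> j))))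
               \<partial>(PiM {..<m} (\<lambda>_. lborel)))))"


section \<open>Widths\<close>

definition closed_subspace :: "torus topology \<Rightarrow> torus set \<Rightarrow> bool" where
  "closed_subspace T M \<longleftrightarrow> subspace M \<and> closedin T M"

definition has_codim :: "torus set \<Rightarrow> torus set \<Rightarrow> nat \<Rightarrow> bool" where
  "has_codim X F n \<longleftrightarrow>
     (\<exists>B. finite B \<and> card B = n \<and> independent B \<and> F \<inter> span B = {0} \<and>
          {f + b | f b. f \<in> F \<and> b \<in> span B} = X)"

definition gelfand_subspaces :: "nat \<Rightarrow> torus set set" where
  "gelfand_subspaces n = {F. closed_subspace top_S F \<and> has_codim S_inf F n}"

definition proj_W2 :: "real \<Rightarrow> torus set \<Rightarrow> torus \<Rightarrow> torus" where
  "proj_W2 r M x = (THE q. q \<in> M \<and> (\<forall>z\<in>M. inner_W2 r (x - q) z = 0))"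

definition measure_on_subspace :: "real \<Rightarrow> torus measure \<Rightarrow> torus set \<Rightarrow> torus measure" where
  "measure_on_subspace r \<mu> M = distr \<mu> (restrict_space (borel_W2 r) M) (proj_W2 r M)"

definition exceptional_sets :: "real \<Rightarrow> torus measure \<Rightarrow> real \<Rightarrow> torus set set" where
  "exceptional_sets r \<mu> \<delta> =
     {G \<in> sets (borel_W2 r). emeasure \<mu> G \<le> ennreal \<delta> \<and> 0 \<notin> G \<and>
        (\<forall>M. closed_subspace (top_W2 r) M \<longrightarrow>
             emeasure (measure_on_subspace r \<mu> M) (G \<inter> M) \<le> ennreal \<delta>)}"

definition prob_gelfand_width :: "real \<Rightarrow> torus measure \<Rightarrow> nat \<Rightarrow> real \<Rightarrow> ennreal" where
  "prob_gelfand_width r \<mu> n \<delta> =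
     (INF G\<in>exceptional_sets r \<mu> \<delta>. INF F\<in>gelfand_subspaces n.
        SUP x\<in>(W2 r - G) \<inter> F. ennreal (norm_S x))"

definition ennreal_root :: "real \<Rightarrow> ennreal \<Rightarrow> ennreal" where
  "ennreal_root p a = (if a = \<infinity> then \<infinity> else ennreal (enn2real a powr (1 / p)))"

text \<open>
  The integral over \<open>W \<inter> F\<close> is taken with respect to the Gaussian measure \<open>\<mu>\<^sub>M\<close> that \<open>\<mu>\<close> induces on
  the closed subspace \<open>M = W \<inter> F\<close>. (The set \<open>M\<close> itself is \<open>\<mu>\<close>-null as soon as it is a proper
  subspace of \<open>W\<close>, so restricting \<open>\<mu>\<close> to \<open>M\<close> would make the integral vanish.)
\<close>

definition avg_gelfand_width :: "real \<Rightarrow> torus measure \<Rightarrow> nat \<Rightarrow> real \<Rightarrow> ennreal" where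
  "avg_gelfand_width r \<mu> n p =
     (INF F\<in>gelfand_subspaces n.
        ennreal_root p
          (\<integral>\<^sup>+ x. ennreal (norm_S x powr p) \<partial>(measure_on_subspace r \<mu> (W2 r \<inter> F))))"

definition comparable_on :: "'a set \<Rightarrow> ('a \<Rightarrow> ennreal) \<Rightarrow> ('a \<Rightarrow> real) \<Rightarrow> bool" where
  "comparable_on D a b \<longleftrightarrow>
     (\<exists>c1>0. \<exists>c2>0. \<forall>y\<in>D. ennreal (c1 * b y) \<le> a y \<and> a y \<le> ennreal (c2 * b y))"

end

theory Submission
  imports Defs "HOL-Probability.Probability" "HOL-Real_Asymp.Real_Asymp"
begin

text \<open>
  In the coordinates \<open>\<xi>\<^sub>j = \<langle>x, e\<^sub>j\<rangle>\<^sub>1\<close> with respect to the functions \<open>e\<^sub>j\<close> whose \<open>r\<close>-th derivatives are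
  the cosines and sines, the Sobolev space is \<open>\<ell>\<^sub>2\<close>, the Gaussian measure makes the \<open>\<xi>\<^sub>j\<close> independent
  normal variables of variance \<open>k\<^sub>j\<close> to the power \<open>-\<rho>\<close>, where \<open>k\<^sub>j\<close> is the frequency of \<open>e\<^sub>j\<close>, and the
  norm of \<open>S\<^sub>\<infinity>\<close> agrees, up to a factor \<open>\<surd>2\<close>, with the supremum of the weighted coordinates, \<open>k\<^sub>j\<close> to
  the power \<open>-r\<close> times \<open>\<bar>\<xi>\<^sub>j\<bar>\<close> (\<open>W2_hilbert_basis\<close>, \<open>gaussian_space_W2\<close>, \<open>norm_S_le_coords\<close>,
  \<open>coords_le_norm_S\<close>). Near frequency \<open>n\<close> the weighted coordinates have standard deviation of order
  \<open>n\<close> to the power \<open>-(r + \<rho>/2)\<close>, and the logarithm is the order of the square of the largest of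
  about \<open>n\<close> independent standard normal variables.

  Upper bounds. The subspace \<open>F\<close> is the common kernel of the first \<open>n\<close> trigonometric functionals, and
  the exceptional set \<open>E\<close> consists of the functions with norm above a threshold in the closed span of high
  frequencies that contains \<open>W \<inter> F\<close>. The delicate point is that \<open>E \<inter> M\<close> must be
  small under \<open>\<mu>\<^sub>M\<close> for every closed subspace \<open>M\<close>. If \<open>M\<close> is not contained in the span of the high
  frequencies, then some low coordinate of \<open>P\<^sub>M x\<close> is a non-degenerate normal variable, so almost surely
  \<open>P\<^sub>M x\<close> misses \<open>E\<close> (\<open>tail_space_null\<close>). If \<open>M\<close> is contained in it, then each coordinate of \<open>P\<^sub>M x\<close> is
  \<open>\<langle>x, P\<^sub>M e\<^sub>j\<rangle>\<^sub>1\<close> with \<open>P\<^sub>M e\<^sub>j\<close> in the span of the high frequencies, hence has at most the variance of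
  the lowest of these frequencies, whatever \<open>M\<close> is. The sum over \<open>j\<close> of the exponential moments
  (\<open>tail_exp_sum\<close>) therefore controls both the probability of exceeding the threshold and, for the
  average width, the \<open>p\<close>-th moment of the norm.

  Lower bounds. For a subspace \<open>F\<close> of codimension \<open>n\<close>, the intersection \<open>M\<close> of \<open>W\<close> and \<open>F\<close> has
  codimension at most \<open>n\<close> in \<open>W\<close>, so \<open>I - P\<^sub>M\<close> has trace at most \<open>n\<close> (\<open>defect_trace\<close>): among \<open>4n\<close>
  coordinates at least \<open>2n\<close> retain at least half of their diagonal entry in \<open>P\<^sub>M\<close>. By Bessel's inequality
  every row of \<open>I - P\<^sub>M\<close> has few large entries, and a greedy choice leaves about \<open>n\<close> to the power \<open>1/6\<close>
  coordinates whose mutual entries are tiny (\<open>almost_orthogonal_coordinates\<close>). Conditionally on all other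
  coordinates, these are independent shifted normal variables up to a small perturbation, so the
  probability that all of them stay below a small multiple of the conjectured size is a product that
  tends to \<open>0\<close> (\<open>conditional_bound\<close>, \<open>joint_bound\<close>, \<open>small_ball_prob\<close>). Thus the norm of \<open>P\<^sub>M x\<close> is of
  order \<open>\<surd>(ln n)\<close> times the standard deviation with probability above \<open>1/2\<close>, which is the lower bound for
  the average width, and for the probabilistic width as long as \<open>\<delta> \<ge> 1/n\<close>, because \<open>ln (n/\<delta>) \<le> 2 ln n\<close>
  there. For \<open>\<delta> < 1/n\<close> the term \<open>ln (1/\<delta>)\<close> dominates, and the tail of a single normal coordinate gives
  the estimate (\<open>tail_prob\<close>).
\<close>

section \<open>Hilbert spaces carried by a subset of a vector space\<close>

text \<open>
  The Sobolev space, \<open>L\<^sub>2\<close> and their closed subspaces are sets inside one vector space of functions, so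
  the Hilbert space is a carrier set rather than a type. Nonnegativity and invariance under \<open>x \<mapsto> -x\<close> are
  required of all vectors, also outside \<open>V\<close>, because a metric space on a carrier has to be
  nonnegative and symmetric on the whole type.
\<close>

locale hilbert =
  fixes V :: "'a::real_vector set" and ip :: "'a \<Rightarrow> 'a \<Rightarrow> real"
  assumes subspace: "subspace V"
    and commute: "x \<in> V \<Longrightarrow> y \<in> V \<Longrightarrow> ip x y = ip y x"
    and add_left: "x \<in> V \<Longrightarrow> y \<in> V \<Longrightarrow> z \<in> V \<Longrightarrow> ip (x + y) z = ip x z + ip y z"
    and scale_left: "x \<in> V \<Longrightarrow> z \<in> V \<Longrightarrow> ip (c *\<^sub>R x) z = c * ip x z"
    and pos: "x \<in> V \<Longrightarrow> x \<noteq> 0 \<Longrightarrow> 0 < ip x x"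
    and nonneg [simp]: "0 \<le> ip x x"
    and ip_uminus: "ip (- x) (- x) = ip x x"
    and complete: "(\<And>n. s n \<in> V) \<Longrightarrow>
      (\<And>e. e > 0 \<Longrightarrow> \<exists>N. \<forall>m\<ge>N. \<forall>n\<ge>N. ip (s m - s n) (s m - s n) < e) \<Longrightarrow>
      \<exists>x\<in>V. (\<lambda>n. ip (s n - x) (s n - x)) \<longlonglongrightarrow> 0"
begin

lemma mem [simp, intro]:
  shows "0 \<in> V" "x \<in> V \<Longrightarrow> y \<in> V \<Longrightarrow> x + y \<in> V" "x \<in> V \<Longrightarrow> c *\<^sub>R x \<in> V"
    "x \<in> V \<Longrightarrow> y \<in> V \<Longrightarrow> x - y \<in> V" "x \<in> V \<Longrightarrow> - x \<in> V"
    "(\<And>i. i \<in> I \<Longrightarrow> f i \<in> V) \<Longrightarrow> sum f I \<in> V"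
  using subspace by (auto intro: subspace_0 subspace_add subspace_scale subspace_diff subspace_neg subspace_sum)

lemma minus_left: "x \<in> V \<Longrightarrow> z \<in> V \<Longrightarrow> ip (- x) z = - ip x z"
  using scale_left[of x z "-1"] by simp

lemma diff_left: "x \<in> V \<Longrightarrow> y \<in> V \<Longrightarrow> z \<in> V \<Longrightarrow> ip (x - y) z = ip x z - ip y z"
  using add_left[of x "- y" z] by (simp add: minus_left)

lemma zero_left [simp]: "z \<in> V \<Longrightarrow> ip 0 z = 0"
  using scale_left[of 0 z 0] by simp

lemma zero_right [simp]: "z \<in> V \<Longrightarrow> ip z 0 = 0"
  using commute[of z 0] by simp

lemma add_right: "x \<in> V \<Longrightarrow> y \<in> V \<Longrightarrow> z \<in> V \<Longrightarrow> ip z (x + y) = ip z x + ip z y"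
  by (simp add: commute[of z] add_left)

lemma diff_right: "x \<in> V \<Longrightarrow> y \<in> V \<Longrightarrow> z \<in> V \<Longrightarrow> ip z (x - y) = ip z x - ip z y"
  by (simp add: commute[of z] diff_left)

lemma scale_right: "x \<in> V \<Longrightarrow> z \<in> V \<Longrightarrow> ip z (c *\<^sub>R x) = c * ip z x"
  by (simp add: commute[of z] scale_left)

lemmas bilinear = add_left diff_left scale_left add_right diff_right scale_right

lemma sum_left: "(\<And>i. i \<in> I \<Longrightarrow> f i \<in> V) \<Longrightarrow> z \<in> V \<Longrightarrow> ip (\<Sum>i\<in>I. f i) z = (\<Sum>i\<in>I. ip (f i) z)"
  by (induction I rule: infinite_finite_induct) (auto simp: add_left)

lemma ip_eq_0_iff: "x \<in> V \<Longrightarrow> ip x x = 0 \<longleftrightarrow> x = 0"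
  using pos[of x] by (cases "x = 0") auto

lemma Cauchy_Schwarz:
  assumes "x \<in> V" "y \<in> V"
  shows "(ip x y)\<^sup>2 \<le> ip x x * ip y y"
proof (cases "y = 0")
  case False
  let ?r = "ip x y / ip y y"
  have p: "ip y y > 0" using pos assms False by auto
  have "0 \<le> ip (x - ?r *\<^sub>R y) (x - ?r *\<^sub>R y)" by (rule nonneg)
  also have "\<dots> = ip x x - (ip x y)\<^sup>2 / ip y y"
    using assms p by (simp add: bilinear commute[of y x] power2_eq_square field_simps)
  finally show ?thesis using p by (simp add: field_simps)
qed (use assms in auto)

definition nrm :: "'a \<Rightarrow> real" where "nrm x = sqrt (ip x x)"

lemma nrm_power2: "(nrm x)\<^sup>2 = ip x x"
  by (simp add: nrm_def)

lemma nrm_nonneg [simp]: "0 \<le> nrm x"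
  by (simp add: nrm_def)

lemma abs_ip_le: "x \<in> V \<Longrightarrow> y \<in> V \<Longrightarrow> \<bar>ip x y\<bar> \<le> nrm x * nrm y"
  using real_sqrt_le_mono[OF Cauchy_Schwarz[of x y]] by (simp add: nrm_def real_sqrt_mult)

lemma nrm_triangle:
  assumes "x \<in> V" "y \<in> V"
  shows "nrm (x + y) \<le> nrm x + nrm y"
proof (rule power2_le_imp_le)
  have "(nrm (x + y))\<^sup>2 = ip x x + 2 * ip x y + ip y y"
    using assms by (simp add: nrm_power2 bilinear commute[of y x])
  also have "\<dots> \<le> (nrm x)\<^sup>2 + 2 * (nrm x * nrm y) + (nrm y)\<^sup>2"
    using abs_ip_le[OF assms] assms by (simp add: nrm_power2)
  finally show "(nrm (x + y))\<^sup>2 \<le> (nrm x + nrm y)\<^sup>2" by (simp add: power2_eq_square algebra_simps)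
qed (use assms in simp)

lemma nrm_minus_commute: "nrm (x - y) = nrm (y - x)"
  using ip_uminus[of "x - y"] by (simp add: nrm_def)

sublocale M: Metric_space V "\<lambda>x y. nrm (x - y)"
proof
  fix x y z assume *: "x \<in> V" "y \<in> V"
  then show "nrm (x - y) = 0 \<longleftrightarrow> x = y" by (simp add: nrm_def ip_eq_0_iff)
  assume "z \<in> V"
  then show "nrm (x - z) \<le> nrm (x - y) + nrm (y - z)"
    using nrm_triangle[of "x - y" "y - z"] * by simp
qed (simp_all add: nrm_minus_commute)

subsection \<open>Orthogonal projections\<close>

text \<open>
  The same description of the projection as in the definition of the measures \<open>\<mu>\<^sub>M\<close>; it makes sense for
  every set, and \<open>projection_exists\<close> shows that it describes a vector if \<open>M\<close> is a closed subspace.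
\<close>

definition proj :: "'a set \<Rightarrow> 'a \<Rightarrow> 'a" where
  "proj M x = (THE q. q \<in> M \<and> (\<forall>z\<in>M. ip (x - q) z = 0))"

text \<open>
  A sequence in \<open>M\<close> minimising the distance to \<open>x\<close> is Cauchy by the parallelogram law, and its limit \<open>q\<close>
  lies in \<open>M\<close>. Orthogonality comes from the near-minimality of the members: moving \<open>s n\<close> in the
  direction \<open>z\<close> can lower the squared distance by at most \<open>1 / Suc n\<close>, which bounds \<open>ip (x - s n) z\<close>.
\<close>

lemma projection_exists:
  assumes M: "Real_Vector_Spaces.subspace M" "closedin M.mtopology M" and x: "x \<in> V"
  shows "\<exists>q\<in>M. \<forall>z\<in>M. ip (x - q) z = 0"
proof -
  have MV: "M \<subseteq> V" using M(2) closedin_subset by fastforce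
  have M0: "0 \<in> M" using M(1) by (rule subspace_0)
  define D where "D = (INF m\<in>M. ip (x - m) (x - m))"
  have D_le: "D \<le> ip (x - m) (x - m)" if "m \<in> M" for m
    unfolding D_def by (rule cINF_lower) (use that in \<open>auto intro!: bdd_belowI[of _ 0]\<close>)
  have "\<exists>m\<in>M. ip (x - m) (x - m) < D + 1 / Suc n" for n
    using cInf_lessD[of "(\<lambda>m. ip (x - m) (x - m)) ` M" "D + 1 / Suc n"] M0
    by (auto simp: D_def)
  then obtain s where s: "\<And>n. s n \<in> M" "\<And>n. ip (x - s n) (x - s n) < D + 1 / Suc n"
    by metis
  have sV: "s n \<in> V" for n using s MV by auto
  \<comment> \<open>parallelogram law, applied to the midpoint of two near-minimisers\<close>
  have par: "ip (s m - s n) (s m - s n) \<le> 2 / Suc m + 2 / Suc n" for m n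
  proof -
    let ?h = "(1/2) *\<^sub>R (s m + s n)"
    have "?h \<in> M" using s M(1) by (simp add: subspace_add subspace_scale)
    moreover have "ip (s m - s n) (s m - s n) + 4 * ip (x - ?h) (x - ?h)
        = 2 * ip (x - s m) (x - s m) + 2 * ip (x - s n) (x - s n)"
      using x sV by (simp add: bilinear commute[of "s _" x] commute[of "s n" "s m"] field_simps)
    ultimately show ?thesis using s(2)[of m] s(2)[of n] D_le[of ?h] by simp
  qed
  obtain q where q: "q \<in> V" "(\<lambda>n. ip (s n - q) (s n - q)) \<longlonglongrightarrow> 0"
  proof -
    have "\<exists>N. \<forall>m\<ge>N. \<forall>n\<ge>N. ip (s m - s n) (s m - s n) < e" if "e > 0" for e
    proof -
      obtain N where N: "4 / e < real (Suc N)" using reals_Archimedean2[of "4/e"]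
        by (metis lessI less_trans of_nat_less_iff)
      have "ip (s m - s n) (s m - s n) < e" if "m \<ge> N" "n \<ge> N" for m n
      proof -
        have "2 / Suc m + 2 / Suc n \<le> 2 / Suc N + 2 / real (Suc N)"
          by (intro add_mono divide_left_mono) (use that in auto)
        also have "\<dots> = 4 / real (Suc N)" by simp
        also have "\<dots> < e" using N \<open>e > 0\<close> by (simp add: field_simps)
        finally show ?thesis using par[of m n] by simp
      qed
      then show ?thesis by blast
    qed
    then show ?thesis using complete[of s] sV that by blast
  qed
  have lim_nrm: "(\<lambda>n. nrm (s n - q)) \<longlonglongrightarrow> 0"
    using tendsto_real_sqrt[OF q(2)] by (simp add: nrm_def)
  then have "limitin M.mtopology s q sequentially"
    using q(1) sV by (subst M.limitin_metric_dist_null) auto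
  then have qM: "q \<in> M"
    using M(2) s(1) by (metis limitin_closedin eventually_sequentiallyI trivial_limit_sequentially)
  have "ip (x - q) z = 0" if z: "z \<in> M" for z
  proof -
    have zV: "z \<in> V" using z MV by auto
    have bound: "(ip (x - s n) z)\<^sup>2 \<le> (1 / Suc n) * ip z z" for n
    proof (cases "z = 0")
      case False
      then have p: "ip z z > 0" using pos zV by auto
      let ?b = "ip (x - s n) z" let ?t = "?b / ip z z"
      have "s n + ?t *\<^sub>R z \<in> M" using s z M(1) by (simp add: subspace_add subspace_scale)
      from D_le[OF this] have "D \<le> ip ((x - s n) - ?t *\<^sub>R z) ((x - s n) - ?t *\<^sub>R z)"
        by (simp add: algebra_simps)
      also have "\<dots> = ip (x - s n) (x - s n) - ?b\<^sup>2 / ip z z"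
        using x sV zV p by (simp add: bilinear commute[of z "x - s n"] commute[of z x] commute[of z "s n"] power2_eq_square field_simps)
      finally have "?b\<^sup>2 / ip z z \<le> 1 / Suc n" using s(2)[of n] by simp
      then show ?thesis using p by (simp add: divide_le_eq)
    qed (use x sV in simp)
    have "(\<lambda>n. (1 / Suc n) * ip z z) \<longlonglongrightarrow> 0"
      using tendsto_mult_left_zero[OF LIMSEQ_inverse_real_of_nat, of "ip z z"] by (simp add: inverse_eq_divide)
    then have "(\<lambda>n. (ip (x - s n) z)\<^sup>2) \<longlonglongrightarrow> 0"
      by (rule Lim_null_comparison[rotated]) (use bound in auto)
    then have 1: "(\<lambda>n. ip (x - s n) z) \<longlonglongrightarrow> 0"
      using tendsto_real_sqrt[of _ 0] by (fastforce simp: tendsto_rabs_zero_iff)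
    have "(\<lambda>n. nrm (s n - q) * nrm z) \<longlonglongrightarrow> 0" using tendsto_mult_left_zero[OF lim_nrm] .
    then have 2: "(\<lambda>n. ip (s n - q) z) \<longlonglongrightarrow> 0"
      by (rule Lim_null_comparison[rotated]) (use abs_ip_le[of "s _ - q" z] sV q zV in auto)
    have "(\<lambda>n. ip (x - q) z) \<longlonglongrightarrow> 0"
      using tendsto_add[OF 1 2] x sV q zV by (simp add: diff_left)
    then show ?thesis by (simp add: LIMSEQ_const_iff)
  qed
  then show ?thesis using qM by blast
qed

definition closed_sub :: "'a set \<Rightarrow> bool" where
  "closed_sub M \<longleftrightarrow> Real_Vector_Spaces.subspace M \<and> closedin M.mtopology M"

lemma closed_sub_subset: "closed_sub M \<Longrightarrow> M \<subseteq> V"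
  unfolding closed_sub_def using closedin_subset by fastforce

lemma proj_eqI:
  assumes "closed_sub M" "x \<in> V" "q \<in> M" "\<And>z. z \<in> M \<Longrightarrow> ip (x - q) z = 0"
  shows "proj M x = q"
  unfolding proj_def
proof (rule the_equality)
  fix q' assume q': "q' \<in> M \<and> (\<forall>z\<in>M. ip (x - q') z = 0)"
  have V: "q \<in> V" "q' \<in> V" using assms q' closed_sub_subset by auto
  have d: "q - q' \<in> M" using assms q' by (simp add: closed_sub_def subspace_diff)
  have "ip (q - q') (q - q') = ip (x - q') (q - q') - ip (x - q) (q - q')"
    using V assms(2) by (simp add: bilinear)
  also have "\<dots> = 0" using q' d assms(4) by simp
  finally show "q' = q" using ip_eq_0_iff[of "q - q'"] V by simp
qed (use assms in auto)

lemma proj_mem_orth: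
  assumes "closed_sub M" "x \<in> V"
  shows "proj M x \<in> M" "z \<in> M \<Longrightarrow> ip (x - proj M x) z = 0"
proof -
  obtain q where "q \<in> M" "\<forall>z\<in>M. ip (x - q) z = 0"
    using projection_exists[of M x] assms by (auto simp: closed_sub_def)
  moreover from this have "proj M x = q" using assms by (intro proj_eqI) auto
  ultimately show "proj M x \<in> M" "z \<in> M \<Longrightarrow> ip (x - proj M x) z = 0" by auto
qed

lemma proj_in_V [simp]: "closed_sub M \<Longrightarrow> x \<in> V \<Longrightarrow> proj M x \<in> V"
  using proj_mem_orth(1) closed_sub_subset by blast

lemma proj_ip:
  assumes "closed_sub M" "x \<in> V" "z \<in> M"
  shows "ip (proj M x) z = ip x z"
  using proj_mem_orth(2)[OF assms(1,2,3)] assms closed_sub_subset[OF assms(1)]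
  by (subst (asm) diff_left) auto

lemma proj_selfadjoint:
  assumes "closed_sub M" "x \<in> V" "y \<in> V"
  shows "ip (proj M x) y = ip x (proj M y)"
  using proj_ip[OF assms(1,2) proj_mem_orth(1)[OF assms(1,3)]]
    proj_ip[OF assms(1,3) proj_mem_orth(1)[OF assms(1,2)]] assms
  by (simp add: commute[of y] commute[of "proj M y"])

lemma proj_ip_self:
  assumes "closed_sub M" "x \<in> V"
  shows "ip (proj M x) (proj M x) = ip (proj M x) x"
  using proj_ip[OF assms(1,2) proj_mem_orth(1)[OF assms]] assms by (simp add: commute)

lemma proj_contraction:
  assumes "closed_sub M" "x \<in> V"
  shows "ip (proj M x) (proj M x) \<le> ip x x"
proof -
  have "0 \<le> ip (x - proj M x) (x - proj M x)" by simp
  also have "\<dots> = ip x x - ip (proj M x) (proj M x)"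
    using assms by (simp add: bilinear commute[of x "proj M x"] proj_ip_self)
  finally show ?thesis by simp
qed

lemma proj_diff:
  assumes "closed_sub M" "x \<in> V" "y \<in> V"
  shows "proj M (x - y) = proj M x - proj M y"
proof (rule proj_eqI)
  show "proj M x - proj M y \<in> M"
    using assms proj_mem_orth(1) by (metis closed_sub_def subspace_diff)
  fix z assume z: "z \<in> M"
  have "ip (x - y - (proj M x - proj M y)) z = ip (x - proj M x) z - ip (y - proj M y) z"
    using assms z closed_sub_subset by (subst diff_left[symmetric]) (auto simp: algebra_simps)
  then show "ip (x - y - (proj M x - proj M y)) z = 0"
    using proj_mem_orth(2) assms z by simp
qed (use assms in auto)

subsection \<open>Orthonormal systems\<close>

lemma sum_ip_orthonormal:
  assumes "finite A" "\<And>i. i \<in> A \<Longrightarrow> e i \<in> V"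
    and "\<And>i j. i \<in> A \<Longrightarrow> j \<in> A \<Longrightarrow> ip (e i) (e j) = (if i = j then 1 else 0)"
    and "j \<in> A"
  shows "ip (\<Sum>i\<in>A. a i *\<^sub>R e i) (e j) = a j"
proof -
  have "ip (\<Sum>i\<in>A. a i *\<^sub>R e i) (e j) = (\<Sum>i\<in>A. ip (a i *\<^sub>R e i) (e j))"
    using assms by (intro sum_left) auto
  also have "\<dots> = (\<Sum>i\<in>A. if i = j then a j else 0)"
    using assms by (intro sum.cong) (auto simp: scale_left)
  finally show ?thesis using assms by simp
qed

lemma ip_orthonormal_sum_self:
  assumes "finite A" "\<And>i. i \<in> A \<Longrightarrow> e i \<in> V"
    and "\<And>i j. i \<in> A \<Longrightarrow> j \<in> A \<Longrightarrow> ip (e i) (e j) = (if i = j then 1 else 0)"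
  shows "ip (\<Sum>i\<in>A. a i *\<^sub>R e i) (\<Sum>i\<in>A. a i *\<^sub>R e i) = (\<Sum>i\<in>A. (a i)\<^sup>2)"
proof -
  let ?s = "\<Sum>i\<in>A. a i *\<^sub>R e i"
  have s: "?s \<in> V" using assms by auto
  have "ip ?s ?s = (\<Sum>i\<in>A. ip (a i *\<^sub>R e i) ?s)"
    using assms s by (intro sum_left) auto
  also have "\<dots> = (\<Sum>i\<in>A. (a i)\<^sup>2)"
    using assms s
    by (intro sum.cong) (auto simp: scale_left commute[of "e _" ?s] sum_ip_orthonormal power2_eq_square)
  finally show ?thesis .
qed

lemma Bessel:
  assumes "finite A" "\<And>i. i \<in> A \<Longrightarrow> e i \<in> V"
    and "\<And>i j. i \<in> A \<Longrightarrow> j \<in> A \<Longrightarrow> ip (e i) (e j) = (if i = j then 1 else 0)"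
    and x: "x \<in> V"
  shows "(\<Sum>i\<in>A. (ip x (e i))\<^sup>2) \<le> ip x x"
proof -
  let ?s = "\<Sum>i\<in>A. ip x (e i) *\<^sub>R e i"
  have s: "?s \<in> V" using assms by auto
  have "ip x ?s = (\<Sum>i\<in>A. ip (ip x (e i) *\<^sub>R e i) x)"
    using assms s by (subst commute) (auto intro!: sum_left)
  also have "\<dots> = (\<Sum>i\<in>A. (ip x (e i))\<^sup>2)"
    using assms by (intro sum.cong) (auto simp: scale_left power2_eq_square commute[of x "e _"])
  finally have "ip (x - ?s) (x - ?s) = ip x x - (\<Sum>i\<in>A. (ip x (e i))\<^sup>2)"
    using x s ip_orthonormal_sum_self[OF assms(1-3), where a="\<lambda>i. ip x (e i)"]
    by (simp add: bilinear commute[of ?s x])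
  then show ?thesis using nonneg[of "x - ?s"] by simp
qed

end

locale hilbert_basis = hilbert V ip for V :: "'a::real_vector set" and ip +
  fixes e :: "nat \<Rightarrow> 'a"
  assumes e_mem [simp]: "e j \<in> V"
    and e_orth: "ip (e i) (e j) = (if i = j then 1 else 0)"
    and total: "x \<in> V \<Longrightarrow> (\<And>j. ip x (e j) = 0) \<Longrightarrow> x = 0"
begin

lemma coeffs_square_summable:
  assumes "x \<in> V" shows "summable (\<lambda>j. (ip x (e j))\<^sup>2)"
  by (rule bounded_imp_summable[where B = "ip x x"])
     (use Bessel[of _ e x] e_orth assms in auto)

text \<open>
  The partial sums are Cauchy by Pythagoras, and their limit has the right coefficients since the
  inner product with \<open>e j\<close> is continuous.
\<close>

lemma Riesz_Fischer_lim:
  assumes a: "summable (\<lambda>j. (a j)\<^sup>2)"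
  shows "\<exists>x\<in>V. (\<forall>j. ip x (e j) = a j) \<and> (\<lambda>n. nrm ((\<Sum>i<n. a i *\<^sub>R e i) - x)) \<longlonglongrightarrow> 0"
proof -
  define s where "s n = (\<Sum>i<n. a i *\<^sub>R e i)" for n
  have sV [simp]: "s n \<in> V" for n by (auto simp: s_def)
  have diff: "ip (s m - s n) (s m - s n) \<le> \<bar>\<Sum>i\<in>{n..<m}. (a i)\<^sup>2\<bar>" if "n \<le> m" for m n
  proof -
    have "s m - s n = (\<Sum>i\<in>{n..<m}. a i *\<^sub>R e i)"
      unfolding s_def using that by (metis atLeast0LessThan sum_diff_nat_ivl zero_le)
    then show ?thesis using ip_orthonormal_sum_self[of "{n..<m}" e a] e_orth by simp
  qed
  have cauchy: "\<exists>N. \<forall>m\<ge>N. \<forall>n\<ge>N. ip (s m - s n) (s m - s n) < \<epsilon>" if "\<epsilon> > 0" for \<epsilon>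
  proof -
    from a[unfolded summable_Cauchy] that obtain N where
      N: "\<And>m n. m \<ge> N \<Longrightarrow> norm (\<Sum>i\<in>{m..<n}. (a i)\<^sup>2) < \<epsilon>" by blast
    have "ip (s m - s n) (s m - s n) < \<epsilon>" if "m \<ge> N" "n \<ge> N" for m n
    proof (cases "n \<le> m")
      case True
      then show ?thesis using diff[of n m] N[of n m] that by simp
    next
      case False
      then show ?thesis using diff[of m n] N[of m n] that ip_uminus[of "s m - s n"] by simp
    qed
    then show ?thesis by blast
  qed
  obtain x where x: "x \<in> V" "(\<lambda>n. ip (s n - x) (s n - x)) \<longlonglongrightarrow> 0"
    using complete[of s, OF sV cauchy] by blast
  have lim: "(\<lambda>n. nrm (s n - x)) \<longlonglongrightarrow> 0"
    using tendsto_real_sqrt[OF x(2)] by (simp add: nrm_def)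
  have "ip x (e j) = a j" for j
  proof -
    have "(\<lambda>n. ip (s n - x) (e j)) \<longlonglongrightarrow> 0"
      by (rule Lim_null_comparison[OF _ lim])
         (use abs_ip_le[of "s _ - x" "e j"] x e_orth in \<open>auto simp: nrm_def\<close>)
    moreover have "\<forall>\<^sub>F n in sequentially. ip (s n - x) (e j) = a j - ip x (e j)"
      using eventually_gt_at_top[of j]
    proof eventually_elim
      case (elim n)
      then have "ip (s n) (e j) = a j" unfolding s_def by (intro sum_ip_orthonormal) (auto simp: e_orth)
      then show ?case using x by (simp add: diff_left)
    qed
    ultimately have "(\<lambda>n::nat. a j - ip x (e j)) \<longlonglongrightarrow> 0" by (simp add: tendsto_cong)
    then show ?thesis by (simp add: LIMSEQ_const_iff)
  qed
  then show ?thesis using x lim by (auto simp: s_def)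
qed

lemma Riesz_Fischer: "summable (\<lambda>j. (a j)\<^sup>2) \<Longrightarrow> \<exists>x\<in>V. \<forall>j. ip x (e j) = a j"
  using Riesz_Fischer_lim by blast

text \<open>
  The Fourier series of \<open>x\<close> converges to some \<open>x'\<close> with the same coefficients, and \<open>x - x'\<close> vanishes
  because the system is total.
\<close>

lemma Parseval:
  assumes x: "x \<in> V" and y: "y \<in> V"
  shows "(\<lambda>j. ip x (e j) * ip y (e j)) sums ip x y"
proof -
  let ?s = "\<lambda>n. \<Sum>i<n. ip x (e i) *\<^sub>R e i"
  obtain x' where x': "x' \<in> V" "\<forall>j. ip x' (e j) = ip x (e j)" "(\<lambda>n. nrm (?s n - x')) \<longlonglongrightarrow> 0"
    using Riesz_Fischer_lim[OF coeffs_square_summable[OF x]] by blast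
  have "x - x' = 0" by (rule total) (use x x' in \<open>auto simp: diff_left\<close>)
  then have lim: "(\<lambda>n. nrm (?s n - x)) \<longlonglongrightarrow> 0" using x' by simp
  have "(\<lambda>n. nrm (?s n - x) * nrm y) \<longlonglongrightarrow> 0" using tendsto_mult_left_zero[OF lim] .
  then have "(\<lambda>n. ip (?s n - x) y) \<longlonglongrightarrow> 0"
    by (rule Lim_null_comparison[rotated])
       (use abs_ip_le[of "?s _ - x" y] x y in auto)
  then have "(\<lambda>n. ip (?s n) y) \<longlonglongrightarrow> ip x y"
    using x y by (simp add: diff_left LIM_zero_iff)
  moreover have "ip (?s n) y = (\<Sum>i<n. ip x (e i) * ip y (e i))" for n
    using y by (subst sum_left) (auto simp: scale_left commute[of y])
  ultimately show ?thesis by (simp add: sums_def)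
qed

end

section \<open>Fourier analysis on the torus\<close>

lemma space_torus_measure [simp]: "space torus_measure = {0..2 * pi}"
  by (simp add: torus_measure_def)

interpretation torus_measure: finite_measure torus_measure
  by standard (simp add: torus_measure_def emeasure_restrict_space)

lemma measure_torus: "measure torus_measure {0..2 * pi} = 2 * pi"
  by (simp add: torus_measure_def measure_restrict_space)

lemma continuous_measurable_torus:
  fixes h :: "real \<Rightarrow> 'a::euclidean_space"
  shows "continuous_on UNIV h \<Longrightarrow> h \<in> borel_measurable torus_measure"
  unfolding torus_measure_def
  by (rule continuous_imp_measurable_on_sets_lebesgue) (auto intro: continuous_on_subset)

lemma integrable_torus_continuous_bounded:
  fixes h :: "real \<Rightarrow> 'a::{euclidean_space, real_normed_field}"
  assumes f: "integrable torus_measure (f :: real \<Rightarrow> real)"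
    and h: "continuous_on UNIV h" and b: "\<And>t. norm (h t) \<le> B"
  shows "integrable torus_measure (\<lambda>t. of_real (f t) * h t)"
proof (rule Bochner_Integration.integrable_bound[OF integrable_mult_left[OF f, of B]])
  have [measurable]: "f \<in> borel_measurable torus_measure" "h \<in> borel_measurable torus_measure"
    using f continuous_measurable_torus[OF h] by auto
  show "(\<lambda>t. of_real (f t) * h t) \<in> borel_measurable torus_measure"
    by (intro borel_measurable_times) (auto intro: borel_measurable_of_real)
  show "AE t in torus_measure. norm (of_real (f t) * h t) \<le> norm (f t * B)"
  proof (intro AE_I2)
    fix t
    have "norm (h t) \<le> \<bar>B\<bar>" using b[of t] by linarith
    then show "norm (of_real (f t) * h t) \<le> norm (f t * B)"
      by (simp add: norm_mult abs_mult mult_left_mono)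
  qed
qed

lemma integrable_torus_continuous:
  fixes h :: "real \<Rightarrow> 'a::{euclidean_space, real_normed_field}"
  assumes h: "continuous_on UNIV h" and b: "\<And>t. norm (h t) \<le> B"
  shows "integrable torus_measure h"
  using integrable_torus_continuous_bounded[of "\<lambda>_. 1", OF _ h b] by simp

subsection \<open>A function is determined by its Fourier coefficients\<close>

text \<open>
  Stated as a closure, so that integrals against trigonometric polynomials can be treated by
  induction; the multiples are complex, so that cosine and sine are included.
\<close>

inductive trig_poly :: "(real \<Rightarrow> complex) \<Rightarrow> bool" where
  trig_poly_exp: "trig_poly (\<lambda>t. exp (- (\<i> * of_int k * of_real t)))"
| trig_poly_add: "trig_poly f \<Longrightarrow> trig_poly g \<Longrightarrow> trig_poly (\<lambda>t. f t + g t)"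
| trig_poly_scale: "trig_poly f \<Longrightarrow> trig_poly (\<lambda>t. c * f t)"

lemma trig_poly_mult:
  assumes "trig_poly f" "trig_poly g"
  shows "trig_poly (\<lambda>t. f t * g t)"
  using assms
proof (induction f rule: trig_poly.induct)
  case (trig_poly_exp k)
  then show ?case
  proof (induction g rule: trig_poly.induct)
    case (trig_poly_exp l)
    show ?case using trig_poly.trig_poly_exp[of "k + l"]
      by (simp add: exp_add[symmetric] algebra_simps)
  next
    case (trig_poly_add f g)
    then show ?case using trig_poly.trig_poly_add by (force simp: algebra_simps)
  next
    case (trig_poly_scale f c)
    then show ?case using trig_poly.trig_poly_scale[OF trig_poly_scale.IH, of c]
      by (simp add: algebra_simps)
  qed
next
  case (trig_poly_add f g')
  then show ?case using trig_poly.trig_poly_add by (force simp: algebra_simps)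
next
  case (trig_poly_scale f c)
  then show ?case using trig_poly.trig_poly_scale[of "\<lambda>t. f t * g t" c]
    by (simp add: algebra_simps)
qed

lemma trig_poly_const: "trig_poly (\<lambda>_. c)"
  using trig_poly_scale[OF trig_poly_exp[of 0], of c] by simp

text \<open>
  A linear function of \<open>cis t\<close> is a combination of \<open>cos t\<close> and \<open>sin t\<close>, that is of the exponentials with
  frequencies \<open>1\<close> and \<open>-1\<close>; products are covered by \<open>trig_poly_mult\<close>.
\<close>

lemma trig_poly_real_polynomial:
  fixes g :: "complex \<Rightarrow> real"
  assumes "real_polynomial_function g"
  shows "trig_poly (\<lambda>t. of_real (g (cis t)))"
  using assms
proof (induction g rule: real_polynomial_function.induct)
  case (linear f)
  interpret f: bounded_linear f by fact
  have lin: "f z = Re z * f 1 + Im z * f \<i>" for z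
  proof -
    have "f z = f (Re z *\<^sub>R 1 + Im z *\<^sub>R \<i>)" by (rule arg_cong[of _ _ f]) (simp add: complex_eq_iff)
    then show ?thesis by (simp only: f.add f.scaleR real_scaleR_def)
  qed
  have "complex_of_real (f (cis t)) =
      ((f 1 + \<i> * f \<i>) / 2) * exp (- (\<i> * of_int 1 * of_real t)) +
      ((f 1 - \<i> * f \<i>) / 2) * exp (- (\<i> * of_int (-1) * of_real t))" for t
    unfolding lin[of "cis t"] by (simp add: complex_eq_iff Re_exp Im_exp field_simps)
  then show ?case
    by (simp only:) (intro trig_poly_add trig_poly_scale trig_poly_exp)
next
  case (const c)
  show ?case by (rule trig_poly_const)
next
  case (add f g)
  then show ?case using trig_poly_add[OF add.IH] by simp
next
  case (mult f g)
  then show ?case using trig_poly_mult[OF mult.IH] by simp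
qed

lemma trig_poly_continuous_bounded:
  "trig_poly h \<Longrightarrow> continuous_on UNIV h \<and> (\<exists>B. \<forall>t. norm (h t) \<le> B)"
proof (induction h rule: trig_poly.induct)
  case (trig_poly_exp k)
  show ?case by (auto intro!: continuous_intros exI[of _ 1])
next
  case (trig_poly_add f g)
  then obtain B C where "\<And>t. norm (f t) \<le> B" "\<And>t. norm (g t) \<le> C" by auto
  then have "norm (f t + g t) \<le> B + C" for t by (meson add_mono norm_triangle_le)
  then show ?case using trig_poly_add by (auto intro: continuous_on_add)
next
  case (trig_poly_scale f c)
  then obtain B where "\<And>t. norm (f t) \<le> B" by auto
  then have "norm (c * f t) \<le> norm c * B" for t by (simp add: norm_mult mult_left_mono)
  then show ?case using trig_poly_scale by (auto intro: continuous_on_mult_left)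
qed

lemma trig_poly_orthogonal:
  assumes f: "integrable torus_measure f"
    and 0: "\<And>k. (LINT t|torus_measure. of_real (f t) * exp (- (\<i> * of_int k * of_real t))) = 0"
    and "trig_poly h"
  shows "(LINT t|torus_measure. complex_of_real (f t) * h t) = 0"
  using assms(3)
proof (induction h rule: trig_poly.induct)
  case (trig_poly_exp k)
  show ?case by (rule 0)
next
  case (trig_poly_add g h)
  have i: "integrable torus_measure (\<lambda>t. complex_of_real (f t) * u t)" if "trig_poly u" for u
    using trig_poly_continuous_bounded[OF that] integrable_torus_continuous_bounded[OF f] by blast
  show ?case using trig_poly_add by (simp add: distrib_left Bochner_Integration.integral_add i)
next
  case (trig_poly_scale g c)
  then show ?case by (simp add: mult.left_commute[of _ c])
qed

lemma continuous_on_cis': "continuous_on S cis"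
  unfolding cis_conv_exp by (intro continuous_intros)

text \<open>
  By the Stone-Weierstrass theorem \<open>G\<close> is, uniformly on the unit circle, within \<open>\<epsilon>\<close> of a polynomial in the
  real coordinates. Composed with \<open>cis\<close>, that polynomial is a trigonometric polynomial, to which \<open>f\<close> is
  orthogonal, and the error costs at most \<open>\<epsilon>\<close> times the \<open>L\<^sub>1\<close> norm of \<open>f\<close>.
\<close>

lemma integral_circle_continuous_zero:
  fixes G :: "complex \<Rightarrow> real"
  assumes f: "integrable torus_measure f"
    and 0: "\<And>k. (LINT t|torus_measure. of_real (f t) * exp (- (\<i> * of_int k * of_real t))) = 0"
    and G: "continuous_on UNIV G" and B: "\<And>z. \<bar>G z\<bar> \<le> B"
  shows "(LINT t|torus_measure. f t * G (cis t)) = 0"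
proof -
  define I where "I = (LINT t|torus_measure. f t * G (cis t))"
  define A where "A = (LINT t|torus_measure. \<bar>f t\<bar>)"
  have A: "A \<ge> 0" unfolding A_def by simp
  have cG: "continuous_on UNIV (\<lambda>t. G (cis t))"
    by (rule continuous_on_compose2[OF G continuous_on_cis']) simp
  have iG: "integrable torus_measure (\<lambda>t. f t * G (cis t))"
    using integrable_torus_continuous_bounded[OF f cG, of B] B by simp
  have bound: "\<bar>I\<bar> \<le> A * \<epsilon>" if eps: "\<epsilon> > 0" for \<epsilon>
  proof -
    obtain g where g: "real_polynomial_function g" "\<And>z. z \<in> sphere 0 1 \<Longrightarrow> \<bar>G z - g z\<bar> < \<epsilon>"
      using Stone_Weierstrass_real_polynomial_function[of "sphere 0 1" G \<epsilon>,
          OF compact_sphere continuous_on_subset[OF G subset_UNIV] eps] by auto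
    note tp = trig_poly_real_polynomial[OF g(1)]
    obtain C where C: "continuous_on UNIV (\<lambda>t. complex_of_real (g (cis t)))" "\<And>t. \<bar>g (cis t)\<bar> \<le> C"
      using trig_poly_continuous_bounded[OF tp] by auto
    then have cg: "continuous_on UNIV (\<lambda>t. g (cis t))"
      using continuous_on_Re[OF C(1)] by simp
    have ig: "integrable torus_measure (\<lambda>t. f t * g (cis t))"
      using integrable_torus_continuous_bounded[OF f cg, of C] C by simp
    have i1: "integrable torus_measure (\<lambda>t. \<bar>f t * G (cis t) - f t * g (cis t)\<bar>)"
      using iG ig by (intro integrable_abs Bochner_Integration.integrable_diff)
    have i2: "integrable torus_measure (\<lambda>t. \<bar>f t\<bar> * \<epsilon>)"
      using f by (intro integrable_mult_left integrable_abs)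
    have "complex_of_real (LINT t|torus_measure. f t * g (cis t)) = 0"
      using trig_poly_orthogonal[OF f 0 tp] by (simp flip: of_real_mult)
    then have "I = (LINT t|torus_measure. f t * G (cis t)) - (LINT t|torus_measure. f t * g (cis t))"
      by (simp add: I_def)
    also have "\<dots> = (LINT t|torus_measure. f t * G (cis t) - f t * g (cis t))"
      by (rule Bochner_Integration.integral_diff[OF iG ig, symmetric])
    finally have "\<bar>I\<bar> \<le> (LINT t|torus_measure. \<bar>f t * G (cis t) - f t * g (cis t)\<bar>)"
      by (simp only: integral_abs_bound)
    also have "\<dots> \<le> (LINT t|torus_measure. \<bar>f t\<bar> * \<epsilon>)"
    proof (rule integral_mono[OF i1 i2])
      fix t
      have "\<bar>f t * G (cis t) - f t * g (cis t)\<bar> = \<bar>f t\<bar> * \<bar>G (cis t) - g (cis t)\<bar>"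
        by (simp only: right_diff_distrib[symmetric] abs_mult)
      also have "\<dots> \<le> \<bar>f t\<bar> * \<epsilon>"
        using g(2)[of "cis t"] by (intro mult_left_mono) auto
      finally show "\<bar>f t * G (cis t) - f t * g (cis t)\<bar> \<le> \<bar>f t\<bar> * \<epsilon>" .
    qed
    finally show ?thesis by (simp add: A_def)
  qed
  have "\<bar>I\<bar> \<le> 0"
  proof (rule field_le_epsilon)
    fix d :: real assume d: "d > 0"
    have "\<bar>I\<bar> \<le> A * (d / (A + 1))" using A d by (intro bound) auto
    also have "\<dots> \<le> d" using A d by (simp add: field_simps)
    finally show "\<bar>I\<bar> \<le> 0 + d" by simp
  qed
  then show ?thesis by (simp add: I_def)
qed

text \<open>
  The indicator of \<open>C\<close> is the decreasing limit of the continuous functions \<open>max 0 (1 - n * infdist z C)\<close>,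
  so dominated convergence passes from continuous functions to indicators of closed sets.
\<close>

lemma integral_circle_closed_zero:
  assumes f: "integrable torus_measure f"
    and 0: "\<And>k. (LINT t|torus_measure. of_real (f t) * exp (- (\<i> * of_int k * of_real t))) = 0"
    and C: "closed C" "C \<noteq> {}"
  shows "(LINT t|torus_measure. f t * indicator C (cis t)) = 0"
proof -
  define G where "G n z = max 0 (1 - real n * infdist z C)" for n and z :: complex
  have cG: "continuous_on UNIV (G n)" for n unfolding G_def by (intro continuous_intros)
  have bG: "\<bar>G n z\<bar> \<le> 1" for n z unfolding G_def by (auto simp: infdist_nonneg)
  have [measurable]: "f \<in> borel_measurable torus_measure" using f by auto
  have m: "(\<lambda>t. G n (cis t)) \<in> borel_measurable torus_measure" for n
    by (intro continuous_measurable_torus continuous_on_compose2[OF cG continuous_on_cis']) simp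
  have lim: "(\<lambda>n. G n z) \<longlonglongrightarrow> indicator C z" for z
  proof (cases "z \<in> C")
    case True
    then have "infdist z C = 0" by simp
    then show ?thesis using True by (simp add: G_def)
  next
    case False
    then have p: "infdist z C > 0"
      using C by (metis in_closed_iff_infdist_zero infdist_nonneg less_eq_real_def)
    obtain N where N: "real N > 1 / infdist z C" using reals_Archimedean2 by blast
    have "G n z = 0" if "n \<ge> N" for n
    proof -
      have "1 \<le> real N * infdist z C" using N p by (simp add: field_simps)
      also have "\<dots> \<le> real n * infdist z C" using that p by (intro mult_right_mono) auto
      finally show ?thesis by (simp add: G_def)
    qed
    then have "\<forall>\<^sub>F n in sequentially. G n z = indicator C z"
      using False by (auto simp: eventually_sequentially)
    then show ?thesis by (rule tendsto_eventually)
  qed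
  have m': "(\<lambda>t. f t * G n (cis t)) \<in> borel_measurable torus_measure" for n
    by (intro borel_measurable_times m) simp
  have lim': "(\<lambda>n. f t * G n (cis t)) \<longlonglongrightarrow> f t * indicator C (cis t)" for t
    by (intro tendsto_intros lim)
  have "(\<lambda>n. LINT t|torus_measure. f t * G n (cis t)) \<longlonglongrightarrow> (LINT t|torus_measure. f t * indicator C (cis t))"
  proof (rule integral_dominated_convergence[where w = "\<lambda>t. \<bar>f t\<bar>"])
    show "(\<lambda>t. f t * indicator C (cis t)) \<in> borel_measurable torus_measure"
      by (rule borel_measurable_LIMSEQ_real[OF lim' m'])
    show "(\<lambda>t. f t * G n (cis t)) \<in> borel_measurable torus_measure" for n by (rule m')
    show "AE t in torus_measure. (\<lambda>n. f t * G n (cis t)) \<longlonglongrightarrow> f t * indicator C (cis t)"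
      using lim' by simp
    show "integrable torus_measure (\<lambda>t. \<bar>f t\<bar>)" using f by simp
    show "AE t in torus_measure. norm (f t * G n (cis t)) \<le> \<bar>f t\<bar>" for n
      using bG[of n] by (intro AE_I2) (simp add: abs_mult mult_left_le)
  qed
  moreover have "(LINT t|torus_measure. f t * G n (cis t)) = 0" for n
    by (rule integral_circle_continuous_zero[OF f 0 cG bG])
  ultimately show ?thesis by (simp add: LIMSEQ_const_iff)
qed

text \<open>
  If \<open>f\<close> were positive on a set of positive measure, then by inner regularity on a closed set \<open>T\<close> of
  positive measure. The image of \<open>T\<close> on the circle is compact, so the integral of \<open>f\<close> over \<open>T\<close> is zero,
  although the integrand is positive there. The end points \<open>0\<close> and \<open>2 * pi\<close> are left out because \<open>cis\<close>
  identifies them; on the open interval \<open>cis\<close> is injective and the indicator of the image pulls back to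
  that of \<open>T\<close>.
\<close>

lemma fourier_zero_imp_nonpos:
  assumes f: "integrable torus_measure f"
    and 0: "\<And>k. (LINT t|torus_measure. of_real (f t) * exp (- (\<i> * of_int k * of_real t))) = 0"
  shows "AE t in torus_measure. f t \<le> 0"
proof -
  define A where "A = {t \<in> {0<..<2 * pi}. f t > 0}"
  have [measurable]: "f \<in> borel_measurable torus_measure" using f by auto
  have "{t \<in> space torus_measure. f t > 0} \<in> sets torus_measure" by measurable
  then have "{t \<in> {0..2 * pi}. f t > 0} \<in> sets lebesgue"
    by (simp add: torus_measure_def sets_restrict_space_iff)
  then have "{t \<in> {0..2 * pi}. f t > 0} \<inter> {0<..<2*pi} \<in> sets lebesgue"
    by (rule sets.Int) auto
  moreover have "{t \<in> {0..2 * pi}. f t > 0} \<inter> {0<..<2*pi} = A" by (auto simp: A_def)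
  ultimately have A: "A \<in> sets lebesgue" by simp
  have null: "emeasure lebesgue T = 0" if T: "closed T" "T \<subseteq> A" for T
  proof (cases "T = {}")
    case False
    have bT: "bounded T" by (rule bounded_subset[of "{0..2 * pi}"]) (use T(2) in \<open>auto simp: A_def\<close>)
    have "compact (cis ` T)"
      using T bT by (intro compact_continuous_image continuous_on_cis') (simp add: compact_eq_bounded_closed)
    then have cl: "closed (cis ` T)" by (rule compact_imp_closed)
    have ind: "indicator (cis ` T) (cis t) = (indicator T t :: real)" if t: "t \<in> {0..2 * pi}" for t
    proof -
      have "t \<in> T" if "cis t \<in> cis ` T"
      proof -
        from that obtain s where s: "s \<in> T" "cis t = cis s" by auto
        have s2: "0 \<le> s" "s < 2 * pi" "s \<noteq> 0" using s T by (auto simp: A_def)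
        have arg: "Arg2pi (cis u) = u" if "0 \<le> u" "u < 2 * pi" for u
          using that by (intro Arg2pi_unique[of 1]) (auto simp: cis_conv_exp)
        have "t \<noteq> 2 * pi"
        proof
          assume "t = 2 * pi"
          then have "cis s = cis 0" using s by (simp add: cis_2pi)
          then show False using arg[of s] arg[of 0] s2 by simp
        qed
        then have "t < 2 * pi" using t by auto
        then have "Arg2pi (cis t) = t" using t arg[of t] by auto
        then have "t = s" using s(2) arg[of s] s2 by metis
        then show ?thesis using s by simp
      qed
      then show ?thesis by (auto simp: indicator_def)
    qed
    have [measurable]: "T \<in> sets lebesgue"
      using borel_closed[OF T(1)] by (simp add: sets_completionI_sets)
    have TI: "T \<subseteq> {0..2 * pi}" using T(2) by (auto simp: A_def less_imp_le)
    have Tm: "T \<in> sets torus_measure"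
      using TI by (simp add: torus_measure_def sets_restrict_space_iff)
    have "(LINT t|torus_measure. f t * indicator T t) = 0"
      using integral_circle_closed_zero[OF f 0 cl] False
      by (subst Bochner_Integration.integral_cong[OF refl, of _ _ "\<lambda>t. f t * indicator (cis ` T) (cis t)"])
         (auto simp: ind)
    moreover have int: "integrable torus_measure (\<lambda>t. f t * indicator T t)"
      using integrable_mult_indicator[OF Tm f] by (simp add: mult.commute)
    moreover have "0 \<le> f t * indicator T t" for t
      using T by (auto simp: A_def indicator_def less_imp_le)
    ultimately have "AE t in torus_measure. f t * indicator T t = 0"
      using integral_nonneg_eq_0_iff_AE[OF int] by blast
    moreover have "f t * indicator T t = 0 \<Longrightarrow> t \<notin> T" for t
      using T by (auto simp: A_def indicator_def)
    ultimately have "AE t in torus_measure. t \<notin> T" by (rule eventually_mono)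
    then have "T \<in> null_sets torus_measure" using AE_iff_null_sets[OF Tm] by simp
    then have "T \<in> null_sets lebesgue"
      using TI by (simp add: torus_measure_def null_sets_restrict_space)
    then show ?thesis by (rule null_setsD1)
  qed simp
  have "emeasure lebesgue A \<le> ennreal \<epsilon>" if "\<epsilon> > 0" for \<epsilon>
  proof -
    obtain T where T: "closed T" "T \<subseteq> A" "A - T \<in> lmeasurable" "emeasure lebesgue (A - T) < ennreal \<epsilon>"
      using sets_lebesgue_inner_closed[OF A \<open>\<epsilon> > 0\<close>] by blast
    have "emeasure lebesgue A = emeasure lebesgue (T \<union> (A - T))" using T by (simp add: Un_absorb1)
    also have "\<dots> \<le> emeasure lebesgue T + emeasure lebesgue (A - T)"
      using borel_closed[OF T(1)] T(3) by (intro emeasure_subadditive) (simp_all add: sets_completionI_sets fmeasurableD)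
    also have "\<dots> \<le> ennreal \<epsilon>" unfolding null[OF T(1,2)] using T(4) by simp
    finally show ?thesis .
  qed
  then have "emeasure lebesgue A = 0"
    using ennreal_le_epsilon[of 0 "emeasure lebesgue A"] by simp
  then have "A \<in> null_sets lebesgue" using A by (intro null_setsI)
  then have "AE t in lebesgue. t \<notin> A" by (rule AE_not_in)
  moreover have "{0, 2 * pi} \<in> null_sets lebesgue"
    by (simp flip: negligible_iff_null_sets)
  then have "AE t in lebesgue. t \<notin> {0, 2 * pi}" by (rule AE_not_in)
  ultimately have "AE t in lebesgue. t \<in> {0..2 * pi} \<longrightarrow> f t \<le> 0"
    by eventually_elim (auto simp: A_def not_less)
  then show ?thesis
    unfolding torus_measure_def by (subst AE_restrict_space_iff) auto
qed

lemma fourier_zero_imp_AE_zero: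
  assumes f: "integrable torus_measure f"
    and 0: "\<And>k. (LINT t|torus_measure. of_real (f t) * exp (- (\<i> * of_int k * of_real t))) = 0"
  shows "AE t in torus_measure. f t = 0"
proof -
  have "AE t in torus_measure. - f t \<le> 0"
  proof (rule fourier_zero_imp_nonpos)
    show "(LINT t|torus_measure. of_real (- f t) * exp (- (\<i> * of_int k * of_real t))) = 0" for k
      using 0[of k] by (simp only: of_real_minus mult_minus_left integral_minus neg_equal_0_iff_equal)
  qed (use f in simp)
  with fourier_zero_imp_nonpos[OF assms] show ?thesis by eventually_elim simp
qed

subsection \<open>Square integrable functions\<close>

lemma rep_torus_fun: "torus_fun (rep_torus x)"
  using Quotient_rep_reflp[OF Quotient_torus, of x] by (simp add: torus_eq_def)

lemma rep_integrable: "integrable torus_measure (rep_torus x)"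
  using rep_torus_fun by (simp add: torus_fun_def)

lemma rep_measurable [measurable]: "rep_torus x \<in> borel_measurable torus_measure"
  using rep_integrable by auto

lemma rep_abs_AE: "torus_fun f \<Longrightarrow> AE t in torus_measure. rep_torus (abs_torus f) t = f t"
  using Quotient_rep_abs[OF Quotient_torus, of f] by (simp add: torus_eq_def)

lemma torus_eqI: "AE t in torus_measure. rep_torus x t = rep_torus y t \<Longrightarrow> x = y"
  using Quotient_rel_rep[OF Quotient_torus, of x y] rep_torus_fun by (simp add: torus_eq_def)

lemma rep_add: "AE t in torus_measure. rep_torus (x + y) t = rep_torus x t + rep_torus y t"
  unfolding plus_torus_def using rep_torus_fun[of x] rep_torus_fun[of y]
  by (auto simp: torus_fun_def intro!: rep_abs_AE)

lemma rep_scaleR: "AE t in torus_measure. rep_torus (c *\<^sub>R x) t = c * rep_torus x t"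
  unfolding scaleR_torus_def using rep_torus_fun[of x]
  by (auto simp: torus_fun_def intro!: rep_abs_AE)

lemma rep_diff: "AE t in torus_measure. rep_torus (x - y) t = rep_torus x t - rep_torus y t"
  unfolding minus_torus_def using rep_torus_fun[of x] rep_torus_fun[of y]
  by (auto simp: torus_fun_def intro!: rep_abs_AE)

lemma rep_uminus: "AE t in torus_measure. rep_torus (- x) t = - rep_torus x t"
  unfolding uminus_torus_def using rep_torus_fun[of x]
  by (auto simp: torus_fun_def intro!: rep_abs_AE)

lemma rep_zero: "AE t in torus_measure. rep_torus 0 t = 0"
  unfolding zero_torus_def by (rule rep_abs_AE) (simp add: torus_fun_def)

lemma fourier_coeff_rep:
  "fourier_coeff x k =
    (LINT t|torus_measure. of_real (rep_torus x t) * exp (- (\<i> * of_int k * of_real t))) / (2 * pi)"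
  by (simp add: fourier_coeff_def)

lemma in_L2_rep: "in_L2 x \<longleftrightarrow> integrable torus_measure (\<lambda>t. (rep_torus x t)\<^sup>2)"
  by (simp add: in_L2_def)

lemma inner_L2_rep: "inner_L2 x y = (LINT t|torus_measure. rep_torus x t * rep_torus y t) / (2 * pi)"
  by (simp add: inner_L2_def)

lemma exp_torus_measurable [measurable]:
  "(\<lambda>t. exp (- (\<i> * of_int k * complex_of_real t))) \<in> borel_measurable torus_measure"
  by (rule continuous_measurable_torus) (intro continuous_intros)

lemma exp_torus_measurable' [measurable]:
  "(\<lambda>t. exp (- (\<i> * (of_int k * complex_of_real t)))) \<in> borel_measurable torus_measure"
  by (rule continuous_measurable_torus) (intro continuous_intros)

lemma fourier_integrand_integrable:
  "integrable torus_measure (\<lambda>t. of_real (rep_torus x t) * exp (- (\<i> * of_int k * complex_of_real t)))"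
  by (rule integrable_torus_continuous_bounded[OF rep_integrable, of _ 1]) (auto intro!: continuous_intros)

lemma fourier_coeff_add: "fourier_coeff (x + y) k = fourier_coeff x k + fourier_coeff y k"
proof -
  have "(LINT t|torus_measure. of_real (rep_torus (x + y) t) * exp (- (\<i> * of_int k * complex_of_real t)))
    = (LINT t|torus_measure. of_real (rep_torus x t) * exp (- (\<i> * of_int k * complex_of_real t))
        + of_real (rep_torus y t) * exp (- (\<i> * of_int k * complex_of_real t)))"
    using rep_add[of x y] by (intro integral_cong_AE) (auto simp: algebra_simps)
  also have "\<dots> = (LINT t|torus_measure. of_real (rep_torus x t) * exp (- (\<i> * of_int k * complex_of_real t)))
        + (LINT t|torus_measure. of_real (rep_torus y t) * exp (- (\<i> * of_int k * complex_of_real t)))"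
    by (intro Bochner_Integration.integral_add fourier_integrand_integrable)
  finally show ?thesis by (simp add: fourier_coeff_rep add_divide_distrib)
qed

lemma fourier_coeff_scaleR: "fourier_coeff (c *\<^sub>R x) k = of_real c * fourier_coeff x k"
proof -
  have "(LINT t|torus_measure. of_real (rep_torus (c *\<^sub>R x) t) * exp (- (\<i> * of_int k * complex_of_real t)))
    = (LINT t|torus_measure. of_real c * (of_real (rep_torus x t) * exp (- (\<i> * of_int k * complex_of_real t))))"
    using rep_scaleR[of c x] by (intro integral_cong_AE) (auto simp: algebra_simps)
  then show ?thesis by (simp add: fourier_coeff_rep)
qed

lemma fourier_coeff_zero [simp]: "fourier_coeff 0 k = 0"
  using fourier_coeff_scaleR[of 0 0 k] by simp

lemma fourier_coeff_uminus: "fourier_coeff (- x) k = - fourier_coeff x k"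
  using fourier_coeff_scaleR[of "-1" x k] by simp

lemma fourier_coeff_diff: "fourier_coeff (x - y) k = fourier_coeff x k - fourier_coeff y k"
  using fourier_coeff_add[of x "- y" k] by (simp add: fourier_coeff_uminus)

lemma fourier_coeff_cnj: "fourier_coeff x (- k) = cnj (fourier_coeff x k)"
proof -
  have "(LINT t|torus_measure. of_real (rep_torus x t) * exp (- (\<i> * of_int (- k) * complex_of_real t)))
    = (LINT t|torus_measure. cnj (of_real (rep_torus x t) * exp (- (\<i> * of_int k * complex_of_real t))))"
    by (intro Bochner_Integration.integral_cong) (simp_all add: exp_cnj)
  also have "\<dots> = cnj (LINT t|torus_measure. of_real (rep_torus x t) * exp (- (\<i> * of_int k * complex_of_real t)))"
    by (rule Bochner_Integration.integral_cnj)
  finally show ?thesis unfolding fourier_coeff_rep by (simp only: complex_cnj_divide) simp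
qed

lemma torus_eq_0I:
  assumes "\<And>k. fourier_coeff x k = 0"
  shows "x = 0"
proof (rule torus_eqI)
  have "AE t in torus_measure. rep_torus x t = 0"
    using assms by (intro fourier_zero_imp_AE_zero[OF rep_integrable]) (simp add: fourier_coeff_rep)
  then show "AE t in torus_measure. rep_torus x t = rep_torus 0 t"
    using rep_zero by eventually_elim simp
qed

lemma torus_eq_fourierI: "(\<And>k. fourier_coeff x k = fourier_coeff y k) \<Longrightarrow> x = y"
  using torus_eq_0I[of "x - y"] by (simp add: fourier_coeff_diff)

lemma norm_fourier_coeff_le:
  "cmod (fourier_coeff x k) \<le> (LINT t|torus_measure. \<bar>rep_torus x t\<bar>) / (2 * pi)"
proof -
  have "cmod (LINT t|torus_measure. of_real (rep_torus x t) * exp (- (\<i> * of_int k * complex_of_real t)))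
    \<le> (LINT t|torus_measure. cmod (of_real (rep_torus x t) * exp (- (\<i> * of_int k * complex_of_real t))))"
    by (rule integral_norm_bound)
  then show ?thesis by (simp add: fourier_coeff_rep norm_mult norm_divide divide_right_mono)
qed

lemma L2_mult_integrable:
  assumes "in_L2 x" "in_L2 y"
  shows "integrable torus_measure (\<lambda>t. rep_torus x t * rep_torus y t)"
proof (rule Bochner_Integration.integrable_bound)
  show "integrable torus_measure (\<lambda>t. (rep_torus x t)\<^sup>2 + (rep_torus y t)\<^sup>2)"
    using assms by (simp add: in_L2_rep)
  have "\<bar>a * b\<bar> \<le> a\<^sup>2 + b\<^sup>2" for a b :: real
  proof -
    have "0 \<le> (\<bar>a\<bar> - \<bar>b\<bar>)\<^sup>2" "0 \<le> \<bar>a\<bar> * \<bar>b\<bar>" by simp_all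
    then show ?thesis unfolding power2_diff abs_mult power2_abs by linarith
  qed
  then show "AE t in torus_measure. norm (rep_torus x t * rep_torus y t)
      \<le> norm ((rep_torus x t)\<^sup>2 + (rep_torus y t)\<^sup>2)" by (intro AE_I2) simp
qed measurable

lemma in_L2_add:
  assumes "in_L2 x" "in_L2 y" shows "in_L2 (x + y)"
proof -
  have "integrable torus_measure (\<lambda>t. (rep_torus x t)\<^sup>2 + (rep_torus y t)\<^sup>2 + 2 * (rep_torus x t * rep_torus y t))"
    using assms L2_mult_integrable[OF assms] by (simp add: in_L2_rep)
  then show ?thesis unfolding in_L2_rep
    by (rule integrable_cong_AE_imp) (use rep_add[of x y] in \<open>auto simp: power2_sum\<close>)
qed

lemma in_L2_scaleR:
  assumes "in_L2 x" shows "in_L2 (c *\<^sub>R x)"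
proof -
  have "integrable torus_measure (\<lambda>t. c\<^sup>2 * (rep_torus x t)\<^sup>2)"
    using assms by (simp add: in_L2_rep)
  then show ?thesis unfolding in_L2_rep
    by (rule integrable_cong_AE_imp) (use rep_scaleR[of c x] in \<open>auto simp: power_mult_distrib\<close>)
qed

lemma in_L2_zero: "in_L2 0"
  unfolding in_L2_rep
  by (rule integrable_cong_AE_imp[of _ "\<lambda>_. 0"]) (use rep_zero in auto)

lemma inner_L2_commute: "inner_L2 x y = inner_L2 y x"
  by (simp add: inner_L2_rep mult.commute)

lemma inner_L2_add:
  assumes "in_L2 x" "in_L2 y" "in_L2 z"
  shows "inner_L2 (x + y) z = inner_L2 x z + inner_L2 y z"
proof -
  have "(LINT t|torus_measure. rep_torus (x + y) t * rep_torus z t)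
    = (LINT t|torus_measure. rep_torus x t * rep_torus z t + rep_torus y t * rep_torus z t)"
    using rep_add[of x y] by (intro integral_cong_AE) (auto simp: algebra_simps)
  also have "\<dots> = (LINT t|torus_measure. rep_torus x t * rep_torus z t)
      + (LINT t|torus_measure. rep_torus y t * rep_torus z t)"
    using assms by (intro Bochner_Integration.integral_add L2_mult_integrable)
  finally show ?thesis by (simp add: inner_L2_rep add_divide_distrib)
qed

lemma inner_L2_scaleR: "inner_L2 (c *\<^sub>R x) z = c * inner_L2 x z"
proof -
  have "(LINT t|torus_measure. rep_torus (c *\<^sub>R x) t * rep_torus z t)
    = (LINT t|torus_measure. c * (rep_torus x t * rep_torus z t))"
    using rep_scaleR[of c x] by (intro integral_cong_AE) (auto simp: algebra_simps)
  then show ?thesis by (simp add: inner_L2_rep)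
qed

lemma inner_L2_nonneg: "0 \<le> inner_L2 x x"
  by (simp add: inner_L2_rep flip: power2_eq_square)

lemma inner_L2_eq_0:
  assumes "in_L2 x" "inner_L2 x x = 0" shows "x = 0"
proof (rule torus_eqI)
  have "(LINT t|torus_measure. (rep_torus x t)\<^sup>2) = 0"
    using assms(2) by (simp add: inner_L2_rep power2_eq_square)
  then have "AE t in torus_measure. (rep_torus x t)\<^sup>2 = 0"
    using integral_nonneg_eq_0_iff_AE[of torus_measure "\<lambda>t. (rep_torus x t)\<^sup>2"] assms(1) by (simp add: in_L2_rep)
  then show "AE t in torus_measure. rep_torus x t = rep_torus 0 t"
    using rep_zero by eventually_elim simp
qed

lemma inner_L2_uminus: "inner_L2 (- x) (- x) = inner_L2 x x"
proof -
  have "(LINT t|torus_measure. rep_torus (- x) t * rep_torus (- x) t)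
    = (LINT t|torus_measure. rep_torus x t * rep_torus x t)"
    using rep_uminus[of x] by (intro integral_cong_AE) auto
  then show ?thesis by (simp add: inner_L2_rep)
qed

lemma nn_integral_L2_diff:
  assumes "in_L2 (x - y)"
  shows "(\<integral>\<^sup>+t. ennreal ((rep_torus x t - rep_torus y t)\<^sup>2) \<partial>torus_measure)
    = ennreal (2 * pi * inner_L2 (x - y) (x - y))"
proof -
  have "(\<integral>\<^sup>+t. ennreal ((rep_torus x t - rep_torus y t)\<^sup>2) \<partial>torus_measure)
    = (\<integral>\<^sup>+t. ennreal ((rep_torus (x - y) t)\<^sup>2) \<partial>torus_measure)"
    using rep_diff[of x y] by (intro nn_integral_cong_AE) auto
  also have "\<dots> = ennreal (LINT t|torus_measure. (rep_torus (x - y) t)\<^sup>2)"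
    using assms by (intro nn_integral_eq_integral) (auto simp: in_L2_rep)
  finally show ?thesis by (simp add: inner_L2_rep power2_eq_square)
qed

text \<open>
  The usual subsequence argument: along indices \<open>\<phi> k\<close> with squared distances below \<open>4\<close> to the power \<open>-k\<close>
  the functions converge almost everywhere, and Fatou's lemma shows that the limit is also the limit
  in \<open>L\<^sub>2\<close>. The limit is taken pointwise for every real \<open>t\<close>, not only on one period, which makes it
  periodic without further modification.
\<close>

lemma L2_complete:
  assumes L2: "\<And>n. in_L2 (s n)"
    and cauchy: "\<And>e. e > 0 \<Longrightarrow> \<exists>N. \<forall>m\<ge>N. \<forall>n\<ge>N. inner_L2 (s m - s n) (s m - s n) < e"
  shows "\<exists>x. in_L2 x \<and> (\<lambda>n. inner_L2 (s n - x) (s n - x)) \<longlonglongrightarrow> 0"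
proof -
  have L2d: "in_L2 (x - y)" if "in_L2 x" "in_L2 y" for x y
    using in_L2_add[OF that(1) in_L2_scaleR[OF that(2), of "-1"]] by simp
  define f where "f n = rep_torus (s n)" for n
  have [measurable]: "f n \<in> borel_measurable torus_measure" for n unfolding f_def by simp
  have nn: "(\<integral>\<^sup>+t. ennreal ((f m t - f n t)\<^sup>2) \<partial>torus_measure) = ennreal (2 * pi * inner_L2 (s m - s n) (s m - s n))" for m n
    unfolding f_def by (intro nn_integral_L2_diff L2d L2)
  have "\<forall>k. \<exists>N. \<forall>m\<ge>N. \<forall>n\<ge>N. inner_L2 (s m - s n) (s m - s n) < (1/4) ^ k"
    using cauchy by simp
  then obtain N where N: "\<And>k m n. m \<ge> N k \<Longrightarrow> n \<ge> N k \<Longrightarrow> inner_L2 (s m - s n) (s m - s n) < (1/4) ^ k"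
    by metis
  define \<phi> where "\<phi> k = k + (\<Sum>i\<le>k. N i)" for k
  have \<phi>_N: "\<phi> k \<ge> N k" for k
    unfolding \<phi>_def using member_le_sum[of k "{..k}" N] by simp
  have \<phi>_ge: "\<phi> k \<ge> k" for k unfolding \<phi>_def by simp
  have \<phi>_Suc: "\<phi> (Suc k) \<ge> N k" for k
    unfolding \<phi>_def using member_le_sum[of k "{..Suc k}" N] by simp
  define g where "g k = f (\<phi> k)" for k
  have [measurable]: "g n \<in> borel_measurable torus_measure" for n unfolding g_def by simp
  have h: "(\<integral>\<^sup>+t. ennreal \<bar>g (Suc k) t - g k t\<bar> \<partial>torus_measure) \<le> ennreal (4 * pi * (1/2) ^ k)" for k
  proof -
    \<comment> \<open>the arithmetic-geometric mean inequality, in place of the Cauchy-Schwarz inequality for integrals: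
      weighting by \<open>2 ^ k\<close> balances the bound \<open>4\<close> to the power \<open>-k\<close> for the squares\<close>
    have le: "\<bar>a\<bar> \<le> 2 ^ k * a\<^sup>2 + (1/2) ^ k" for a :: real
    proof -
      have "0 \<le> 2 ^ k * (\<bar>a\<bar> - (1/2) ^ k)\<^sup>2" by simp
      also have "\<dots> = 2 ^ k * a\<^sup>2 - 2 * \<bar>a\<bar> + (1/2) ^ k"
        by (simp add: power2_eq_square field_simps)
      finally show ?thesis by linarith
    qed
    have "(\<integral>\<^sup>+t. ennreal \<bar>g (Suc k) t - g k t\<bar> \<partial>torus_measure)
      \<le> (\<integral>\<^sup>+t. ennreal (2 ^ k) * ennreal ((g (Suc k) t - g k t)\<^sup>2) + ennreal ((1/2) ^ k) \<partial>torus_measure)"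
      by (intro nn_integral_mono) (simp add: le flip: ennreal_mult ennreal_plus)
    also have "\<dots> = ennreal (2 ^ k) * (\<integral>\<^sup>+t. ennreal ((g (Suc k) t - g k t)\<^sup>2) \<partial>torus_measure)
        + ennreal ((1/2) ^ k) * emeasure torus_measure {0..2 * pi}"
      by (subst nn_integral_add) (auto simp: nn_integral_cmult)
    also have "\<dots> \<le> ennreal (2 ^ k) * ennreal (2 * pi * (1/4) ^ k) + ennreal ((1/2) ^ k) * ennreal (2 * pi)"
    proof (intro add_mono mult_left_mono)
      show "(\<integral>\<^sup>+t. ennreal ((g (Suc k) t - g k t)\<^sup>2) \<partial>torus_measure) \<le> ennreal (2 * pi * (1/4) ^ k)"
        unfolding g_def nn using N[OF \<phi>_Suc \<phi>_N, of k] by (intro ennreal_leI mult_left_mono) auto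
      show "emeasure torus_measure {0..2 * pi} \<le> ennreal (2 * pi)"
        by (simp add: torus_measure.emeasure_eq_measure measure_torus)
    qed auto
    also have "\<dots> = ennreal (2 ^ k * (2 * pi * (1/4) ^ k) + (1/2) ^ k * (2 * pi))"
      by (simp flip: ennreal_mult ennreal_plus)
    also have "2 ^ k * (2 * pi * (1/4) ^ k) + (1/2) ^ k * (2 * pi) = 4 * pi * (1/2) ^ k"
      by (simp add: field_simps flip: power_mult_distrib)
    finally show ?thesis .
  qed
  have "(\<integral>\<^sup>+t. (\<Sum>k. ennreal \<bar>g (Suc k) t - g k t\<bar>) \<partial>torus_measure)
      = (\<Sum>k. \<integral>\<^sup>+t. ennreal \<bar>g (Suc k) t - g k t\<bar> \<partial>torus_measure)"
    by (rule nn_integral_suminf) measurable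
  also have "\<dots> \<le> (\<Sum>k. ennreal (4 * pi * (1/2) ^ k))"
    by (intro suminf_le h) auto
  also have "\<dots> < \<infinity>"
  proof -
    have "(\<Sum>k. ennreal (4 * pi * (1/2) ^ k)) \<noteq> top"
      by (intro ennreal_suminf_neq_top summable_mult summable_geometric) auto
    then show ?thesis by (simp add: less_top)
  qed
  finally have "AE t in torus_measure. (\<Sum>k. ennreal \<bar>g (Suc k) t - g k t\<bar>) \<noteq> \<infinity>"
    by (intro nn_integral_PInf_AE) auto
  then have conv: "AE t in torus_measure. convergent (\<lambda>k. g k t)"
  proof eventually_elim
    case (elim t)
    then have "summable (\<lambda>k. \<bar>g (Suc k) t - g k t\<bar>)"
      by (intro summable_suminf_not_top) auto
    then have "summable (\<lambda>k. g (Suc k) t - g k t)" by (rule summable_rabs_cancel)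
    then have "convergent (\<lambda>n. \<Sum>k<n. g (Suc k) t - g k t)" by (simp add: summable_iff_convergent)
    then have "convergent (\<lambda>n. g n t - g 0 t)" by (simp only: sum_lessThan_telescope[of "\<lambda>k. g k t"])
    then show ?case by (simp add: convergent_diff_const_right_iff)
  qed
  define F where "F t = lim (\<lambda>k. g k t)" for t
  have [measurable]: "F \<in> borel_measurable torus_measure"
    unfolding F_def by (rule borel_measurable_lim_metric) simp
  have limF: "AE t in torus_measure. (\<lambda>k. g k t) \<longlonglongrightarrow> F t"
    using conv by eventually_elim (simp add: F_def convergent_LIMSEQ_iff)
  have bound: "\<exists>n0. \<forall>n\<ge>n0. (\<integral>\<^sup>+t. ennreal ((f n t - F t)\<^sup>2) \<partial>torus_measure) \<le> ennreal (2 * pi * e)"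
    if e: "e > 0" for e
  proof -
    obtain n0 where n0: "\<And>m n. m \<ge> n0 \<Longrightarrow> n \<ge> n0 \<Longrightarrow> inner_L2 (s m - s n) (s m - s n) < e"
      using cauchy[OF e] by blast
    have "(\<integral>\<^sup>+t. ennreal ((f n t - F t)\<^sup>2) \<partial>torus_measure) \<le> ennreal (2 * pi * e)" if "n \<ge> n0" for n
    proof -
      have "(\<integral>\<^sup>+t. ennreal ((f n t - F t)\<^sup>2) \<partial>torus_measure)
        = (\<integral>\<^sup>+t. liminf (\<lambda>k. ennreal ((f n t - g k t)\<^sup>2)) \<partial>torus_measure)"
      proof (rule nn_integral_cong_AE)
        show "AE t in torus_measure. ennreal ((f n t - F t)\<^sup>2) = liminf (\<lambda>k. ennreal ((f n t - g k t)\<^sup>2))"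
          using limF
        proof eventually_elim
          case (elim t)
          then have "(\<lambda>k. ennreal ((f n t - g k t)\<^sup>2)) \<longlonglongrightarrow> ennreal ((f n t - F t)\<^sup>2)"
            by (intro tendsto_intros)
          then show ?case by (intro lim_imp_Liminf[symmetric]) simp_all
        qed
      qed
      also have "\<dots> \<le> liminf (\<lambda>k. \<integral>\<^sup>+t. ennreal ((f n t - g k t)\<^sup>2) \<partial>torus_measure)"
        by (rule nn_integral_liminf) measurable
      also have "\<dots> \<le> liminf (\<lambda>k. ennreal (2 * pi * e))"
      proof (rule Liminf_mono)
        show "\<forall>\<^sub>F k in sequentially. (\<integral>\<^sup>+t. ennreal ((f n t - g k t)\<^sup>2) \<partial>torus_measure) \<le> ennreal (2 * pi * e)"
          using eventually_ge_at_top[of n0]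
        proof eventually_elim
          case (elim k)
          then have "\<phi> k \<ge> n0" using \<phi>_ge[of k] by simp
          then show ?case unfolding g_def nn using n0[OF \<open>n \<ge> n0\<close>, of "\<phi> k"]
            by (intro ennreal_leI mult_left_mono) auto
        qed
      qed
      also have "\<dots> = ennreal (2 * pi * e)" by (simp add: Liminf_const)
      finally show ?thesis .
    qed
    then show ?thesis by blast
  qed
  obtain n1 where n1: "(\<integral>\<^sup>+t. ennreal ((f n1 t - F t)\<^sup>2) \<partial>torus_measure) \<le> ennreal (2 * pi * 1)"
    using bound[of 1] by auto
  have i1: "integrable torus_measure (\<lambda>t. (f n1 t - F t)\<^sup>2)"
    using n1 by (intro integrableI_nonneg) (auto intro: le_less_trans)
  have i2: "integrable torus_measure (\<lambda>t. (F t)\<^sup>2)"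
  proof (rule Bochner_Integration.integrable_bound)
    show "integrable torus_measure (\<lambda>t. 2 * (f n1 t - F t)\<^sup>2 + 2 * (f n1 t)\<^sup>2)"
      using i1 L2[of n1] by (simp add: f_def in_L2_rep)
    have "b\<^sup>2 \<le> 2 * (a - b)\<^sup>2 + 2 * a\<^sup>2" for a b :: real
    proof -
      have "0 \<le> (2 * a - b)\<^sup>2" by simp
      then show ?thesis by (simp add: power2_eq_square algebra_simps)
    qed
    then show "AE t in torus_measure. norm ((F t)\<^sup>2) \<le> norm (2 * (f n1 t - F t)\<^sup>2 + 2 * (f n1 t)\<^sup>2)"
      by (intro AE_I2) simp
  qed measurable
  have i3: "integrable torus_measure F"
  proof (rule Bochner_Integration.integrable_bound)
    show "integrable torus_measure (\<lambda>t. 1 + (F t)\<^sup>2)" using i2 by simp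
    have "\<bar>a\<bar> \<le> 1 + a\<^sup>2" for a :: real
    proof -
      have "0 \<le> (\<bar>a\<bar> - 1)\<^sup>2" "0 \<le> \<bar>a\<bar>" by simp_all
      then show ?thesis unfolding power2_diff by simp
    qed
    then show "AE t in torus_measure. norm (F t) \<le> norm (1 + (F t)\<^sup>2)"
      by (intro AE_I2) simp
  qed measurable
  have per: "F (t + 2 * pi) = F t" for t
    using rep_torus_fun by (simp add: F_def g_def f_def torus_fun_def)
  define x where "x = abs_torus F"
  have rx: "AE t in torus_measure. rep_torus x t = F t"
    unfolding x_def by (rule rep_abs_AE) (use per i3 in \<open>simp add: torus_fun_def\<close>)
  have xL2: "in_L2 x"
    unfolding in_L2_rep by (rule integrable_cong_AE_imp[OF i2]) (use rx in auto)
  have "(\<lambda>n. inner_L2 (s n - x) (s n - x)) \<longlonglongrightarrow> 0"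
  proof (rule LIMSEQ_I)
    fix e :: real assume e: "e > 0"
    then obtain n0 where n0: "\<And>n. n \<ge> n0 \<Longrightarrow> (\<integral>\<^sup>+t. ennreal ((f n t - F t)\<^sup>2) \<partial>torus_measure) \<le> ennreal (2 * pi * (e / 2))"
      using bound[of "e/2"] by auto
    have "norm (inner_L2 (s n - x) (s n - x) - 0) < e" if "n \<ge> n0" for n
    proof -
      have "ennreal (2 * pi * inner_L2 (s n - x) (s n - x)) = (\<integral>\<^sup>+t. ennreal ((f n t - rep_torus x t)\<^sup>2) \<partial>torus_measure)"
        unfolding f_def by (rule nn_integral_L2_diff[symmetric]) (intro L2d L2 xL2)
      also have "\<dots> = (\<integral>\<^sup>+t. ennreal ((f n t - F t)\<^sup>2) \<partial>torus_measure)"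
        using rx by (intro nn_integral_cong_AE) auto
      also have "\<dots> \<le> ennreal (2 * pi * (e / 2))" using n0[OF that] .
      finally have "2 * pi * inner_L2 (s n - x) (s n - x) \<le> 2 * pi * (e / 2)"
        using e by (subst (asm) ennreal_le_iff) auto
      then have "inner_L2 (s n - x) (s n - x) \<le> e / 2" by simp
      then show ?thesis using e inner_L2_nonneg[of "s n - x"] by simp
    qed
    then show "\<exists>no. \<forall>n\<ge>no. norm (inner_L2 (s n - x) (s n - x) - 0) < e" by blast
  qed
  then show ?thesis using xL2 by blast
qed

interpretation L2: hilbert "{x. in_L2 x}" inner_L2
proof
  show "subspace {x. in_L2 x}"
    by (simp add: subspace_def in_L2_zero in_L2_add in_L2_scaleR)
  show "\<exists>x\<in>{x. in_L2 x}. (\<lambda>n. inner_L2 (s n - x) (s n - x)) \<longlonglongrightarrow> 0"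
    if "\<And>n. s n \<in> {x. in_L2 x}" "\<And>e. e > 0 \<Longrightarrow> \<exists>N. \<forall>m\<ge>N. \<forall>n\<ge>N. inner_L2 (s m - s n) (s m - s n) < e" for s
    using L2_complete[of s] that by simp
  show "0 < inner_L2 x x" if "x \<in> {x. in_L2 x}" "x \<noteq> 0" for x
    using inner_L2_eq_0[of x] inner_L2_nonneg[of x] that by force
qed (rule inner_L2_commute, auto simp: inner_L2_add inner_L2_scaleR inner_L2_nonneg inner_L2_uminus)

subsection \<open>The real trigonometric basis\<close>

text \<open>
  The real basis is numbered by \<open>1, cos t, sin t, cos 2t, sin 2t, ...\<close>: index \<open>0\<close> is the constant, and
  frequency \<open>m > 0\<close> occupies the indices \<open>2m - 1\<close> (cosine) and \<open>2m\<close> (sine). The factor \<open>\<surd>2\<close> in \<open>trig\<close>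
  normalises with respect to the mean value over a period.
\<close>

definition freq :: "nat \<Rightarrow> nat" where "freq j = (j + 1) div 2"

definition trig :: "nat \<Rightarrow> real \<Rightarrow> real" where
  "trig j t = (if j = 0 then 1 else if odd j then sqrt 2 * cos (real (freq j) * t) else sqrt 2 * sin (real (freq j) * t))"

definition trig_torus :: "nat \<Rightarrow> torus" where "trig_torus j = abs_torus (trig j)"

lemma trig_continuous: "continuous_on UNIV (trig j)"
proof -
  consider "j = 0" | "j \<noteq> 0" "odd j" | "j \<noteq> 0" "even j" by blast
  then show ?thesis by cases (auto simp: trig_def[abs_def] intro!: continuous_intros)
qed

lemma trig_bound: "\<bar>trig j t\<bar> \<le> sqrt 2"
  by (auto simp: trig_def abs_mult)

lemma trig_torus_fun: "torus_fun (trig j)"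
proof -
  have "sin (real n * (t + 2 * pi)) = sin (real n * t)" "cos (real n * (t + 2 * pi)) = cos (real n * t)" for n t
    using sin_2npi[of n] cos_2npi[of n] by (simp_all add: distrib_left sin_add cos_add mult.assoc mult.left_commute)
  moreover have "integrable torus_measure (trig j)"
    by (rule integrable_torus_continuous[OF trig_continuous, of _ "sqrt 2"]) (simp add: trig_bound)
  ultimately show ?thesis by (auto simp: torus_fun_def trig_def[abs_def])
qed

lemma rep_trig: "AE t in torus_measure. rep_torus (trig_torus j) t = trig j t"
  unfolding trig_torus_def by (rule rep_abs_AE[OF trig_torus_fun])

lemma in_L2_trig: "in_L2 (trig_torus j)"
proof -
  have "integrable torus_measure (\<lambda>t. (trig j t)\<^sup>2)"
  proof (rule integrable_torus_continuous)
    show "norm ((trig j t)\<^sup>2) \<le> 2" for t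
      using power_mono[OF trig_bound[of j t], of 2] by simp
  qed (intro continuous_intros trig_continuous)
  then show ?thesis unfolding in_L2_rep
    by (rule integrable_cong_AE_imp) (use rep_trig[of j] in auto)
qed

lemma integral_exp_torus:
  "(LINT t|torus_measure. exp (\<i> * of_int m * complex_of_real t)) = (if m = 0 then 2 * pi else 0)"
proof (cases "m = 0")
  case True
  then show ?thesis by (simp add: measure_torus scaleR_conv_of_real)
next
  case False
  let ?e = "\<lambda>t. exp (\<i> * of_int m * complex_of_real t)"
  have int: "integrable torus_measure ?e"
    by (rule integrable_torus_continuous[of _ 1]) (auto intro!: continuous_intros)
  have "(?e has_integral (?e (2 * pi) / (\<i> * of_int m) - ?e 0 / (\<i> * of_int m))) {0..2 * pi}"
  proof (rule fundamental_theorem_of_calculus)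
    fix t :: real
    show "((\<lambda>t. ?e t / (\<i> * of_int m)) has_vector_derivative ?e t) (at t within {0..2 * pi})"
      using False by (auto intro!: derivative_eq_intros has_vector_derivative_real_field simp: field_simps)
  qed simp
  moreover have "?e (2 * pi) = 1"
    using exp_integer_2pi[of "of_int m"] by (simp add: mult_ac)
  ultimately have "integral {0..2 * pi} ?e = 0" by (simp add: integral_unique)
  then show ?thesis
    using False int lebesgue_integral_eq_integral[of "{0..2*pi}" ?e] by (simp add: torus_measure_def)
qed

text \<open>
  The sum on the right also covers \<open>m = 0\<close>, where the two exponentials coincide; the cosines, the sines
  and the constant are all of this form.
\<close>

lemma fourier_coeff_two_terms:
  assumes x: "AE t in torus_measure. complex_of_real (rep_torus x t) =
      a * exp (\<i> * of_int m * complex_of_real t) + b * exp (\<i> * of_int (- m) * complex_of_real t)"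
  shows "fourier_coeff x k = (if k = m then a else 0) + (if k = - m then b else 0)"
proof -
  let ?e = "\<lambda>m t. exp (\<i> * of_int m * complex_of_real t)"
  have int: "integrable torus_measure (?e m)" for m
    by (rule integrable_torus_continuous[of _ 1]) (auto intro!: continuous_intros)
  have [measurable]: "?e m \<in> borel_measurable torus_measure" for m using int by auto
  have "(LINT t|torus_measure. of_real (rep_torus x t) * exp (- (\<i> * of_int k * complex_of_real t)))
    = (LINT t|torus_measure. a * ?e (m - k) t + b * ?e (- m - k) t)"
  proof (rule integral_cong_AE)
    show "AE t in torus_measure. of_real (rep_torus x t) * exp (- (\<i> * of_int k * complex_of_real t))
        = a * ?e (m - k) t + b * ?e (- m - k) t"
      using x by eventually_elim (simp add: distrib_right mult.assoc flip: exp_add; simp add: algebra_simps)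
  qed measurable
  also have "\<dots> = a * (LINT t|torus_measure. ?e (m - k) t) + b * (LINT t|torus_measure. ?e (- m - k) t)"
    using Bochner_Integration.integral_add[OF integrable_mult_right[OF int[of "m - k"], of a]
        integrable_mult_right[OF int[of "- m - k"], of b]]
    by (simp only: integral_mult_right_zero)
  also have "\<dots> = a * (if k = m then 2 * pi else 0) + b * (if k = - m then 2 * pi else 0)"
    unfolding integral_exp_torus by auto
  finally show ?thesis unfolding fourier_coeff_rep by (simp add: add_divide_distrib)
qed

lemma fourier_coeff_trig:
  "fourier_coeff (trig_torus j) k =
    (if j = 0 then (if k = 0 then 1 else 0)
     else if odd j then (if \<bar>k\<bar> = freq j then sqrt 2 / 2 else 0)
     else (if \<bar>k\<bar> = freq j then - \<i> * of_int (sgn k) * sqrt 2 / 2 else 0))"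
proof (cases "j = 0")
  case True
  have "AE t in torus_measure. complex_of_real (rep_torus (trig_torus j) t) =
      1 * exp (\<i> * of_int 0 * complex_of_real t) + 0 * exp (\<i> * of_int (- 0) * complex_of_real t)"
    using rep_trig[of j] by eventually_elim (simp add: trig_def True)
  from fourier_coeff_two_terms[OF this, of k] show ?thesis using True by auto
next
  case False
  then have f: "freq j > 0" by (auto simp: freq_def)
  show ?thesis
  proof (cases "odd j")
    case True
    have "AE t in torus_measure. complex_of_real (rep_torus (trig_torus j) t) =
      (sqrt 2 / 2) * exp (\<i> * of_int (freq j) * complex_of_real t) + (sqrt 2 / 2) * exp (\<i> * of_int (- int (freq j)) * complex_of_real t)"
      using rep_trig[of j] by eventually_elim (simp add: trig_def True False complex_eq_iff Re_exp Im_exp)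
    from fourier_coeff_two_terms[OF this, of k] show ?thesis using True False f by auto
  next
    case ev: False
    have "AE t in torus_measure. complex_of_real (rep_torus (trig_torus j) t) =
      (- \<i> * sqrt 2 / 2) * exp (\<i> * of_int (freq j) * complex_of_real t) + (\<i> * sqrt 2 / 2) * exp (\<i> * of_int (- int (freq j)) * complex_of_real t)"
      using rep_trig[of j] by eventually_elim (simp add: trig_def ev False complex_eq_iff Re_exp Im_exp)
    from fourier_coeff_two_terms[OF this, of k] show ?thesis using ev False f by auto
  qed
qed

text \<open>
  Real and imaginary parts of a Fourier coefficient are the integrals against cosine and sine, so all
  questions about inner products with the real basis become questions about Fourier coefficients.
\<close>

lemma inner_trig:
  "inner_L2 x (trig_torus j) = (if j = 0 then Re (fourier_coeff x 0)
     else if odd j then sqrt 2 * Re (fourier_coeff x (freq j))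
     else - sqrt 2 * Im (fourier_coeff x (freq j)))"
proof -
  have 1: "(LINT t|torus_measure. rep_torus x t * rep_torus (trig_torus j) t)
      = (LINT t|torus_measure. rep_torus x t * trig j t)"
    using rep_trig[of j] continuous_measurable_torus[OF trig_continuous, of j]
    by (intro integral_cong_AE) auto
  have Re: "Re (fourier_coeff x k) = (LINT t|torus_measure. rep_torus x t * cos (k * t)) / (2 * pi)" for k
  proof -
    have "Re (LINT t|torus_measure. of_real (rep_torus x t) * exp (- (\<i> * of_int k * complex_of_real t)))
      = (LINT t|torus_measure. Re (of_real (rep_torus x t) * exp (- (\<i> * of_int k * complex_of_real t))))"
      by (rule integral_Re[symmetric, OF fourier_integrand_integrable])
    then show ?thesis by (simp add: fourier_coeff_rep Re_exp Re_divide_of_real flip: of_real_mult)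
  qed
  have Im: "Im (fourier_coeff x k) = - (LINT t|torus_measure. rep_torus x t * sin (k * t)) / (2 * pi)" for k
  proof -
    have "Im (LINT t|torus_measure. of_real (rep_torus x t) * exp (- (\<i> * of_int k * complex_of_real t)))
      = (LINT t|torus_measure. Im (of_real (rep_torus x t) * exp (- (\<i> * of_int k * complex_of_real t))))"
      by (rule integral_Im[symmetric, OF fourier_integrand_integrable])
    then show ?thesis by (simp add: fourier_coeff_rep Im_exp Im_divide_of_real flip: of_real_mult)
  qed
  have s: "rep_torus x t * (sqrt 2 * u) = sqrt 2 * (rep_torus x t * u)" for t u by simp
  consider "j = 0" | "j \<noteq> 0" "odd j" | "j \<noteq> 0" "even j" by blast
  then show ?thesis
    unfolding inner_L2_rep 1 by cases (simp_all add: trig_def Re Im s)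
qed

lemma cmod_fourier_coeff:
  assumes "m > 0"
  shows "(cmod (fourier_coeff x (int m)))\<^sup>2 =
    ((inner_L2 x (trig_torus (2 * m - 1)))\<^sup>2 + (inner_L2 x (trig_torus (2 * m)))\<^sup>2) / 2"
proof -
  have "freq (2 * m - 1) = m" "freq (2 * m) = m" "odd (2 * m - 1)" using assms by (auto simp: freq_def)
  then show ?thesis using assms by (simp add: inner_trig cmod_power2 power_mult_distrib)
qed

lemma trig_inner_zero_imp_fourier_zero:
  assumes "\<And>j. freq j = nat \<bar>k\<bar> \<Longrightarrow> inner_L2 x (trig_torus j) = 0"
    and "k = 0 \<Longrightarrow> Im (fourier_coeff x 0) = 0"
  shows "fourier_coeff x k = 0"
proof -
  have nn: "fourier_coeff x (int m) = 0" if "m > 0" "nat \<bar>k\<bar> = m" for m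
    using cmod_fourier_coeff[OF that(1), of x] assms(1)[of "2 * m - 1"] assms(1)[of "2 * m"] that
    by (simp add: freq_def)
  show ?thesis
  proof (cases k rule: int_cases3)
    case zero
    then show ?thesis using assms(1)[of 0] assms(2) by (simp add: inner_trig freq_def complex_eq_iff)
  next
    case (pos n)
    then show ?thesis using nn[of n] by simp
  next
    case (neg n)
    then show ?thesis using nn[of n] fourier_coeff_cnj[of x "int n"] by simp
  qed
qed

lemma Im_fourier_coeff_0: "Im (fourier_coeff x 0) = 0"
  using fourier_coeff_cnj[of x 0] by (simp add: complex_eq_iff)

interpretation L2: hilbert_basis "{x. in_L2 x}" inner_L2 trig_torus
proof
  show "trig_torus j \<in> {x. in_L2 x}" for j by (simp add: in_L2_trig)
  show "inner_L2 (trig_torus i) (trig_torus j) = (if i = j then 1 else 0)" for i j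
  proof -
    have p: "freq j = 0 \<longleftrightarrow> j = 0" "freq i = 0 \<longleftrightarrow> i = 0" unfolding freq_def by presburger+
    have D: "freq i = freq j \<Longrightarrow> odd i = odd j \<Longrightarrow> i = j" unfolding freq_def by presburger
    consider "i = j" | "i \<noteq> j" "freq i = freq j" "odd i" "even j" | "i \<noteq> j" "freq i = freq j" "even i" "odd j"
      | "i \<noteq> j" "freq i \<noteq> freq j"
      using D by blast
    then show ?thesis
      using p odd_pos[of i] odd_pos[of j] by cases (auto simp add: inner_trig fourier_coeff_trig)
  qed
  show "x = 0" if "\<And>j. inner_L2 x (trig_torus j) = 0" for x
    by (rule torus_eq_0I, rule trig_inner_zero_imp_fourier_zero) (simp_all add: that Im_fourier_coeff_0)
qed

section \<open>Fourier multipliers and the Sobolev space as a Hilbert space\<close>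

lemma freq_eq_0_iff [simp]: "freq j = 0 \<longleftrightarrow> j = 0"
  unfolding freq_def by presburger

lemma summable_freq:
  fixes h :: "nat \<Rightarrow> real"
  assumes "summable h"
  shows "summable (\<lambda>j. h (freq j))"
proof -
  have "(\<lambda>n. if even n then h (n div 2) else h (Suc ((n - 1) div 2))) sums (suminf (\<lambda>n. h (Suc n)) + suminf h)"
    using assms by (intro sums_if summable_sums) (simp_all add: summable_Suc_iff)
  moreover have "(if even n then h (n div 2) else h (Suc ((n - 1) div 2))) = h (freq n)" for n
    unfolding freq_def by (auto elim!: evenE oddE)
  ultimately show ?thesis by (simp add: sums_iff)
qed

text \<open>
  The Riesz-Fischer theorem for the real basis: the symmetry of \<open>c\<close> says that the function is real, and
  it turns \<open>c\<close> into the real coefficients \<open>a\<close>.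
\<close>

lemma in_L2_fourier_exists:
  assumes sym: "\<And>k. c (- k) = cnj (c k)"
    and c: "summable (\<lambda>m. (cmod (c (int m)))\<^sup>2)"
  shows "\<exists>y. in_L2 y \<and> (\<forall>k. fourier_coeff y k = c k)"
proof -
  define a where "a j = (if j = 0 then Re (c 0) else if odd j then sqrt 2 * Re (c (freq j))
     else - sqrt 2 * Im (c (freq j)))" for j
  have "summable (\<lambda>j. (a j)\<^sup>2)"
  proof (rule summable_comparison_test')
    show "summable (\<lambda>j. 2 * (cmod (c (int (freq j))))\<^sup>2)"
      by (intro summable_mult summable_freq[OF c])
    show "norm ((a j)\<^sup>2) \<le> 2 * (cmod (c (int (freq j))))\<^sup>2" for j
      by (auto simp: a_def power_mult_distrib cmod_power2 freq_def)
  qed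
  then obtain y where y: "in_L2 y" "\<And>j. inner_L2 y (trig_torus j) = a j"
    using L2.Riesz_Fischer[of a] by auto
  have pos: "fourier_coeff y (int m) = c (int m)" for m
  proof (cases "m = 0")
    case True
    have "Im (c 0) = 0" using sym[of 0] by (simp add: complex_eq_iff)
    then show ?thesis using y(2)[of 0] True by (simp add: inner_trig a_def complex_eq_iff Im_fourier_coeff_0)
  next
    case False
    then have "freq (2 * m - 1) = m" "freq (2 * m) = m" "odd (2 * m - 1)" by (auto simp: freq_def)
    then show ?thesis using y(2)[of "2 * m - 1"] y(2)[of "2 * m"] False
      by (simp add: inner_trig a_def complex_eq_iff)
  qed
  have "fourier_coeff y k = c k" for k
  proof (cases k rule: int_cases2)
    case (nonneg n)
    then show ?thesis using pos by simp
  next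
    case (nonpos n)
    then show ?thesis using pos[of n] fourier_coeff_cnj[of y "int n"] sym[of "int n"] by simp
  qed
  then show ?thesis using y by blast
qed

lemma in_L2_fourier_summable:
  assumes "in_L2 x"
  shows "summable (\<lambda>m. (cmod (fourier_coeff x (int m)))\<^sup>2)"
proof -
  have sub: "summable (\<lambda>m. (inner_L2 x (trig_torus (q m)))\<^sup>2)" if "inj q" for q
    by (rule bounded_imp_summable[where B = "inner_L2 x x"])
       (use L2.Bessel[of _ "\<lambda>m. trig_torus (q m)" x] that assms in \<open>auto simp: in_L2_trig L2.e_orth inj_eq\<close>)
  have "summable (\<lambda>m. ((inner_L2 x (trig_torus (2 * m + 1)))\<^sup>2 + (inner_L2 x (trig_torus (2 * m + 2)))\<^sup>2) / 2)"
    by (intro summable_divide summable_add sub) (auto simp: inj_def)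
  then have "summable (\<lambda>m. (cmod (fourier_coeff x (int (Suc m))))\<^sup>2)"
    by (subst cmod_fourier_coeff) auto
  then show ?thesis by (subst (asm) summable_Suc_iff)
qed

lemma is_multiplier_unique: "is_multiplier m x y \<Longrightarrow> multiplier m x = y"
  unfolding multiplier_def is_multiplier_def
  by (rule the_equality) (auto intro!: torus_eq_fourierI)

lemma is_multiplier_exists:
  assumes "in_L2 x" "\<And>k. m (- k) = cnj (m k)" "\<And>k. cmod (m k) \<le> 1"
  shows "is_multiplier m x (multiplier m x)"
proof -
  have "\<exists>y. in_L2 y \<and> (\<forall>k. fourier_coeff y k = m k * fourier_coeff x k)"
  proof (rule in_L2_fourier_exists)
    show "m (- k) * fourier_coeff x (- k) = cnj (m k * fourier_coeff x k)" for k
      using assms(2) by (simp add: fourier_coeff_cnj)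
    show "summable (\<lambda>j. (cmod (m (int j) * fourier_coeff x (int j)))\<^sup>2)"
    proof (rule summable_comparison_test'[OF in_L2_fourier_summable[OF assms(1)]])
      show "norm ((cmod (m (int j) * fourier_coeff x (int j)))\<^sup>2) \<le> (cmod (fourier_coeff x (int j)))\<^sup>2" for j
        using mult_right_mono[OF assms(3)[of "int j"], of "cmod (fourier_coeff x (int j))"]
        by (simp add: norm_mult power_mono)
    qed
  qed
  then obtain y where "is_multiplier m x y" by (auto simp: is_multiplier_def)
  with is_multiplier_unique[OF this] show ?thesis by simp
qed

text \<open>
  This holds for every \<open>x\<close>, also where the multiplier is undefined: then no \<open>y\<close> is described for \<open>x\<close> nor
  for \<open>-x\<close>, and the two definite descriptions agree because they are descriptions by the same empty
  predicate. It makes the Sobolev inner product symmetric outside the Sobolev space too.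
\<close>

lemma multiplier_uminus_inner:
  "inner_L2 (multiplier m (- x)) (multiplier m (- x)) = inner_L2 (multiplier m x) (multiplier m x)"
proof (cases "\<exists>y. is_multiplier m x y")
  case True
  then obtain y where y: "is_multiplier m x y" by blast
  then have "is_multiplier m (- x) (- y)"
    using in_L2_scaleR[of y "-1"] by (simp add: is_multiplier_def fourier_coeff_uminus)
  then show ?thesis using is_multiplier_unique y inner_L2_uminus by metis
next
  case False
  then have "\<not> is_multiplier m (- x) y" for y
    using in_L2_scaleR[of y "-1"] by (force simp: is_multiplier_def fourier_coeff_uminus dest: spec[of _ "- y"])
  then have "is_multiplier m x = is_multiplier m (- x)" using False by blast
  then show ?thesis by (simp add: multiplier_def)
qed

lemma weyl_symbol_cnj: "weyl_symbol r (- k) = cnj (weyl_symbol r k)"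
  by (simp add: weyl_symbol_def exp_cnj)

lemma cmod_weyl_symbol: "cmod (weyl_symbol r k) = \<bar>real_of_int k\<bar> powr r"
  by (simp add: weyl_symbol_def norm_mult)

lemma weyl_symbol_0 [simp]: "weyl_symbol r 0 = 0"
  by (simp add: weyl_symbol_def)

lemma weyl_symbol_inverse:
  assumes "k \<noteq> 0" shows "weyl_symbol r k * weyl_symbol (- r) k = 1"
proof -
  have "weyl_symbol r k * weyl_symbol (- r) k =
     of_real (\<bar>real_of_int k\<bar> powr r * \<bar>real_of_int k\<bar> powr - r)
      * (exp (pi * \<i> / 2 * of_real (r * sgn (real_of_int k))) * exp (pi * \<i> / 2 * of_real (- r * sgn (real_of_int k))))"
    by (simp add: weyl_symbol_def)
  also have "\<dots> = 1" using assms by (simp flip: powr_add exp_add)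
  finally show ?thesis .
qed

lemma powr_neg_le_one: "r > 0 \<Longrightarrow> \<bar>real_of_int k\<bar> powr - r \<le> 1"
proof (cases "k = 0")
  case False
  assume "r > 0"
  moreover have "1 \<le> \<bar>real_of_int k\<bar>" using False by linarith
  ultimately show ?thesis using powr_mono[of "-r" 0 "\<bar>real_of_int k\<bar>"] False by simp
qed simp

text \<open>
  The range of the Weyl derivative: the isometry \<open>x \<mapsto> x\<^sup>(\<^sup>r\<^sup>)\<close> maps the Sobolev space onto it.
\<close>

definition L2_0 :: "torus set" where "L2_0 = {y. in_L2 y \<and> fourier_coeff y 0 = 0}"

lemma fourier_weyl_neg:
  assumes "r > 0" "in_L2 y"
  shows "in_L2 (weyl (- r) y)" "fourier_coeff (weyl (- r) y) k = weyl_symbol (- r) k * fourier_coeff y k"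
  using is_multiplier_exists[of y "weyl_symbol (- r)"] assms
  by (simp_all add: weyl_def is_multiplier_def weyl_symbol_cnj cmod_weyl_symbol powr_neg_le_one)

lemma fourier_weyl:
  assumes "x \<in> W2 r"
  shows "in_L2 (weyl r x)" "fourier_coeff (weyl r x) k = weyl_symbol r k * fourier_coeff x k"
proof -
  obtain y where "is_multiplier (weyl_symbol r) x y" using assms by (auto simp: W2_def)
  with is_multiplier_unique[OF this] show "in_L2 (weyl r x)"
      "fourier_coeff (weyl r x) k = weyl_symbol r k * fourier_coeff x k"
    by (auto simp: weyl_def is_multiplier_def)
qed

lemma weyl_in_L2_0: "x \<in> W2 r \<Longrightarrow> weyl r x \<in> L2_0"
  by (simp add: L2_0_def fourier_weyl)

lemma weyl_eqI: "in_L2 y \<Longrightarrow> (\<And>k. fourier_coeff y k = weyl_symbol r k * fourier_coeff x k) \<Longrightarrow> weyl r x = y"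
  unfolding weyl_def by (intro is_multiplier_unique) (simp add: is_multiplier_def)

lemma weyl_neg_in_W2:
  assumes "r > 0" "y \<in> L2_0"
  shows "weyl (- r) y \<in> W2 r" "weyl r (weyl (- r) y) = y"
proof -
  have y: "in_L2 y" "fourier_coeff y 0 = 0" using assms by (auto simp: L2_0_def)
  have *: "fourier_coeff y k = weyl_symbol r k * fourier_coeff (weyl (- r) y) k" for k
    using weyl_symbol_inverse[of k r] y
    by (cases "k = 0") (simp_all add: fourier_weyl_neg[OF assms(1) y(1)] flip: mult.assoc)
  show "weyl (- r) y \<in> W2 r"
    unfolding W2_def is_multiplier_def using * y fourier_weyl_neg[OF assms(1) y(1)] by auto
  show "weyl r (weyl (- r) y) = y" by (rule weyl_eqI[OF y(1) *])
qed

lemma W2_subspace: "subspace (W2 r)"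
proof -
  have "0 \<in> W2 r"
    unfolding W2_def is_multiplier_def by (auto simp: in_L2_zero intro!: exI[of _ 0])
  moreover have "x + y \<in> W2 r" if "x \<in> W2 r" "y \<in> W2 r" for x y
    unfolding W2_def is_multiplier_def
    using that by (auto simp: W2_def in_L2_add fourier_coeff_add fourier_weyl[OF that(1)] fourier_weyl[OF that(2)]
        distrib_left intro!: exI[of _ "weyl r x + weyl r y"])
  moreover have "c *\<^sub>R x \<in> W2 r" if "x \<in> W2 r" for x c
    unfolding W2_def is_multiplier_def
    using that by (auto simp: W2_def in_L2_scaleR fourier_coeff_scaleR fourier_weyl[OF that(1)]
        intro!: exI[of _ "c *\<^sub>R weyl r x"])
  ultimately show ?thesis by (simp add: subspace_def)
qed

lemma weyl_add: "x \<in> W2 r \<Longrightarrow> y \<in> W2 r \<Longrightarrow> weyl r (x + y) = weyl r x + weyl r y"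
  by (rule weyl_eqI) (simp_all add: fourier_weyl in_L2_add fourier_coeff_add distrib_left)

lemma weyl_scaleR: "x \<in> W2 r \<Longrightarrow> weyl r (c *\<^sub>R x) = c *\<^sub>R weyl r x"
  by (rule weyl_eqI) (simp_all add: fourier_weyl in_L2_scaleR fourier_coeff_scaleR)

lemma weyl_diff: "x \<in> W2 r \<Longrightarrow> y \<in> W2 r \<Longrightarrow> weyl r (x - y) = weyl r x - weyl r y"
  using weyl_add[of x r "(-1) *\<^sub>R y"] weyl_scaleR[of y r "-1"] subspace_scale[OF W2_subspace, of y r "-1"]
  by simp

lemma weyl_eq_0: "x \<in> W2 r \<Longrightarrow> weyl r x = 0 \<Longrightarrow> x = 0"
proof (rule torus_eq_0I)
  fix k assume x: "x \<in> W2 r" and "weyl r x = 0"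
  then have "weyl_symbol r k * fourier_coeff x k = 0" using fourier_weyl(2)[OF x, of k] by simp
  moreover have "weyl_symbol r k \<noteq> 0" if "k \<noteq> 0"
    using cmod_weyl_symbol[of r k] that by auto
  ultimately show "fourier_coeff x k = 0"
    using x by (cases "k = 0") (auto simp: W2_def)
qed

text \<open>
  The index is shifted by one to skip the constant function, which has no periodic antiderivative.
\<close>

definition sob_basis :: "real \<Rightarrow> nat \<Rightarrow> torus" where
  "sob_basis r j = weyl (- r) (trig_torus (Suc j))"

lemma trig_L2_0: "trig_torus (Suc j) \<in> L2_0"
  by (auto simp: L2_0_def in_L2_trig fourier_coeff_trig)

lemma inner_sob_basis:
  "r > 0 \<Longrightarrow> inner_W2 r x (sob_basis r j) = inner_L2 (weyl r x) (trig_torus (Suc j))"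
  unfolding inner_W2_def sob_basis_def by (simp add: weyl_neg_in_W2(2)[OF _ trig_L2_0])

text \<open>
  Everything is transported from \<open>L\<^sub>2\<close> along the isometry \<open>weyl r\<close>. For completeness the \<open>L\<^sub>2\<close> limit of the
  derivatives must have mean value zero in order to be a derivative again; the mean value is a
  continuous functional that vanishes along the sequence.
\<close>

lemma W2_hilbert_basis:
  assumes r: "r > 0"
  shows "hilbert_basis (W2 r) (inner_W2 r) (sob_basis r)"
proof
  show "subspace (W2 r)" by (rule W2_subspace)
  show "inner_W2 r x y = inner_W2 r y x" for x y
    by (simp add: inner_W2_def inner_L2_commute)
  show "inner_W2 r (x + y) z = inner_W2 r x z + inner_W2 r y z"
    if "x \<in> W2 r" "y \<in> W2 r" "z \<in> W2 r" for x y z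
    using that by (simp add: inner_W2_def weyl_add inner_L2_add fourier_weyl)
  show "inner_W2 r (c *\<^sub>R x) z = c * inner_W2 r x z" if "x \<in> W2 r" for x z c
    using that by (simp add: inner_W2_def weyl_scaleR inner_L2_scaleR)
  show "0 < inner_W2 r x x" if "x \<in> W2 r" "x \<noteq> 0" for x
    using L2.pos[of "weyl r x"] weyl_eq_0[of x r] that fourier_weyl(1)[of x r] by (auto simp: inner_W2_def)
  show "0 \<le> inner_W2 r x x" for x by (simp add: inner_W2_def inner_L2_nonneg)
  show "inner_W2 r (- x) (- x) = inner_W2 r x x" for x
    unfolding inner_W2_def weyl_def by (rule multiplier_uminus_inner)
  show "\<exists>x\<in>W2 r. (\<lambda>n. inner_W2 r (s n - x) (s n - x)) \<longlonglongrightarrow> 0"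
    if s: "\<And>n. s n \<in> W2 r"
      and c: "\<And>e. e > 0 \<Longrightarrow> \<exists>N. \<forall>m\<ge>N. \<forall>n\<ge>N. inner_W2 r (s m - s n) (s m - s n) < e" for s
  proof -
    have "\<exists>N. \<forall>m\<ge>N. \<forall>n\<ge>N. inner_L2 (weyl r (s m) - weyl r (s n)) (weyl r (s m) - weyl r (s n)) < e" if "e > 0" for e
      using c[OF that] by (simp add: inner_W2_def weyl_diff s)
    from L2_complete[of "\<lambda>n. weyl r (s n)", OF fourier_weyl(1)[OF s] this]
    obtain y where y: "in_L2 y" "(\<lambda>n. inner_L2 (weyl r (s n) - y) (weyl r (s n) - y)) \<longlonglongrightarrow> 0" by blast
    have "(\<lambda>n. inner_L2 (weyl r (s n) - y) (trig_torus 0)) \<longlonglongrightarrow> 0"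
    proof (rule Lim_null_comparison)
      show "(\<lambda>n. sqrt (inner_L2 (weyl r (s n) - y) (weyl r (s n) - y))) \<longlonglongrightarrow> 0"
        using tendsto_real_sqrt[OF y(2)] by simp
      show "\<forall>\<^sub>F n in sequentially. norm (inner_L2 (weyl r (s n) - y) (trig_torus 0))
          \<le> sqrt (inner_L2 (weyl r (s n) - y) (weyl r (s n) - y))"
        using L2.abs_ip_le[of "weyl r (s _) - y" "trig_torus 0"] fourier_weyl(1)[OF s] y(1) in_L2_trig L2.mem(4)
        by (intro always_eventually allI) (auto simp: L2.nrm_def L2.e_orth)
    qed
    moreover have "inner_L2 (weyl r (s n) - y) (trig_torus 0) = - Re (fourier_coeff y 0)" for n
      by (simp add: inner_trig fourier_coeff_diff fourier_weyl(2)[OF s])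
    ultimately have "Re (fourier_coeff y 0) = 0" by (simp add: LIMSEQ_const_iff)
    then have y0: "y \<in> L2_0" using y Im_fourier_coeff_0[of y] by (simp add: L2_0_def complex_eq_iff)
    show ?thesis
      using weyl_neg_in_W2[OF r y0] y(2) s by (intro bexI[of _ "weyl (- r) y"]) (simp_all add: inner_W2_def weyl_diff)
  qed
  show "sob_basis r j \<in> W2 r" for j
    unfolding sob_basis_def by (rule weyl_neg_in_W2(1)[OF r trig_L2_0])
  show "inner_W2 r (sob_basis r i) (sob_basis r j) = (if i = j then 1 else 0)" for i j
    unfolding inner_sob_basis[OF r] unfolding sob_basis_def weyl_neg_in_W2(2)[OF r trig_L2_0]
    by (simp add: L2.e_orth)
  show "x = 0" if x: "x \<in> W2 r" and 0: "\<And>j. inner_W2 r x (sob_basis r j) = 0" for x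
  proof (rule weyl_eq_0[OF x], rule L2.total)
    show "weyl r x \<in> {x. in_L2 x}" using fourier_weyl(1)[OF x] by simp
    show "inner_L2 (weyl r x) (trig_torus j) = 0" for j
      using 0[of "j - 1"] fourier_weyl(2)[OF x, of 0]
      by (cases j) (simp_all add: inner_sob_basis[OF r] inner_trig)
  qed
qed

subsection \<open>The norm of \<open>S\<^sub>\<infinity>\<close>\<close>

lemma bdd_above_fourier: "bdd_above (range (\<lambda>k. cmod (fourier_coeff x k)))"
  using norm_fourier_coeff_le by (intro bdd_aboveI2) blast

text \<open>
  The Fourier coefficients of a function are bounded by its \<open>L\<^sub>1\<close> norm.
\<close>

lemma S_inf_UNIV: "S_inf = UNIV"
proof -
  have "bounded (range (fourier_coeff x))" for x
    using norm_fourier_coeff_le by (intro boundedI[where B="(LINT t|torus_measure. \<bar>rep_torus x t\<bar>) / (2 * pi)"]) auto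
  then show ?thesis by (auto simp: S_inf_def)
qed

lemma fourier_le_norm_S: "cmod (fourier_coeff x k) \<le> norm_S x"
  unfolding norm_S_def by (rule cSUP_upper[OF _ bdd_above_fourier]) simp

lemma norm_S_leI: "(\<And>k. cmod (fourier_coeff x k) \<le> B) \<Longrightarrow> norm_S x \<le> B"
  unfolding norm_S_def by (rule cSUP_least) auto

lemma norm_S_nonneg [simp]: "0 \<le> norm_S x"
  using fourier_le_norm_S[of x 0] norm_ge_zero order_trans by blast

lemma norm_S_triangle: "norm_S (x + y) \<le> norm_S x + norm_S y"
  by (rule norm_S_leI)
     (metis fourier_coeff_add add_mono fourier_le_norm_S norm_triangle_le)

lemma norm_S_minus_commute: "norm_S (x - y) = norm_S (y - x)"
  by (simp add: norm_S_def fourier_coeff_diff norm_minus_commute)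

lemma norm_S_zero [simp]: "norm_S 0 = 0"
  by (simp add: norm_S_def)

lemma norm_S_eq_0: "norm_S x = 0 \<longleftrightarrow> x = 0"
proof
  assume "norm_S x = 0"
  then have "cmod (fourier_coeff x k) \<le> 0" for k using fourier_le_norm_S[of x k] by simp
  then show "x = 0" by (intro torus_eq_0I) simp
qed simp

interpretation S: Metric_space UNIV "\<lambda>x y. norm_S (x - y)"
proof
  fix x y z
  show "norm_S (x - y) = 0 \<longleftrightarrow> x = y" by (simp add: norm_S_eq_0)
  show "norm_S (x - z) \<le> norm_S (x - y) + norm_S (y - z)"
    using norm_S_triangle[of "x - y" "y - z"] by simp
qed (simp_all add: norm_S_minus_commute)

lemma top_S_eq: "top_S = S.mtopology"
  unfolding top_S_def S_inf_UNIV by simp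

text \<open>
  The frequency of the basis function \<open>sob_basis r j\<close>; every frequency occurs for two consecutive \<open>j\<close>.
\<close>

definition kap :: "nat \<Rightarrow> real" where "kap j = real (freq (Suc j))"

lemma kap_ge_1: "kap j \<ge> 1"
  using freq_eq_0_iff[of "Suc j"] unfolding kap_def by linarith

lemma kap_pos [simp]: "kap j > 0" using kap_ge_1[of j] by linarith

lemma fourier_coeff_sobolev:
  assumes "r > 0" "x \<in> W2 r" "m > 0"
  shows "cmod (fourier_coeff x (int m)) = real m powr - r *
    sqrt (((inner_W2 r x (sob_basis r (2 * m - 2)))\<^sup>2 + (inner_W2 r x (sob_basis r (2 * m - 1)))\<^sup>2) / 2)"
proof -
  have S: "Suc (2 * m - 2) = 2 * m - 1" "Suc (2 * m - 1) = 2 * m" using assms by auto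
  have "cmod (fourier_coeff (weyl r x) (int m)) = real m powr r * cmod (fourier_coeff x (int m))"
    by (simp add: fourier_weyl(2)[OF assms(2)] norm_mult cmod_weyl_symbol)
  then have "cmod (fourier_coeff x (int m)) = real m powr - r * cmod (fourier_coeff (weyl r x) (int m))"
    using assms(3) by (simp add: powr_minus field_simps)
  also have "cmod (fourier_coeff (weyl r x) (int m)) =
    sqrt (((inner_W2 r x (sob_basis r (2 * m - 2)))\<^sup>2 + (inner_W2 r x (sob_basis r (2 * m - 1)))\<^sup>2) / 2)"
    unfolding inner_sob_basis[OF assms(1)] S cmod_fourier_coeff[OF assms(3), symmetric] by simp
  finally show ?thesis .
qed

text \<open>
  The squared modulus of a Fourier coefficient is the mean of the squares of its two weighted
  coordinates, hence at most the larger of them; conversely it is at least half of each of them, which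
  costs the factor \<open>\<surd>2\<close> in \<open>coords_le_norm_S\<close>.
\<close>

lemma norm_S_le_coords:
  assumes r: "r > 0" and x: "x \<in> W2 r" and t: "\<And>j. kap j powr - r * \<bar>inner_W2 r x (sob_basis r j)\<bar> \<le> t"
  shows "norm_S x \<le> t"
proof (rule norm_S_leI)
  have t0: "0 \<le> t" using t[of 0] by (smt (verit) mult_nonneg_nonneg powr_ge_zero)
  have posm: "cmod (fourier_coeff x (int m)) \<le> t" if m: "m > 0" for m
  proof -
    let ?a = "real m powr - r * \<bar>inner_W2 r x (sob_basis r (2 * m - 2))\<bar>"
    let ?b = "real m powr - r * \<bar>inner_W2 r x (sob_basis r (2 * m - 1))\<bar>"
    have "freq (Suc (2 * m - 2)) = m" "freq (Suc (2 * m - 1)) = m" using m unfolding freq_def by presburger+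
    then have k: "kap (2 * m - 2) = real m" "kap (2 * m - 1) = real m" by (simp_all only: kap_def)
    have "?a \<le> t" "?b \<le> t" using t[of "2 * m - 2"] t[of "2 * m - 1"] k by auto
    then have "?a\<^sup>2 \<le> t\<^sup>2" "?b\<^sup>2 \<le> t\<^sup>2" using t0 by (auto intro!: power_mono)
    moreover have "(cmod (fourier_coeff x (int m)))\<^sup>2 = (?a\<^sup>2 + ?b\<^sup>2) / 2"
      by (simp add: fourier_coeff_sobolev[OF r x m] power_mult_distrib distrib_left)
    ultimately have "(cmod (fourier_coeff x (int m)))\<^sup>2 \<le> t\<^sup>2" by simp
    then show ?thesis using t0 by (rule power2_le_imp_le)
  qed
  fix k
  show "cmod (fourier_coeff x k) \<le> t"
  proof (cases k rule: int_cases3)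
    case zero then show ?thesis using x t0 by (simp add: W2_def)
  next
    case (pos n) then show ?thesis using posm[of n] by simp
  next
    case (neg n) then show ?thesis using posm[of n] by (simp add: fourier_coeff_cnj)
  qed
qed

lemma coords_le_norm_S:
  assumes r: "r > 0" and x: "x \<in> W2 r"
  shows "kap j powr - r * \<bar>inner_W2 r x (sob_basis r j)\<bar> \<le> sqrt 2 * norm_S x"
proof -
  define m where "m = freq (Suc j)"
  have m: "m > 0" using freq_eq_0_iff[of "Suc j"] unfolding m_def by linarith
  have j: "j = 2 * m - 2 \<or> j = 2 * m - 1" unfolding m_def freq_def by presburger
  let ?a = "inner_W2 r x (sob_basis r (2 * m - 2))" and ?b = "inner_W2 r x (sob_basis r (2 * m - 1))"
  have "\<bar>inner_W2 r x (sob_basis r j)\<bar> \<le> sqrt (?a\<^sup>2 + ?b\<^sup>2)"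
    using j by (auto intro!: real_le_rsqrt)
  also have "\<dots> = sqrt 2 * sqrt ((?a\<^sup>2 + ?b\<^sup>2) / 2)" by (simp flip: real_sqrt_mult)
  finally have "kap j powr - r * \<bar>inner_W2 r x (sob_basis r j)\<bar> \<le> kap j powr - r * (sqrt 2 * sqrt ((?a\<^sup>2 + ?b\<^sup>2) / 2))"
    by (rule mult_left_mono) simp
  also have "\<dots> = sqrt 2 * cmod (fourier_coeff x (int m))"
    unfolding fourier_coeff_sobolev[OF r x m] by (simp add: kap_def m_def)
  also have "\<dots> \<le> sqrt 2 * norm_S x" by (intro mult_left_mono fourier_le_norm_S) simp
  finally show ?thesis .
qed

subsection \<open>Coordinates of the Gaussian measure\<close>

lemma fourier_corr_op:
  assumes "\<rho> > 0" "in_L2 y"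
  shows "in_L2 (corr_op \<rho> y)" "fourier_coeff (corr_op \<rho> y) k = of_real (\<bar>real_of_int k\<bar> powr - \<rho>) * fourier_coeff y k"
  using is_multiplier_exists[of y "\<lambda>k. of_real (\<bar>real_of_int k\<bar> powr - \<rho>)"] assms
  by (simp_all add: corr_op_def is_multiplier_def powr_neg_le_one)

lemma inner_corr_op_trig:
  assumes "\<rho> > 0" "in_L2 y"
  shows "inner_L2 (corr_op \<rho> y) (trig_torus j) = real (freq j) powr - \<rho> * inner_L2 y (trig_torus j)"
  by (simp add: inner_trig fourier_corr_op[OF assms])

lemma inner_corr_op:
  assumes "\<rho> > 0" "in_L2 y" "in_L2 z"
  shows "(\<lambda>j. real (freq j) powr - \<rho> * inner_L2 y (trig_torus j) * inner_L2 z (trig_torus j)) sums inner_L2 (corr_op \<rho> y) z"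
  using L2.Parseval[of "corr_op \<rho> y" z] fourier_corr_op(1)[OF assms(1,2)] assms
  by (simp add: inner_corr_op_trig)

section \<open>Gaussian measures on a Hilbert space\<close>

context hilbert
begin

definition borel_V :: "'a measure" where
  "borel_V = sigma V {U. openin M.mtopology U}"

lemma space_borel_V [simp]: "space borel_V = V"
  by (simp add: borel_V_def space_measure_of_conv)

lemma openin_borel_V: "openin M.mtopology U \<Longrightarrow> U \<in> sets borel_V"
proof -
  assume U: "openin M.mtopology U"
  have "{U. openin M.mtopology U} \<subseteq> Pow V"
    using openin_subset[of M.mtopology] by (simp add: subset_eq)
  then show ?thesis using U by (simp add: borel_V_def sets_measure_of sigma_sets.Basic)
qed

text \<open>
  The source of all measurability on \<open>V\<close>: inner products and the norm of \<open>S\<^sub>\<infinity>\<close> are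
  Lipschitz continuous with respect to the Hilbert norm, hence Borel.
\<close>

lemma lipschitz_measurable:
  fixes f :: "'a \<Rightarrow> real"
  assumes L: "\<And>x y. x \<in> V \<Longrightarrow> y \<in> V \<Longrightarrow> \<bar>f x - f y\<bar> \<le> L * nrm (x - y)"
  shows "f \<in> borel_measurable borel_V"
proof (rule borel_measurableI)
  fix T :: "real set" assume T: "open T"
  have "openin M.mtopology (f -` T \<inter> V)"
    unfolding M.openin_mtopology
  proof (intro conjI allI impI)
    fix x assume x: "x \<in> f -` T \<inter> V"
    then obtain \<epsilon> where \<epsilon>: "\<epsilon> > 0" "ball (f x) \<epsilon> \<subseteq> T" using T by (auto simp: open_contains_ball)
    have "y \<in> f -` T \<inter> V" if y: "y \<in> M.mball x (\<epsilon> / (\<bar>L\<bar> + 1))" for y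
    proof -
      have yV: "y \<in> V" and d: "nrm (x - y) < \<epsilon> / (\<bar>L\<bar> + 1)" using y by (auto simp: M.in_mball)
      have "\<bar>f x - f y\<bar> \<le> L * nrm (x - y)" using L x yV by simp
      also have "\<dots> \<le> (\<bar>L\<bar> + 1) * nrm (x - y)" by (intro mult_right_mono) auto
      also have "\<dots> < \<epsilon>" using d by (simp add: pos_less_divide_eq mult.commute[of _ "\<bar>L\<bar> + 1"])
      finally have "f y \<in> ball (f x) \<epsilon>" by (simp add: dist_real_def)
      then show ?thesis using \<epsilon> yV by auto
    qed
    then show "\<exists>r>0. M.mball x r \<subseteq> f -` T \<inter> V"
      using \<epsilon>(1) by (intro exI[of _ "\<epsilon> / (\<bar>L\<bar> + 1)"]) auto
  qed simp
  then show "f -` T \<inter> space borel_V \<in> sets borel_V" by (simp add: openin_borel_V)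
qed

lemma ip_measurable:
  assumes h: "h \<in> V"
  shows "(\<lambda>x. ip x h) \<in> borel_measurable borel_V"
proof (rule lipschitz_measurable)
  fix x y assume "x \<in> V" "y \<in> V"
  then show "\<bar>ip x h - ip y h\<bar> \<le> nrm h * nrm (x - y)"
    using abs_ip_le[of "x - y" h] h by (simp add: diff_left mult.commute)
qed

end

text \<open>
  What the estimates need of the Gaussian measure: independent coordinates with variances \<open>lam j\<close>, and
  the law of every continuous linear functional. The latter does not follow formally from the former
  without a limit argument, but both are instances of the cylindrical formula.
\<close>

locale gaussian_space = hilbert_basis V ip e + prob_space \<mu>
  for V :: "'a::real_vector set" and ip e and \<mu> :: "'a measure" +
  fixes lam :: "nat \<Rightarrow> real"
  assumes lam_pos: "0 < lam j" and lam_le_1: "lam j \<le> 1"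
    and space_mu: "space \<mu> = V"
    and sets_mu: "sets \<mu> = sets borel_V"
    and law: "h \<in> V \<Longrightarrow> h \<noteq> 0 \<Longrightarrow>
      distributed \<mu> lborel (\<lambda>x. ip x h) (normal_density 0 (sqrt (\<Sum>j. lam j * (ip h (e j))\<^sup>2)))"
    and indep: "indep_vars (\<lambda>_. borel) (\<lambda>j x. ip x (e j)) UNIV"

lemma kap_neq_0 [simp]: "kap j \<noteq> 0"
  using kap_pos[of j] less_irrefl by metis

text \<open>
  On a box the cylindrical formula is an integral of a product of functions of one variable each, so it
  factorises into one-dimensional normal probabilities.
\<close>

lemma gaussian_box:
  assumes \<mu>: "gaussian_W2 r \<rho> \<mu>" and y: "gaussian_system \<rho> m y" and A: "\<And>j. A j \<in> sets borel"
    and \<sigma>: "\<And>j. j < m \<Longrightarrow> inner_L2 (corr_op \<rho> (y j)) (y j) = \<sigma> j" "\<And>j. j < m \<Longrightarrow> 0 < \<sigma> j"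
  shows "emeasure \<mu> {x \<in> W2 r. \<forall>j<m. inner_W2 r x (weyl (- r) (y j)) \<in> A j} =
    (\<Prod>j<m. emeasure (density lborel (normal_density 0 (sqrt (\<sigma> j)))) (A j))"
proof -
  interpret product_sigma_finite "\<lambda>_::nat. lborel :: real measure" ..
  let ?B = "PiE {..<m} A"
  have B: "?B \<in> sets (PiM {..<m} (\<lambda>_. borel))" using A by (intro sets_PiM_I_finite) auto
  have eq: "{x \<in> W2 r. \<forall>j<m. inner_W2 r x (weyl (- r) (y j)) \<in> A j}
      = {x \<in> W2 r. (\<lambda>j\<in>{..<m}. inner_W2 r x (weyl (- r) (y j))) \<in> ?B}"
    by auto
  have "emeasure \<mu> {x \<in> W2 r. \<forall>j<m. inner_W2 r x (weyl (- r) (y j)) \<in> A j} =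
      ennreal (\<Prod>j<m. (2 * pi * inner_L2 (corr_op \<rho> (y j)) (y j)) powr (- 1 / 2)) *
      (\<integral>\<^sup>+ u\<in>?B. ennreal (exp (- (\<Sum>j<m. \<bar>u j\<bar>\<^sup>2 / (2 * inner_L2 (corr_op \<rho> (y j)) (y j))))) \<partial>(PiM {..<m} (\<lambda>_. lborel)))"
    unfolding eq using \<mu> y B unfolding gaussian_W2_def Let_def by blast
  also have "(\<Prod>j<m. (2 * pi * inner_L2 (corr_op \<rho> (y j)) (y j)) powr (- 1 / 2)) = (\<Prod>j<m. (2 * pi * \<sigma> j) powr (- 1 / 2))"
    using \<sigma> by (intro prod.cong) auto
  also have "(\<lambda>u. \<Sum>j<m. \<bar>u j\<bar>\<^sup>2 / (2 * inner_L2 (corr_op \<rho> (y j)) (y j))) = (\<lambda>u. \<Sum>j<m. (u j)\<^sup>2 / (2 * \<sigma> j))"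
    using \<sigma> by (intro ext sum.cong) auto
  also have "(\<integral>\<^sup>+ u\<in>?B. ennreal (exp (- (\<Sum>j<m. (u j)\<^sup>2 / (2 * \<sigma> j)))) \<partial>(PiM {..<m} (\<lambda>_. lborel)))
     = (\<integral>\<^sup>+ u. (\<Prod>j<m. ennreal (exp (- ((u j)\<^sup>2 / (2 * \<sigma> j)))) * indicator (A j) (u j)) \<partial>(PiM {..<m} (\<lambda>_. lborel)))"
  proof (rule nn_integral_cong)
    fix u :: "nat \<Rightarrow> real" assume u: "u \<in> space (PiM {..<m} (\<lambda>_. lborel))"
    have "exp (- (\<Sum>j<m. (u j)\<^sup>2 / (2 * \<sigma> j))) = (\<Prod>j<m. exp (- ((u j)\<^sup>2 / (2 * \<sigma> j))))"
      by (simp add: exp_sum flip: sum_negf)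
    moreover have "indicator ?B u = (\<Prod>j<m. indicator (A j) (u j) :: ennreal)"
    proof (cases "u \<in> ?B")
      case True
      then have "u j \<in> A j" if "j < m" for j using that by auto
      then show ?thesis using True by simp
    next
      case False
      then obtain j where "j < m" "u j \<notin> A j" using u by (auto simp: space_PiM PiE_iff)
      then show ?thesis using False by (auto intro!: prod_zero[symmetric] bexI[of _ j])
    qed
    ultimately show "ennreal (exp (- (\<Sum>j<m. (u j)\<^sup>2 / (2 * \<sigma> j)))) * indicator ?B u =
       (\<Prod>j<m. ennreal (exp (- ((u j)\<^sup>2 / (2 * \<sigma> j)))) * indicator (A j) (u j))"
      by (simp add: prod.distrib prod_ennreal)
  qed
  also have "\<dots> = (\<Prod>j<m. \<integral>\<^sup>+ u. ennreal (exp (- (u\<^sup>2 / (2 * \<sigma> j)))) * indicator (A j) u \<partial>lborel)"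
    by (rule product_nn_integral_prod) (use A in \<open>auto intro!: borel_measurable_times_ennreal\<close>)
  also have "ennreal (\<Prod>j<m. (2 * pi * \<sigma> j) powr (- 1 / 2)) * \<dots> =
     (\<Prod>j<m. ennreal ((2 * pi * \<sigma> j) powr (- 1 / 2)) *
         (\<integral>\<^sup>+ u. ennreal (exp (- (u\<^sup>2 / (2 * \<sigma> j)))) * indicator (A j) u \<partial>lborel))"
    by (simp add: prod.distrib prod_ennreal)
  also have "\<dots> = (\<Prod>j<m. emeasure (density lborel (normal_density 0 (sqrt (\<sigma> j)))) (A j))"
  proof (rule prod.cong)
    fix j assume "j \<in> {..<m}"
    then have p: "\<sigma> j > 0" using \<sigma> by auto
    have "emeasure (density lborel (normal_density 0 (sqrt (\<sigma> j)))) (A j)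
      = (\<integral>\<^sup>+ u. ennreal (normal_density 0 (sqrt (\<sigma> j)) u) * indicator (A j) u \<partial>lborel)"
      using A by (subst emeasure_density) auto
    also have "\<dots> = (\<integral>\<^sup>+ u. ennreal ((2 * pi * \<sigma> j) powr (- 1 / 2)) * (ennreal (exp (- (u\<^sup>2 / (2 * \<sigma> j)))) * indicator (A j) u) \<partial>lborel)"
    proof (rule nn_integral_cong)
      fix u :: real
      have "normal_density 0 (sqrt (\<sigma> j)) u = (2 * pi * \<sigma> j) powr (- 1 / 2) * exp (- (u\<^sup>2 / (2 * \<sigma> j)))"
        using p powr_minus_divide[of "2 * pi * \<sigma> j" "1/2"] by (simp add: normal_density_def powr_half_sqrt)
      then show "ennreal (normal_density 0 (sqrt (\<sigma> j)) u) * indicator (A j) u =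
          ennreal ((2 * pi * \<sigma> j) powr (- 1 / 2)) * (ennreal (exp (- (u\<^sup>2 / (2 * \<sigma> j)))) * indicator (A j) u)"
        by (simp only: ennreal_mult'' ennreal_mult mult.assoc exp_ge_zero)
    qed
    also have "\<dots> = ennreal ((2 * pi * \<sigma> j) powr (- 1 / 2)) *
         (\<integral>\<^sup>+ u. ennreal (exp (- (u\<^sup>2 / (2 * \<sigma> j)))) * indicator (A j) u \<partial>lborel)"
      using A[of j] by (intro nn_integral_cmult) auto
    finally show "ennreal ((2 * pi * \<sigma> j) powr (- 1 / 2)) *
         (\<integral>\<^sup>+ u. ennreal (exp (- (u\<^sup>2 / (2 * \<sigma> j)))) * indicator (A j) u \<partial>lborel)
       = emeasure (density lborel (normal_density 0 (sqrt (\<sigma> j)))) (A j)" by simp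
  qed simp
  finally show ?thesis .
qed

context
  fixes r \<rho> :: real and \<mu> :: "torus measure"
  assumes r: "r > 0" and \<rho>: "\<rho> > 0" and \<mu>: "gaussian_W2 r \<rho> \<mu>"
begin

interpretation W: hilbert_basis "W2 r" "inner_W2 r" "sob_basis r"
  by (rule W2_hilbert_basis[OF r])

lemma top_W2_eq: "top_W2 r = W.M.mtopology"
  by (simp add: top_W2_def W.nrm_def[abs_def])

lemma borel_W2_eq: "borel_W2 r = W.borel_V"
  by (simp add: borel_W2_def W.borel_V_def top_W2_eq)

lemma sets_gaussian: "sets \<mu> = sets W.borel_V"
  using \<mu> by (simp add: gaussian_W2_def borel_W2_eq)

lemma space_gaussian: "space \<mu> = W2 r"
  using sets_eq_imp_space_eq[OF sets_gaussian] by simp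

lemma prob_space_gaussian: "prob_space \<mu>"
proof
  have "gaussian_system \<rho> 0 (\<lambda>_. 0)" by (simp add: gaussian_system_def)
  from gaussian_box[OF \<mu> this, of "\<lambda>_. UNIV" "\<lambda>_. 1"] show "emeasure \<mu> (space \<mu>) = 1"
    by (simp add: space_gaussian)
qed

lemma inner_measurable:
  assumes h: "h \<in> W2 r"
  shows "(\<lambda>x. inner_W2 r x h) \<in> borel_measurable \<mu>"
  using W.ip_measurable[OF h] by (simp add: measurable_cong_sets[OF sets_gaussian refl])

lemma gaussian_trig_box:
  assumes A: "\<And>j. A j \<in> sets borel"
  shows "emeasure \<mu> {x \<in> W2 r. \<forall>j<m. inner_W2 r x (sob_basis r j) \<in> A j} =
    (\<Prod>j<m. emeasure (density lborel (normal_density 0 (sqrt (kap j powr - \<rho>)))) (A j))"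
  unfolding sob_basis_def
proof (rule gaussian_box[OF \<mu> _ A])
  show "gaussian_system \<rho> m (\<lambda>j. trig_torus (Suc j))"
    using trig_L2_0 by (auto simp: gaussian_system_def L2.e_orth L2_0_def inner_corr_op_trig[OF \<rho>])
qed (auto simp: L2.e_orth inner_corr_op_trig[OF \<rho>] in_L2_trig kap_def)

text \<open>
  A single unit vector always forms an admissible system for the cylindrical formula, since there
  are no off-diagonal conditions. The derivative of \<open>h\<close> divided by its norm \<open>c\<close> is such a vector, and
  the functional for \<open>h\<close> is \<open>c\<close> times the functional in the formula.
\<close>

lemma gaussian_law:
  assumes h: "h \<in> W2 r" "h \<noteq> 0"
  shows "distributed \<mu> lborel (\<lambda>x. inner_W2 r x h)
    (normal_density 0 (sqrt (\<Sum>j. kap j powr - \<rho> * (inner_W2 r h (sob_basis r j))\<^sup>2)))"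
proof -
  define c where "c = sqrt (inner_W2 r h h)"
  have c: "c > 0" using W.pos[OF h] by (simp add: c_def)
  define y where "y = (1 / c) *\<^sub>R weyl r h"
  have y0: "y \<in> L2_0"
    using weyl_in_L2_0[OF h(1)] by (simp add: y_def L2_0_def in_L2_scaleR fourier_coeff_scaleR)
  then have yL2: "in_L2 y" by (simp add: L2_0_def)
  have yy: "inner_L2 y y = 1"
  proof -
    have "inner_L2 y y = (1 / c) * inner_L2 (weyl r h) y"
      unfolding y_def by (rule inner_L2_scaleR)
    also have "inner_L2 (weyl r h) y = (1 / c) * inner_L2 (weyl r h) (weyl r h)"
      unfolding inner_L2_commute[of "weyl r h" y] unfolding y_def by (rule inner_L2_scaleR)
    also have "inner_L2 (weyl r h) (weyl r h) = c * c"
      using W.nonneg[of h] by (simp add: c_def inner_W2_def)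
    finally show ?thesis using c by simp
  qed
  define \<sigma> where "\<sigma> = inner_L2 (corr_op \<rho> y) y"
  have sums: "(\<lambda>j. kap j powr - \<rho> * (inner_L2 y (trig_torus (Suc j)))\<^sup>2) sums \<sigma>"
    using inner_corr_op[OF \<rho> yL2 yL2] sums_Suc_iff[of "\<lambda>j. real (freq j) powr - \<rho> * inner_L2 y (trig_torus j) * inner_L2 y (trig_torus j)" \<sigma>]
    by (simp add: kap_def \<sigma>_def power2_eq_square mult.assoc freq_def[of 0])
  have \<sigma>pos: "\<sigma> > 0"
  proof -
    have "y \<noteq> 0" using yy L2.zero_left[of 0] in_L2_zero by auto
    then obtain j where "inner_L2 y (trig_torus j) \<noteq> 0" using L2.total[of y] yL2 by auto
    moreover have "inner_L2 y (trig_torus 0) = 0" using y0 by (simp add: inner_trig L2_0_def)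
    ultimately obtain i where i: "inner_L2 y (trig_torus (Suc i)) \<noteq> 0" by (metis not0_implies_Suc)
    have "0 < (\<Sum>j. kap j powr - \<rho> * (inner_L2 y (trig_torus (Suc j)))\<^sup>2)"
      by (rule suminf_pos2[of _ i]) (use i sums in \<open>auto simp: sums_iff\<close>)
    then show ?thesis using sums by (simp add: sums_iff)
  qed
  have sys: "gaussian_system \<rho> 1 (\<lambda>_. y)"
    using y0 yy by (simp add: gaussian_system_def L2_0_def)
  define g where "g = weyl (- r) y"
  have g: "g \<in> W2 r" "weyl r g = y" using weyl_neg_in_W2[OF r y0] by (auto simp: g_def)
  have hg: "inner_W2 r x h = c * inner_W2 r x g" for x
    unfolding inner_W2_def g(2) using c by (simp add: y_def inner_L2_commute[of "weyl r x"] inner_L2_scaleR)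
  have "distributed \<mu> lborel (\<lambda>x. inner_W2 r x g) (normal_density 0 (sqrt \<sigma>))"
    unfolding distributed_def
  proof (intro conjI)
    show m: "(\<lambda>x. inner_W2 r x g) \<in> measurable \<mu> lborel" using inner_measurable[OF g(1)] by simp
    show "distr \<mu> lborel (\<lambda>x. inner_W2 r x g) = density lborel (normal_density 0 (sqrt \<sigma>))"
    proof (rule measure_eqI)
      fix A assume "A \<in> sets (distr \<mu> lborel (\<lambda>x. inner_W2 r x g))"
      then have A: "A \<in> sets borel" by simp
      have "emeasure (distr \<mu> lborel (\<lambda>x. inner_W2 r x g)) A = emeasure \<mu> {x \<in> W2 r. inner_W2 r x g \<in> A}"
        using A m by (subst emeasure_distr) (auto simp: space_gaussian intro!: arg_cong[where f = "emeasure \<mu>"])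
      also have "\<dots> = emeasure (density lborel (normal_density 0 (sqrt \<sigma>))) A"
        using gaussian_box[OF \<mu> sys, of "\<lambda>_. A" "\<lambda>_. \<sigma>"] A \<sigma>pos by (simp add: \<sigma>_def g_def)
      finally show "emeasure (distr \<mu> lborel (\<lambda>x. inner_W2 r x g)) A = emeasure (density lborel (normal_density 0 (sqrt \<sigma>))) A" .
    qed simp
  qed simp
  from prob_space.normal_density_affine[OF prob_space_gaussian this, of c 0] c \<sigma>pos
  have "distributed \<mu> lborel (\<lambda>x. inner_W2 r x h) (normal_density 0 (c * sqrt \<sigma>))"
    by (simp add: hg)
  moreover have "c * sqrt \<sigma> = sqrt (\<Sum>j. kap j powr - \<rho> * (inner_W2 r h (sob_basis r j))\<^sup>2)"
  proof -
    have "inner_W2 r h (sob_basis r j) = c * inner_L2 y (trig_torus (Suc j))" for j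
      using c by (simp add: inner_sob_basis[OF r] y_def inner_L2_scaleR)
    then have "(\<lambda>j. kap j powr - \<rho> * (inner_W2 r h (sob_basis r j))\<^sup>2) = (\<lambda>j. c\<^sup>2 * (kap j powr - \<rho> * (inner_L2 y (trig_torus (Suc j)))\<^sup>2))"
      by (simp add: power_mult_distrib mult_ac)
    then have "(\<Sum>j. kap j powr - \<rho> * (inner_W2 r h (sob_basis r j))\<^sup>2) = c\<^sup>2 * \<sigma>"
      using sums by (simp add: suminf_mult sums_iff)
    then show ?thesis using c by (simp add: real_sqrt_mult)
  qed
  ultimately show ?thesis by simp
qed

text \<open>
  The sets in the cylindrical formula involve an initial segment of the coordinates; an arbitrary finite
  set of them is reached by putting no condition on the others.
\<close>

lemma gaussian_indep:
  "prob_space.indep_vars \<mu> (\<lambda>_. borel) (\<lambda>j x. inner_W2 r x (sob_basis r j)) UNIV"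
proof -
  interpret prob_space \<mu> by (rule prob_space_gaussian)
  let ?X = "\<lambda>j x. inner_W2 r x (sob_basis r j)"
  let ?N = "\<lambda>j. density lborel (normal_density 0 (sqrt (kap j powr - \<rho>)))"
  have N: "prob_space (?N j)" for j
    by (rule prob_space_normal_density) simp
  have N1: "emeasure (?N j) UNIV = 1" for j
    using prob_space.emeasure_space_1[OF N[of j]] by simp
  have N_eq: "emeasure (?N j) A = ennreal (measure (?N j) A)" for j A
    using prob_space.axioms(1)[OF N] by (rule finite_measure.emeasure_eq_measure)
  have pr: "prob {x \<in> W2 r. \<forall>j\<in>J. ?X j x \<in> B j} = (\<Prod>j\<in>J. measure (?N j) (B j))"
    if J: "finite J" and B: "\<And>j. j \<in> J \<Longrightarrow> B j \<in> sets borel" for J B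
  proof -
    obtain K where K: "J \<subseteq> {..<K}" using J by (meson finite_nat_iff_bounded)
    let ?A = "\<lambda>j. if j \<in> J then B j else UNIV"
    have "{x \<in> W2 r. \<forall>j\<in>J. ?X j x \<in> B j} = {x \<in> W2 r. \<forall>j<K. ?X j x \<in> ?A j}"
      using K by auto
    then have "emeasure \<mu> {x \<in> W2 r. \<forall>j\<in>J. ?X j x \<in> B j} = (\<Prod>j<K. emeasure (?N j) (?A j))"
      using gaussian_trig_box[of ?A K] B by simp
    also have "\<dots> = (\<Prod>j\<in>J. emeasure (?N j) (B j))"
      using K N1 by (intro prod.mono_neutral_cong_right) auto
    also have "\<dots> = ennreal (\<Prod>j\<in>J. measure (?N j) (B j))"
      by (subst prod_ennreal[symmetric]) (auto simp: N_eq)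
    finally show ?thesis by (simp add: measure_def prod_nonneg)
  qed
  show ?thesis
    unfolding indep_vars_def2 indep_sets_def
  proof (intro conjI ballI allI impI)
    fix J :: "nat set" and A assume J: "J \<noteq> {}" "finite J" "A \<in> (\<Pi> j\<in>J. {?X j -` B \<inter> space \<mu> | B. B \<in> sets borel})"
    then have "\<forall>j\<in>J. \<exists>B. B \<in> sets borel \<and> A j = ?X j -` B \<inter> space \<mu>" by blast
    then obtain B where B: "\<And>j. j \<in> J \<Longrightarrow> B j \<in> sets borel" "\<And>j. j \<in> J \<Longrightarrow> A j = ?X j -` B j \<inter> space \<mu>"
      by metis
    have "(\<Inter>j\<in>J. A j) = {x \<in> W2 r. \<forall>j\<in>J. ?X j x \<in> B j}"
      using J(1) B(2) by (auto simp: space_gaussian)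
    then have "prob (\<Inter>j\<in>J. A j) = (\<Prod>j\<in>J. measure (?N j) (B j))"
      using pr[OF J(2) B(1)] by simp
    also have "\<dots> = (\<Prod>j\<in>J. prob (A j))"
    proof (rule prod.cong)
      fix j assume j: "j \<in> J"
      have "A j = {x \<in> W2 r. \<forall>i\<in>{j}. ?X i x \<in> B i}" using B(2)[OF j] by (auto simp: space_gaussian)
      then show "measure (?N j) (B j) = prob (A j)" using pr[of "{j}" B] B(1)[OF j] by simp
    qed simp
    finally show "prob (\<Inter>j\<in>J. A j) = (\<Prod>j\<in>J. prob (A j))" .
  qed (auto intro!: measurable_sets[OF inner_measurable] inner_measurable)
qed

lemma gaussian_space_W2: "gaussian_space (W2 r) (inner_W2 r) (sob_basis r) \<mu> (\<lambda>j. kap j powr - \<rho>)"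
proof -
  interpret prob_space \<mu> by (rule prob_space_gaussian)
  show ?thesis
  proof
    show "kap j powr - \<rho> \<le> 1" for j
      using powr_mono[of "-\<rho>" 0 "kap j"] kap_ge_1[of j] \<rho> by simp
    show "0 < kap j powr - \<rho>" for j using kap_pos[of j] by simp
  qed (use sets_gaussian space_gaussian gaussian_law gaussian_indep in auto)
qed

end

section \<open>Gaussian tails and the joint law of many coordinates\<close>

context gaussian_space
begin

text \<open>
  The variance of \<open>\<lambda>x. ip x h\<close>, that is the value of the quadratic form of the correlation operator.
\<close>

definition var :: "'a \<Rightarrow> real" where "var h = (\<Sum>j. lam j * (ip h (e j))\<^sup>2)"

lemma var_summable: "h \<in> V \<Longrightarrow> summable (\<lambda>j. lam j * (ip h (e j))\<^sup>2)"
proof (rule summable_comparison_test'[OF coeffs_square_summable])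
  fix j show "norm (lam j * (ip h (e j))\<^sup>2) \<le> (ip h (e j))\<^sup>2"
    using lam_pos[of j] lam_le_1[of j] by (simp add: abs_mult mult_left_le_one_le)
qed

lemma var_ge:
  assumes "h \<in> V" shows "lam j * (ip h (e j))\<^sup>2 \<le> var h"
  using sum_le_suminf[OF var_summable[OF assms], of "{j}"] lam_pos by (simp add: var_def less_imp_le)

lemma var_pos:
  assumes "h \<in> V" "h \<noteq> 0" shows "0 < var h"
proof -
  obtain j where "ip h (e j) \<noteq> 0" using total assms by blast
  then have "0 < lam j * (ip h (e j))\<^sup>2" using lam_pos[of j] by simp
  then show ?thesis using var_ge[OF assms(1), of j] by linarith
qed

lemma var_le:
  assumes h: "h \<in> V" and \<tau>: "\<And>j. ip h (e j) \<noteq> 0 \<Longrightarrow> lam j \<le> t"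
  shows "var h \<le> t * ip h h"
proof -
  have s: "(\<lambda>j. (ip h (e j))\<^sup>2) sums ip h h"
    using Parseval[OF h h] by (simp add: power2_eq_square)
  have "var h \<le> (\<Sum>j. t * (ip h (e j))\<^sup>2)"
    unfolding var_def
  proof (rule suminf_le[OF _ var_summable[OF h]])
    show "summable (\<lambda>j. t * (ip h (e j))\<^sup>2)" using s by (intro summable_mult) (simp add: sums_iff)
    show "lam j * (ip h (e j))\<^sup>2 \<le> t * (ip h (e j))\<^sup>2" for j
      using \<tau>[of j] by (cases "ip h (e j) = 0") (auto intro: mult_right_mono)
  qed
  also have "\<dots> = t * ip h h" using s by (simp add: suminf_mult sums_iff)
  finally show ?thesis .
qed

lemma ip_measurable_mu [measurable]: "h \<in> V \<Longrightarrow> (\<lambda>x. ip x h) \<in> borel_measurable \<mu>"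
  using ip_measurable[of h] by (simp add: measurable_cong_sets[OF sets_mu refl])

lemma law': "h \<in> V \<Longrightarrow> h \<noteq> 0 \<Longrightarrow> distributed \<mu> lborel (\<lambda>x. ip x h) (normal_density 0 (sqrt (var h)))"
  using law[of h] by (simp add: var_def)

text \<open>
  The factor \<open>4\<close> makes the exponential remove half of the exponent of the normal density: what remains is
  at most \<open>\<surd>2\<close> times the normal density of twice the variance. Markov's inequality then gives \<open>tail_upper\<close>.
\<close>

lemma exp_moment:
  assumes h: "h \<in> V" and s: "s > 0" "var h \<le> s\<^sup>2"
  shows "(\<integral>\<^sup>+ x. ennreal (exp ((ip x h)\<^sup>2 / (4 * s\<^sup>2))) \<partial>\<mu>) \<le> ennreal (sqrt 2)"
proof (cases "h = 0")
  case True
  have "(\<integral>\<^sup>+ x. ennreal (exp ((ip x h)\<^sup>2 / (4 * s\<^sup>2))) \<partial>\<mu>) = (\<integral>\<^sup>+ x. 1 \<partial>\<mu>)"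
    by (rule nn_integral_cong) (simp add: True space_mu)
  also have "\<dots> = ennreal 1" by (simp add: emeasure_space_1)
  also have "\<dots> \<le> ennreal (sqrt 2)" by (rule ennreal_leI) simp
  finally show ?thesis .
next
  case False
  define \<sigma> where "\<sigma> = sqrt (var h)"
  have \<sigma>: "\<sigma> > 0" "\<sigma>\<^sup>2 = var h" using var_pos[OF h False] by (auto simp: \<sigma>_def)
  have le: "normal_density 0 \<sigma> t * exp (t\<^sup>2 / (4 * s\<^sup>2)) \<le> sqrt 2 * normal_density 0 (sqrt 2 * \<sigma>) t" for t
  proof -
    have "t\<^sup>2 / (4 * s\<^sup>2) \<le> t\<^sup>2 / (4 * \<sigma>\<^sup>2)"
      using \<sigma> s var_pos[OF h False] by (intro divide_left_mono) auto
    then have "normal_density 0 \<sigma> t * exp (t\<^sup>2 / (4 * s\<^sup>2)) \<le> normal_density 0 \<sigma> t * exp (t\<^sup>2 / (4 * \<sigma>\<^sup>2))"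
      by (intro mult_left_mono) auto
    also have "\<dots> = (1 / sqrt (2 * pi * \<sigma>\<^sup>2)) * (exp (- (t\<^sup>2 / (2 * \<sigma>\<^sup>2))) * exp (t\<^sup>2 / (4 * \<sigma>\<^sup>2)))"
      by (simp add: normal_density_def)
    also have "exp (- (t\<^sup>2 / (2 * \<sigma>\<^sup>2))) * exp (t\<^sup>2 / (4 * \<sigma>\<^sup>2)) = exp (- (t\<^sup>2 / (4 * \<sigma>\<^sup>2)))"
      using \<sigma>(1) by (simp add: field_simps flip: exp_add)
    also have "1 / sqrt (2 * pi * \<sigma>\<^sup>2) = sqrt 2 * (1 / sqrt (2 * pi * (sqrt 2 * \<sigma>)\<^sup>2))"
    proof -
      have "2 * pi * (sqrt 2 * \<sigma>)\<^sup>2 = 2 * (2 * pi * \<sigma>\<^sup>2)" by (simp add: power_mult_distrib)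
      then have "sqrt (2 * pi * (sqrt 2 * \<sigma>)\<^sup>2) = sqrt 2 * sqrt (2 * pi * \<sigma>\<^sup>2)"
        by (simp only: real_sqrt_mult)
      then show ?thesis by simp
    qed
    also have "\<dots> * exp (- (t\<^sup>2 / (4 * \<sigma>\<^sup>2))) = sqrt 2 * normal_density 0 (sqrt 2 * \<sigma>) t"
      by (simp add: normal_density_def power_mult_distrib)
    finally show ?thesis .
  qed
  have "(\<integral>\<^sup>+ x. ennreal (exp ((ip x h)\<^sup>2 / (4 * s\<^sup>2))) \<partial>\<mu>)
    = (\<integral>\<^sup>+ t. ennreal (normal_density 0 \<sigma> t) * ennreal (exp (t\<^sup>2 / (4 * s\<^sup>2))) \<partial>lborel)"
    unfolding \<sigma>_def by (rule distributed_nn_integral[OF law'[OF h False], symmetric]) simp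
  also have "\<dots> \<le> (\<integral>\<^sup>+ t. ennreal (sqrt 2) * ennreal (normal_density 0 (sqrt 2 * \<sigma>) t) \<partial>lborel)"
    using le by (intro nn_integral_mono) (simp add: ennreal_leI flip: ennreal_mult)
  also have "\<dots> = ennreal (sqrt 2) * (\<integral>\<^sup>+ t. ennreal (normal_density 0 (sqrt 2 * \<sigma>) t) \<partial>lborel)"
    by (intro nn_integral_cmult) simp
  also have "(\<integral>\<^sup>+ t. ennreal (normal_density 0 (sqrt 2 * \<sigma>) t) \<partial>lborel) = 1"
    using prob_space.emeasure_space_1[OF prob_space_normal_density[of "sqrt 2 * \<sigma>" 0]] \<sigma>(1)
    by (simp add: emeasure_density)
  finally show ?thesis by simp
qed

text \<open>
  Integrate the density over an interval of length \<open>\<sigma>\<close> to the right of \<open>z\<close>, where it is at least its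
  value at \<open>z + \<sigma>\<close>, and estimate \<open>(z + \<sigma>)\<^sup>2 \<le> 2 z\<^sup>2 + 2 \<sigma>\<^sup>2\<close>. The constant comes from
  \<open>exp 1 * sqrt (2 * pi) \<le> 9\<close>.
\<close>

lemma tail_lower:
  assumes h: "h \<in> V" "h \<noteq> 0" and z: "z \<ge> 0"
  shows "exp (- (z\<^sup>2 / var h)) / 9 \<le> prob {x \<in> V. z < ip x h}"
proof -
  define \<sigma> where "\<sigma> = sqrt (var h)"
  have \<sigma>: "\<sigma> > 0" "\<sigma>\<^sup>2 = var h" using var_pos[OF h] by (auto simp: \<sigma>_def)
  define c where "c = normal_density 0 \<sigma> (z + \<sigma>)"
  have c0: "c \<ge> 0" by (simp add: c_def)
  have low: "ennreal (c * \<sigma>) \<le> emeasure \<mu> {x \<in> V. z < ip x h}"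
  proof -
    have "ennreal (c * \<sigma>) = (\<integral>\<^sup>+ t. ennreal c * indicator {z<..z + \<sigma>} t \<partial>lborel)"
      using \<sigma> c0 by (simp add: nn_integral_cmult ennreal_mult)
    also have "\<dots> \<le> (\<integral>\<^sup>+ t. ennreal (normal_density 0 \<sigma> t) * indicator {z<..} t \<partial>lborel)"
    proof (rule nn_integral_mono)
      fix t
      have "c \<le> normal_density 0 \<sigma> t" if "z < t" "t \<le> z + \<sigma>"
      proof -
        have "t\<^sup>2 \<le> (z + \<sigma>)\<^sup>2" using that z by (intro power_mono) auto
        then show ?thesis unfolding c_def normal_density_def
          by (intro mult_left_mono) (auto intro: divide_right_mono)
      qed
      then show "ennreal c * indicator {z<..z + \<sigma>} t \<le> ennreal (normal_density 0 \<sigma> t) * indicator {z<..} t"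
        by (auto simp: indicator_def ennreal_leI)
    qed
    also have "\<dots> = (\<integral>\<^sup>+ x. indicator {z<..} (ip x h) \<partial>\<mu>)"
      unfolding \<sigma>_def by (rule distributed_nn_integral[OF law'[OF h]]) simp
    also have "\<dots> = (\<integral>\<^sup>+ x. indicator {x \<in> V. z < ip x h} x \<partial>\<mu>)"
      by (rule nn_integral_cong) (auto simp: indicator_def space_mu)
    also have "\<dots> = emeasure \<mu> {x \<in> V. z < ip x h}"
    proof (rule nn_integral_indicator)
      have "{x \<in> space \<mu>. z < ip x h} \<in> sets \<mu>" using h(1) by measurable
      then show "{x \<in> V. z < ip x h} \<in> sets \<mu>" by (simp add: space_mu)
    qed
    finally show ?thesis .
  qed
  then have "c * \<sigma> \<le> prob {x \<in> V. z < ip x h}"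
    by (simp add: emeasure_eq_measure)
  moreover have "exp (- (z\<^sup>2 / var h)) / 9 \<le> c * \<sigma>"
  proof -
    have e: "(z + \<sigma>)\<^sup>2 / (2 * \<sigma>\<^sup>2) \<le> z\<^sup>2 / \<sigma>\<^sup>2 + 1"
    proof -
      have "0 \<le> (z - \<sigma>)\<^sup>2" by simp
      then have "(z + \<sigma>)\<^sup>2 \<le> 2 * (z\<^sup>2 + \<sigma>\<^sup>2)" by (simp add: power2_eq_square algebra_simps)
      then have "(z + \<sigma>)\<^sup>2 / (2 * \<sigma>\<^sup>2) \<le> 2 * (z\<^sup>2 + \<sigma>\<^sup>2) / (2 * \<sigma>\<^sup>2)" by (rule divide_right_mono) simp
      also have "\<dots> = z\<^sup>2 / \<sigma>\<^sup>2 + 1" using \<sigma>(1) by (simp add: add_divide_distrib)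
      finally show ?thesis .
    qed
    have "exp 1 * sqrt (2 * pi) \<le> 3 * (3::real)"
    proof (rule mult_mono)
      show "sqrt (2 * pi) \<le> 3" using pi_less_4 by (intro real_le_lsqrt) auto
    qed (use exp_le in auto)
    then have "exp (- (z\<^sup>2 / \<sigma>\<^sup>2)) / 9 \<le> exp (- (z\<^sup>2 / \<sigma>\<^sup>2)) / (exp 1 * sqrt (2 * pi))"
      by (intro divide_left_mono) auto
    also have "\<dots> = exp (- (z\<^sup>2 / \<sigma>\<^sup>2 + 1)) / sqrt (2 * pi)"
      by (simp add: exp_diff exp_minus field_simps exp_add)
    also have "\<dots> \<le> exp (- ((z + \<sigma>)\<^sup>2 / (2 * \<sigma>\<^sup>2))) / sqrt (2 * pi)"
      using e by (intro divide_right_mono) auto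
    also have "\<dots> = c * \<sigma>"
      using \<sigma>(1) by (simp add: c_def normal_density_def real_sqrt_mult)
    finally show ?thesis using \<sigma>(2) by simp
  qed
  ultimately show ?thesis by linarith
qed

lemma var_basis: "var (e i) = lam i"
proof -
  have "(\<lambda>j. lam j * (ip (e i) (e j))\<^sup>2) = (\<lambda>j. if j = i then lam i else 0)"
    by (auto simp: e_orth)
  then show ?thesis using sums_single[of i "\<lambda>_. lam i"] by (simp add: var_def sums_iff)
qed

lemma basis_neq_0: "e i \<noteq> 0"
  using e_orth[of i i] by force

text \<open>
  A shift cannot help both tails: for \<open>c \<ge> 0\<close> the values \<open>u > 2 * T\<close> violate the condition, for \<open>c < 0\<close> the
  values \<open>u < - 2 * T\<close>. So the bound is uniform in the shift.
\<close>

lemma affine_coordinate_bound: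
  assumes a: "a \<ge> 1 / 2" and T: "T \<ge> 0"
  shows "emeasure (distr \<mu> borel (\<lambda>x. ip x (e i))) {u. \<bar>a * u + c\<bar> \<le> T}
    \<le> ennreal (1 - exp (- ((2 * T)\<^sup>2 / lam i)) / 9)"
proof -
  have B: "{u::real. \<bar>a * u + c\<bar> \<le> T} \<in> sets borel" by measurable
  define A where "A = {x \<in> V. \<bar>a * ip x (e i) + c\<bar> \<le> T}"
  have "A = (\<lambda>x. ip x (e i)) -` {u. \<bar>a * u + c\<bar> \<le> T} \<inter> space \<mu>" by (auto simp: A_def space_mu)
  then have E: "emeasure (distr \<mu> borel (\<lambda>x. ip x (e i))) {u. \<bar>a * u + c\<bar> \<le> T} = emeasure \<mu> A"
    and Am: "A \<in> sets \<mu>"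
    using B by (auto simp: emeasure_distr measurable_sets)
  have key: "prob A \<le> 1 - exp (- ((2 * T)\<^sup>2 / lam i)) / 9"
    if h: "h \<in> V" "h \<noteq> 0" "var h = lam i" and sub: "\<And>x. x \<in> V \<Longrightarrow> 2 * T < ip x h \<Longrightarrow> x \<notin> A" for h
  proof -
    have "exp (- ((2 * T)\<^sup>2 / lam i)) / 9 \<le> prob {x \<in> V. 2 * T < ip x h}"
      using tail_lower[OF h(1,2), of "2 * T"] T h(3) by simp
    also have "\<dots> \<le> prob (space \<mu> - A)"
      using sub by (intro finite_measure_mono[OF _ sets.compl_sets[OF Am]]) (auto simp: space_mu)
    also have "\<dots> = 1 - prob A" using Am by (rule prob_compl)
    finally show ?thesis by simp
  qed
  have "prob A \<le> 1 - exp (- ((2 * T)\<^sup>2 / lam i)) / 9"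
  proof (cases "c \<ge> 0")
    case True
    show ?thesis
    proof (rule key[of "e i"])
      fix x assume "2 * T < ip x (e i)"
      then have "T < (1 / 2) * ip x (e i)" "0 \<le> ip x (e i)" using T by auto
      moreover have "(1 / 2) * ip x (e i) \<le> a * ip x (e i)" using a calculation by (intro mult_right_mono) auto
      ultimately show "x \<notin> A" using True by (auto simp: A_def)
    qed (auto simp: var_basis basis_neq_0)
  next
    case False
    have m: "ip x (- e i) = - ip x (e i)" if "x \<in> V" for x
      using that by (simp add: commute[of x] minus_left)
    have "var (- e i) = var (e i)" by (simp add: var_def minus_left)
    then show ?thesis
    proof (intro key[of "- e i"])
      fix x assume x: "x \<in> V" "2 * T < ip x (- e i)"
      then have "T < (1 / 2) * (- ip x (e i))" "0 \<le> - ip x (e i)" using T m by auto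
      moreover have "(1 / 2) * (- ip x (e i)) \<le> a * (- ip x (e i))" using a calculation by (intro mult_right_mono) auto
      ultimately show "x \<notin> A" using False by (auto simp: A_def)
    qed (auto simp: var_basis basis_neq_0)
  qed
  then show ?thesis unfolding E by (simp add: emeasure_eq_measure ennreal_leI)
qed

text \<open>
  Subtracting the interaction with the other members of \<open>S\<close> leaves the own coordinate of \<open>i\<close>, times a
  factor of at least \<open>1/2\<close>, plus a function \<open>C\<close> of the coordinates outside \<open>S\<close>. For fixed outer coordinates
  the conditions are independent and each is an instance of \<open>affine_coordinate_bound\<close>, whose bound does
  not depend on the shift \<open>C\<close>; Fubini's theorem integrates over the outer coordinates.
\<close>

lemma conditional_bound:
  assumes S: "finite S" "S \<noteq> {}" and v: "\<And>i. i \<in> S \<Longrightarrow> v i \<in> V"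
    and diag: "\<And>i. i \<in> S \<Longrightarrow> ip (v i) (e i) \<ge> 1 / 2" and T: "T \<ge> 0"
  shows "{x \<in> V. \<forall>i\<in>S. \<bar>ip x (v i) - (\<Sum>j\<in>S - {i}. ip x (e j) * ip (v i) (e j))\<bar> \<le> T} \<in> sets \<mu>"
    and "prob {x \<in> V. \<forall>i\<in>S. \<bar>ip x (v i) - (\<Sum>j\<in>S - {i}. ip x (e j) * ip (v i) (e j))\<bar> \<le> T}
      \<le> (\<Prod>i\<in>S. 1 - exp (- ((2 * T)\<^sup>2 / lam i)) / 9)"
proof -
  define E where "E = {x \<in> V. \<forall>i\<in>S. \<bar>ip x (v i) - (\<Sum>j\<in>S - {i}. ip x (e j) * ip (v i) (e j))\<bar> \<le> T}"
  let ?X = "\<lambda>j x. ip x (e j)"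
  let ?M1 = "PiM S (\<lambda>_. borel :: real measure)" and ?M2 = "PiM (- S) (\<lambda>_. borel :: real measure)"
  let ?U = "\<lambda>x. restrict (\<lambda>j. ?X j x) S" and ?Z = "\<lambda>x. restrict (\<lambda>j. ?X j x) (- S)"
  define C where "C i z = (\<Sum>j. if j \<in> S then 0 else z j * ip (v i) (e j))" for i and z :: "nat \<Rightarrow> real"
  have C_meas [measurable]: "C i \<in> borel_measurable ?M2" for i
    unfolding C_def
  proof (rule borel_measurable_suminf)
    fix j show "(\<lambda>z. if j \<in> S then 0 else z j * ip (v i) (e j)) \<in> borel_measurable ?M2"
      by (cases "j \<in> S") auto
  qed
  have split: "ip x (v i) - (\<Sum>j\<in>S - {i}. ip x (e j) * ip (v i) (e j)) = ip (v i) (e i) * ?X i x + C i (?Z x)"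
    if "i \<in> S" "x \<in> V" for i x
  proof -
    let ?f = "\<lambda>j. ip x (e j) * ip (v i) (e j)"
    have 1: "?f sums ip x (v i)" using Parseval that v by blast
    have 2: "(\<lambda>j. if j \<in> S then ?f j else 0) sums (\<Sum>j\<in>S. ?f j)"
      by (rule sums_If_finite_set[OF S(1)])
    have "(\<lambda>j. ?f j - (if j \<in> S then ?f j else 0)) sums (ip x (v i) - (\<Sum>j\<in>S. ?f j))"
      by (rule sums_diff[OF 1 2])
    moreover have "(\<lambda>j. ?f j - (if j \<in> S then ?f j else 0)) = (\<lambda>j. if j \<in> S then 0 else ?Z x j * ip (v i) (e j))"
      by auto
    ultimately have "C i (?Z x) = ip x (v i) - (\<Sum>j\<in>S. ?f j)" by (simp add: C_def sums_iff)
    moreover have "(\<Sum>j\<in>S. ?f j) = ?f i + (\<Sum>j\<in>S - {i}. ?f j)" using S that by (simp add: sum.remove)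
    ultimately show ?thesis by (simp add: mult.commute)
  qed
  define G where "G = {p \<in> space (?M1 \<Otimes>\<^sub>M ?M2). \<forall>i\<in>S. \<bar>ip (v i) (e i) * fst p i + C i (snd p)\<bar> \<le> T}"
  have G: "G \<in> sets (?M1 \<Otimes>\<^sub>M ?M2)"
    unfolding G_def using S(1) by measurable
  have rv: "random_variable borel (?X j)" for j by measurable
  have U: "?U \<in> measurable \<mu> ?M1" and Z: "?Z \<in> measurable \<mu> ?M2"
    by (rule measurable_restrict, rule rv)+
  have EG: "E = (\<lambda>x. (?U x, ?Z x)) -` G \<inter> space \<mu>"
    unfolding E_def G_def using split measurable_space[OF U] measurable_space[OF Z]
    by (auto simp: space_pair_measure space_mu)
  have UZ: "(\<lambda>x. (?U x, ?Z x)) \<in> measurable \<mu> (?M1 \<Otimes>\<^sub>M ?M2)" using U Z by (rule measurable_Pair)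
  have Em: "E \<in> sets \<mu>" unfolding EG by (rule measurable_sets[OF UZ G])
  have ind: "indep_var ?M1 ?U ?M2 ?Z"
    by (rule indep_var_restrict[OF indep]) auto
  interpret P1: prob_space "distr \<mu> ?M1 ?U" by (rule prob_space_distr[OF U])
  interpret P2: prob_space "distr \<mu> ?M2 ?Z" by (rule prob_space_distr[OF Z])
  interpret P12: pair_sigma_finite "distr \<mu> ?M1 ?U" "distr \<mu> ?M2 ?Z" ..
  interpret N: product_prob_space "\<lambda>i. distr \<mu> borel (?X i)" S
    by (intro product_prob_spaceI prob_space_distr rv)
  have "indep_vars (\<lambda>_. borel) ?X S" by (rule indep_vars_subset[OF indep]) simp
  then have dU: "distr \<mu> ?M1 ?U = PiM S (\<lambda>i. distr \<mu> borel (?X i))"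
    using indep_vars_iff_distr_eq_PiM[OF S(2), where M' = "\<lambda>_. borel" and X = ?X, OF rv] by simp
  have slice: "emeasure (distr \<mu> ?M1 ?U) ((\<lambda>u. (u, z)) -` G) \<le> ennreal (\<Prod>i\<in>S. 1 - exp (- ((2 * T)\<^sup>2 / lam i)) / 9)"
    if z: "z \<in> space ?M2" for z
  proof -
    let ?B = "\<lambda>i. {u. \<bar>ip (v i) (e i) * u + C i z\<bar> \<le> T}"
    have "(\<lambda>u. (u, z)) -` G = PiE S ?B"
      using z by (auto simp: G_def space_pair_measure space_PiM PiE_iff extensional_def)
    then have "emeasure (distr \<mu> ?M1 ?U) ((\<lambda>u. (u, z)) -` G) = emeasure (PiM S (\<lambda>i. distr \<mu> borel (?X i))) (PiE S ?B)"
      by (simp add: dU)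
    also have "\<dots> = (\<Prod>i\<in>S. emeasure (distr \<mu> borel (?X i)) (?B i))"
      by (rule N.emeasure_PiM[OF S(1)]) measurable
    also have "\<dots> \<le> (\<Prod>i\<in>S. ennreal (1 - exp (- ((2 * T)\<^sup>2 / lam i)) / 9))"
      by (intro prod_mono_ennreal affine_coordinate_bound diag T)
    also have "\<dots> = ennreal (\<Prod>i\<in>S. 1 - exp (- ((2 * T)\<^sup>2 / lam i)) / 9)"
    proof (rule prod_ennreal)
      fix i
      have "exp (- ((2 * T)\<^sup>2 / lam i)) \<le> 1" using lam_pos[of i] by simp
      then show "0 \<le> 1 - exp (- ((2 * T)\<^sup>2 / lam i)) / 9" by linarith
    qed
    finally show ?thesis .
  qed
  have "emeasure \<mu> E = emeasure (distr \<mu> (?M1 \<Otimes>\<^sub>M ?M2) (\<lambda>x. (?U x, ?Z x))) G"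
    unfolding EG using UZ G by (simp add: emeasure_distr)
  also have "distr \<mu> (?M1 \<Otimes>\<^sub>M ?M2) (\<lambda>x. (?U x, ?Z x)) = distr \<mu> ?M1 ?U \<Otimes>\<^sub>M distr \<mu> ?M2 ?Z"
    using ind by (simp add: indep_var_distribution_eq)
  also have "emeasure (distr \<mu> ?M1 ?U \<Otimes>\<^sub>M distr \<mu> ?M2 ?Z) G
      = (\<integral>\<^sup>+ z. emeasure (distr \<mu> ?M1 ?U) ((\<lambda>u. (u, z)) -` G) \<partial>distr \<mu> ?M2 ?Z)"
    by (rule P12.emeasure_pair_measure_alt2) (use G in \<open>simp cong: sets_pair_measure_cong\<close>)
  also have "\<dots> \<le> (\<integral>\<^sup>+ z. ennreal (\<Prod>i\<in>S. 1 - exp (- ((2 * T)\<^sup>2 / lam i)) / 9) \<partial>distr \<mu> ?M2 ?Z)"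
    by (intro nn_integral_mono slice) simp
  also have "\<dots> = ennreal (\<Prod>i\<in>S. 1 - exp (- ((2 * T)\<^sup>2 / lam i)) / 9)"
    using P2.emeasure_space_1 by simp
  finally have "emeasure \<mu> E \<le> ennreal (\<Prod>i\<in>S. 1 - exp (- ((2 * T)\<^sup>2 / lam i)) / 9)" .
  moreover have "0 \<le> (\<Prod>i\<in>S. 1 - exp (- ((2 * T)\<^sup>2 / lam i)) / 9)"
  proof (rule prod_nonneg)
    fix i
    have "exp (- ((2 * T)\<^sup>2 / lam i)) \<le> 1" using lam_pos[of i] by simp
    then show "0 \<le> 1 - exp (- ((2 * T)\<^sup>2 / lam i)) / 9" by linarith
  qed
  ultimately show "{x \<in> V. \<forall>i\<in>S. \<bar>ip x (v i) - (\<Sum>j\<in>S - {i}. ip x (e j) * ip (v i) (e j))\<bar> \<le> T} \<in> sets \<mu>"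
    and "prob {x \<in> V. \<forall>i\<in>S. \<bar>ip x (v i) - (\<Sum>j\<in>S - {i}. ip x (e j) * ip (v i) (e j))\<bar> \<le> T}
      \<le> (\<Prod>i\<in>S. 1 - exp (- ((2 * T)\<^sup>2 / lam i)) / 9)"
    using Em unfolding E_def[symmetric] by (simp_all add: emeasure_eq_measure)
qed

lemma tail_upper:
  assumes h: "h \<in> V" and s: "s > 0" "var h \<le> s\<^sup>2" and R: "R \<ge> 0"
  shows "emeasure \<mu> {x \<in> V. R < \<bar>ip x h\<bar>} \<le> ennreal (sqrt 2 * exp (- (R\<^sup>2 / (4 * s\<^sup>2))))"
proof -
  let ?f = "\<lambda>x. ennreal (exp ((ip x h)\<^sup>2 / (4 * s\<^sup>2)))"
  have m: "?f \<in> borel_measurable \<mu>" using h by measurable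
  have "{x \<in> space \<mu>. R < \<bar>ip x h\<bar>} \<in> sets \<mu>" using h by measurable
  then have E: "{x \<in> V. R < \<bar>ip x h\<bar>} \<in> sets \<mu>" by (simp add: space_mu)
  have "emeasure \<mu> {x \<in> V. R < \<bar>ip x h\<bar>} = (\<integral>\<^sup>+ x. indicator {x \<in> V. R < \<bar>ip x h\<bar>} x \<partial>\<mu>)"
    using E by simp
  also have "\<dots> \<le> (\<integral>\<^sup>+ x. ennreal (exp (- (R\<^sup>2 / (4 * s\<^sup>2)))) * ?f x \<partial>\<mu>)"
  proof (rule nn_integral_mono)
    fix x
    have "1 \<le> exp (- (R\<^sup>2 / (4 * s\<^sup>2))) * exp ((ip x h)\<^sup>2 / (4 * s\<^sup>2))" if "R < \<bar>ip x h\<bar>"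
    proof -
      have "R\<^sup>2 \<le> (ip x h)\<^sup>2" using that R power_mono[of R "\<bar>ip x h\<bar>" 2] by simp
      then have "R\<^sup>2 / (4 * s\<^sup>2) \<le> (ip x h)\<^sup>2 / (4 * s\<^sup>2)" by (rule divide_right_mono) simp
      then show ?thesis by (simp flip: exp_add)
    qed
    then show "indicator {x \<in> V. R < \<bar>ip x h\<bar>} x \<le> ennreal (exp (- (R\<^sup>2 / (4 * s\<^sup>2)))) * ?f x"
      by (auto simp: indicator_def simp flip: ennreal_mult intro: ennreal_leI[of 1, simplified])
  qed
  also have "\<dots> = ennreal (exp (- (R\<^sup>2 / (4 * s\<^sup>2)))) * (\<integral>\<^sup>+ x. ?f x \<partial>\<mu>)"
    by (rule nn_integral_cmult[OF m])
  also have "\<dots> \<le> ennreal (exp (- (R\<^sup>2 / (4 * s\<^sup>2)))) * ennreal (sqrt 2)"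
    by (intro mult_left_mono exp_moment h s) simp
  finally show ?thesis by (simp add: mult.commute flip: ennreal_mult)
qed

text \<open>
  The interaction subtracted in \<open>conditional_bound\<close> is at most \<open>b\<close>, unless one of the coordinates in \<open>S\<close>
  exceeds \<open>card S * b\<close>: it has fewer than \<open>card S\<close> terms with factors of at most \<open>1 / (card S)\<^sup>2\<close>. The first
  summand of the bound comes from this exceptional event.
\<close>

lemma joint_bound:
  assumes S: "finite S" "S \<noteq> {}" and v: "\<And>i. i \<in> S \<Longrightarrow> v i \<in> V"
    and diag: "\<And>i. i \<in> S \<Longrightarrow> ip (v i) (e i) \<ge> 1 / 2"
    and off: "\<And>i j. i \<in> S \<Longrightarrow> j \<in> S \<Longrightarrow> i \<noteq> j \<Longrightarrow> \<bar>ip (v i) (e j)\<bar> \<le> 1 / (real (card S))\<^sup>2"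
    and lo: "\<And>i. i \<in> S \<Longrightarrow> a\<^sup>2 \<le> lam i" and hi: "\<And>i. i \<in> S \<Longrightarrow> lam i \<le> b\<^sup>2"
    and ab: "0 < a" "0 < b" and T: "T \<ge> 0"
  shows "prob {x \<in> V. \<forall>i\<in>S. \<bar>ip x (v i)\<bar> \<le> T}
    \<le> real (card S) * (sqrt 2 * exp (- ((real (card S))\<^sup>2 / 4)))
      + (1 - exp (- ((2 * (T + b)) / a)\<^sup>2) / 9) ^ card S"
proof -
  let ?s = "real (card S)"
  have s1: "?s \<ge> 1" using S by (simp add: Suc_leI card_gt_0_iff)
  define R where "R = ?s * b"
  define A where "A j = {x \<in> V. R < \<bar>ip x (e j)\<bar>}" for j
  define E where "E = {x \<in> V. \<forall>i\<in>S. \<bar>ip x (v i) - (\<Sum>j\<in>S - {i}. ip x (e j) * ip (v i) (e j))\<bar> \<le> T + b}"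
  have Am: "A j \<in> sets \<mu>" for j
  proof -
    have "{x \<in> space \<mu>. R < \<bar>ip x (e j)\<bar>} \<in> sets \<mu>" by measurable
    then show ?thesis by (simp add: A_def space_mu)
  qed
  have Em: "E \<in> sets \<mu>" unfolding E_def
    by (rule conditional_bound(1)) (use S v diag T ab in auto)
  have sub: "{x \<in> V. \<forall>i\<in>S. \<bar>ip x (v i)\<bar> \<le> T} \<subseteq> (\<Union>j\<in>S. A j) \<union> E"
  proof
    fix x assume x: "x \<in> {x \<in> V. \<forall>i\<in>S. \<bar>ip x (v i)\<bar> \<le> T}"
    show "x \<in> (\<Union>j\<in>S. A j) \<union> E"
    proof (cases "\<exists>j\<in>S. x \<in> A j")
      case False
      then have R: "\<bar>ip x (e j)\<bar> \<le> R" if "j \<in> S" for j using that x by (force simp: A_def)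
      have "\<bar>ip x (v i) - (\<Sum>j\<in>S - {i}. ip x (e j) * ip (v i) (e j))\<bar> \<le> T + b" if i: "i \<in> S" for i
      proof -
        have "\<bar>\<Sum>j\<in>S - {i}. ip x (e j) * ip (v i) (e j)\<bar> \<le> (\<Sum>j\<in>S - {i}. R * (1 / ?s\<^sup>2))"
        proof (rule order_trans[OF sum_abs sum_mono])
          fix j assume j: "j \<in> S - {i}"
          have "\<bar>ip x (e j)\<bar> * \<bar>ip (v i) (e j)\<bar> \<le> R * (1 / ?s\<^sup>2)"
            using j i by (intro mult_mono R off) (auto simp: R_def ab less_imp_le)
          then show "\<bar>ip x (e j) * ip (v i) (e j)\<bar> \<le> R * (1 / ?s\<^sup>2)" by (simp add: abs_mult)
        qed
        also have "\<dots> \<le> (\<Sum>j\<in>S. R * (1 / ?s\<^sup>2))"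
          using S ab by (intro sum_mono2) (auto simp: R_def)
        also have "\<dots> = b" using s1 by (simp add: R_def power2_eq_square)
        finally have "\<bar>\<Sum>j\<in>S - {i}. ip x (e j) * ip (v i) (e j)\<bar> \<le> b" .
        moreover have "\<bar>ip x (v i)\<bar> \<le> T" using x i by simp
        ultimately show ?thesis by linarith
      qed
      then show ?thesis using x by (auto simp: E_def)
    qed auto
  qed
  have "prob {x \<in> V. \<forall>i\<in>S. \<bar>ip x (v i)\<bar> \<le> T} \<le> prob ((\<Union>j\<in>S. A j) \<union> E)"
    using S Am Em sub by (intro finite_measure_mono) auto
  also have "\<dots> \<le> prob (\<Union>j\<in>S. A j) + prob E"
    using S Am Em by (intro measure_Un_le) auto
  also have "prob (\<Union>j\<in>S. A j) \<le> (\<Sum>j\<in>S. prob (A j))"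
    using S Am by (intro finite_measure_subadditive_finite) auto
  also have "(\<Sum>j\<in>S. prob (A j)) \<le> (\<Sum>j\<in>S. sqrt 2 * exp (- (?s\<^sup>2 / 4)))"
  proof (rule sum_mono)
    fix j assume j: "j \<in> S"
    have "emeasure \<mu> (A j) \<le> ennreal (sqrt 2 * exp (- (R\<^sup>2 / (4 * b\<^sup>2))))"
      unfolding A_def by (rule tail_upper) (use hi[OF j] ab in \<open>auto simp: var_basis R_def\<close>)
    also have "R\<^sup>2 / (4 * b\<^sup>2) = ?s\<^sup>2 / 4" using ab by (simp add: R_def power_mult_distrib)
    finally show "prob (A j) \<le> sqrt 2 * exp (- (?s\<^sup>2 / 4))" by (simp add: emeasure_eq_measure)
  qed
  also have "\<dots> = ?s * (sqrt 2 * exp (- (?s\<^sup>2 / 4)))" by simp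
  also have "prob E \<le> (\<Prod>i\<in>S. 1 - exp (- ((2 * (T + b))\<^sup>2 / lam i)) / 9)"
    unfolding E_def by (rule conditional_bound(2)) (use S v diag T ab in auto)
  also have "\<dots> \<le> (\<Prod>i\<in>S. 1 - exp (- ((2 * (T + b)) / a)\<^sup>2) / 9)"
  proof (rule prod_mono)
    fix i assume i: "i \<in> S"
    have "(2 * (T + b))\<^sup>2 / lam i \<le> (2 * (T + b))\<^sup>2 / a\<^sup>2"
      using lo[OF i] ab lam_pos[of i] by (intro divide_left_mono) auto
    then have "exp (- ((2 * (T + b)) / a)\<^sup>2) \<le> exp (- ((2 * (T + b))\<^sup>2 / lam i))"
      by (simp add: power_divide)
    moreover have "exp (- ((2 * (T + b))\<^sup>2 / lam i)) \<le> 1" using lam_pos[of i] by simp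
    ultimately show "0 \<le> 1 - exp (- ((2 * (T + b))\<^sup>2 / lam i)) / 9 \<and>
        1 - exp (- ((2 * (T + b))\<^sup>2 / lam i)) / 9 \<le> 1 - exp (- ((2 * (T + b)) / a)\<^sup>2) / 9"
      by linarith
  qed
  also have "\<dots> = (1 - exp (- ((2 * (T + b)) / a)\<^sup>2) / 9) ^ card S" by simp
  finally show ?thesis by simp
qed

end

section \<open>Subspaces of finite codimension\<close>

text \<open>
  The greedy algorithm: a vertex is chosen and removed together with its at most \<open>D\<close> neighbours.
\<close>

lemma sparse_independent_set:
  fixes W :: "'i set"
  assumes "finite W" and sym: "\<And>i j. R i j \<Longrightarrow> R j i"
    and deg: "\<And>i. i \<in> W \<Longrightarrow> card {j \<in> W. R i j} \<le> D"
    and "s * (D + 1) \<le> card W"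
  shows "\<exists>S\<subseteq>W. card S = s \<and> (\<forall>i\<in>S. \<forall>j\<in>S. i \<noteq> j \<longrightarrow> \<not> R i j)"
  using assms
proof (induction s arbitrary: W)
  case 0
  show ?case by (rule exI[of _ "{}"]) simp
next
  case (Suc s)
  then have "W \<noteq> {}" by auto
  then obtain i where i: "i \<in> W" by blast
  define W1 where "W1 = W - insert i {j \<in> W. R i j}"
  have fK: "finite {j \<in> W. R i j}" using Suc.prems(1) by simp
  have "card (insert i {j \<in> W. R i j}) \<le> Suc (card {j \<in> W. R i j})"
    using fK by (simp add: card_insert_if)
  also have "\<dots> \<le> Suc D" using Suc.prems(3)[OF i] by simp
  finally have "card (insert i {j \<in> W. R i j}) \<le> Suc D" .
  moreover have "card W1 = card W - card (insert i {j \<in> W. R i j})"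
    unfolding W1_def using fK i by (intro card_Diff_subset) auto
  ultimately have "s * (D + 1) \<le> card W1"
    using Suc.prems(4) by simp
  moreover have "card {j \<in> W1. R k j} \<le> D" if "k \<in> W1" for k
  proof -
    have "card {j \<in> W1. R k j} \<le> card {j \<in> W. R k j}"
      using Suc.prems(1) by (intro card_mono) (auto simp: W1_def)
    then show ?thesis using Suc.prems(3)[of k] that by (simp add: W1_def)
  qed
  ultimately obtain S where S: "S \<subseteq> W1" "card S = s" "\<forall>i\<in>S. \<forall>j\<in>S. i \<noteq> j \<longrightarrow> \<not> R i j"
    using Suc.IH[of W1] Suc.prems(1,2) by (auto simp: W1_def)
  have fin: "finite S" using S(1) Suc.prems(1) by (auto simp: W1_def intro: finite_subset)
  have iS: "i \<notin> S" "\<And>j. j \<in> S \<Longrightarrow> \<not> R i j" using S(1) by (auto simp: W1_def)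
  show ?case
  proof (intro exI[of _ "insert i S"] conjI)
    show "insert i S \<subseteq> W" using S(1) i by (auto simp: W1_def)
    show "card (insert i S) = Suc s" using fin iS S(2) by simp
    show "\<forall>k\<in>insert i S. \<forall>j\<in>insert i S. k \<noteq> j \<longrightarrow> \<not> R k j"
      using S(3) iS(2) Suc.prems(2) by blast
  qed
qed

text \<open>
  Codimension at most \<open>n\<close>, expressed by linear dependence: any \<open>n + 1\<close> vectors are dependent modulo \<open>M\<close>.
  No complement of \<open>M\<close> in \<open>V\<close> has to be named, so the property passes from a subspace of the whole space
  to its intersection with \<open>V\<close>.
\<close>

definition (in hilbert) codim_le :: "nat \<Rightarrow> 'a set \<Rightarrow> bool" where
  "codim_le n M \<longleftrightarrow> (\<forall>u. (\<forall>i\<le>n. u i \<in> V) \<longrightarrow> (\<exists>c. (\<exists>i\<le>n. c i \<noteq> 0) \<and> (\<Sum>i\<le>n. c i *\<^sub>R u i) \<in> M))"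

context hilbert
begin

definition orthonormal_perp :: "'a set \<Rightarrow> nat \<Rightarrow> (nat \<Rightarrow> 'a) \<Rightarrow> bool" where
  "orthonormal_perp M d f \<longleftrightarrow> (\<forall>l<d. f l \<in> V \<and> (\<forall>z\<in>M. ip (f l) z = 0)) \<and>
     (\<forall>l<d. \<forall>k<d. ip (f l) (f k) = (if l = k then 1 else 0))"

lemma orthonormal_perp_le_codim:
  assumes M: "closed_sub M" "codim_le n M" and f: "orthonormal_perp M d f"
  shows "d \<le> n"
proof (rule ccontr)
  assume "\<not> d \<le> n"
  then have f': "f l \<in> V" "z \<in> M \<Longrightarrow> ip (f l) z = 0" "k \<le> n \<Longrightarrow> ip (f l) (f k) = (if l = k then 1 else 0)"
    if "l \<le> n" for l k z
    using f that by (auto simp: orthonormal_perp_def)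
  then obtain c where c: "\<exists>i\<le>n. c i \<noteq> 0" "(\<Sum>i\<le>n. c i *\<^sub>R f i) \<in> M"
    using M(2)[unfolded codim_le_def, THEN spec, of f] by blast
  let ?w = "\<Sum>i\<le>n. c i *\<^sub>R f i"
  have wV: "?w \<in> V" using closed_sub_subset[OF M(1)] c(2) by blast
  have "ip ?w ?w = (\<Sum>i\<le>n. ip (c i *\<^sub>R f i) ?w)" using f'(1) wV by (intro sum_left) auto
  also have "\<dots> = 0" using f'(1) f'(2)[OF _ c(2)] wV by (intro sum.neutral) (simp add: scale_left)
  finally have "ip ?w ?w = 0" .
  moreover have "ip ?w ?w = (\<Sum>i\<le>n. (c i)\<^sup>2)" using f' by (intro ip_orthonormal_sum_self) auto
  ultimately show False using c(1) by (auto simp: sum_nonneg_eq_0_iff)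
qed

text \<open>
  Orthonormal systems in the orthogonal complement of \<open>M\<close> have at most \<open>n\<close> members, so there is one of
  maximal length. By maximality no non-zero vector of the complement is orthogonal to it, hence it spans the
  complement.
\<close>

lemma perp_basis_exists:
  assumes M: "closed_sub M" "codim_le n M"
  obtains d f where "d \<le> n" "orthonormal_perp M d f"
    "\<And>u. u \<in> V \<Longrightarrow> (\<And>z. z \<in> M \<Longrightarrow> ip u z = 0) \<Longrightarrow> ip u u = (\<Sum>l<d. (ip u (f l))\<^sup>2)"
proof -
  have "\<exists>d f. orthonormal_perp M d f \<and> (\<nexists>f'. orthonormal_perp M (Suc d) f')"
  proof (rule ccontr)
    assume no: "\<not> ?thesis"
    have "\<exists>f. orthonormal_perp M d f" for d
    proof (induction d)
      case 0 show ?case by (simp add: orthonormal_perp_def)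
    next
      case (Suc d) then show ?case using no by blast
    qed
    then obtain f where "orthonormal_perp M (Suc n) f" by blast
    from orthonormal_perp_le_codim[OF M this] show False by simp
  qed
  then obtain d f where f: "orthonormal_perp M d f" and max: "\<nexists>f'. orthonormal_perp M (Suc d) f'" by blast
  have fV: "f l \<in> V" and fM: "z \<in> M \<Longrightarrow> ip (f l) z = 0" and ff: "k < d \<Longrightarrow> ip (f l) (f k) = (if l = k then 1 else 0)"
    if "l < d" for l k z
    using f that by (auto simp: orthonormal_perp_def)
  have MV: "z \<in> V" if "z \<in> M" for z using closed_sub_subset[OF M(1)] that by blast
  have "ip u u = (\<Sum>l<d. (ip u (f l))\<^sup>2)" if u: "u \<in> V" "\<And>z. z \<in> M \<Longrightarrow> ip u z = 0" for u
  proof -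
    let ?s = "\<Sum>l<d. ip u (f l) *\<^sub>R f l"
    define w where "w = u - ?s"
    have sV: "?s \<in> V" using fV by auto
    have wV: "w \<in> V" using u sV by (simp add: w_def)
    have wM: "ip w z = 0" if "z \<in> M" for z
    proof -
      have "ip ?s z = (\<Sum>l<d. ip (ip u (f l) *\<^sub>R f l) z)" using fV MV[OF that] by (intro sum_left) auto
      also have "\<dots> = 0" using fV fM that MV by (intro sum.neutral) (simp add: scale_left)
      finally show ?thesis using u that MV sV by (simp add: w_def diff_left)
    qed
    have wf: "ip w (f l) = 0" if "l < d" for l
    proof -
      have "ip ?s (f l) = ip u (f l)" using that fV ff by (intro sum_ip_orthonormal) auto
      then show ?thesis using u sV fV that by (simp add: w_def diff_left)
    qed
    have "w = 0"
    proof (rule ccontr)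
      assume "w \<noteq> 0"
      then have p: "ip w w > 0" using pos wV by blast
      define g where "g = (1 / nrm w) *\<^sub>R w"
      have n: "nrm w > 0" "nrm w * nrm w = ip w w" using p by (auto simp: nrm_def)
      have gV: "g \<in> V" using wV by (simp add: g_def)
      have gg: "ip g g = 1" using wV n p by (simp add: g_def scale_left scale_right field_simps)
      have gf: "ip g (f l) = 0" "ip (f l) g = 0" if "l < d" for l
        using wf[OF that] wV fV[OF that] by (simp_all add: g_def scale_left scale_right commute[of "f l" w])
      have gM: "ip g z = 0" if "z \<in> M" for z
        using wM[OF that] wV MV[OF that] by (simp add: g_def scale_left)
      have "orthonormal_perp M (Suc d) (f(d := g))"
        unfolding orthonormal_perp_def less_Suc_eq
        using gV gg gf gM fV fM ff by auto
      then show False using max by blast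
    qed
    then have "u = ?s" by (simp add: w_def)
    then have "ip u u = ip ?s ?s" by simp
    also have "\<dots> = (\<Sum>l<d. (ip u (f l))\<^sup>2)" using fV ff by (intro ip_orthonormal_sum_self) auto
    finally show ?thesis .
  qed
  then show ?thesis using that[OF orthonormal_perp_le_codim[OF M f] f] by blast
qed

end

context hilbert_basis
begin

text \<open>
  The matrix of \<open>I - P\<^sub>M\<close>: its diagonal entry at \<open>i\<close> tells how much of \<open>e i\<close> is lost by projecting to \<open>M\<close>.
\<close>

definition defect :: "'a set \<Rightarrow> nat \<Rightarrow> nat \<Rightarrow> real" where
  "defect M i j = ip (e i - proj M (e i)) (e j)"

lemma defect_diag:
  assumes M: "closed_sub M"
  shows "defect M i i = ip (e i - proj M (e i)) (e i - proj M (e i))"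
proof -
  have "ip (e i - proj M (e i)) (proj M (e i)) = 0"
    using proj_mem_orth[OF M e_mem] by blast
  then show ?thesis using M by (simp add: defect_def diff_right)
qed

lemma defect_sym: "closed_sub M \<Longrightarrow> defect M i j = defect M j i"
  by (simp add: defect_def diff_left proj_selfadjoint commute[of "e j" "e i"] commute[of "e i" "proj M (e j)"])

lemma defect_square_sum:
  assumes "closed_sub M" "finite A"
  shows "(\<Sum>j\<in>A. (defect M i j)\<^sup>2) \<le> defect M i i"
  unfolding defect_diag[OF assms(1)] unfolding defect_def
  using assms by (intro Bessel) (auto simp: e_orth)

text \<open>
  The projection \<open>I - P\<^sub>M\<close> has rank at most \<open>n\<close>: writing it in an orthonormal basis \<open>f\<close> of the complement and
  exchanging the two sums, each of the at most \<open>n\<close> basis vectors contributes at most its squared norm.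
\<close>

lemma defect_trace:
  assumes M: "closed_sub M" "codim_le n M" and A: "finite A"
  shows "(\<Sum>i\<in>A. defect M i i) \<le> n"
proof -
  obtain d f where d: "d \<le> n" and f: "orthonormal_perp M d f"
    and ex: "\<And>u. u \<in> V \<Longrightarrow> (\<And>z. z \<in> M \<Longrightarrow> ip u z = 0) \<Longrightarrow> ip u u = (\<Sum>l<d. (ip u (f l))\<^sup>2)"
    using perp_basis_exists[OF M] by blast
  have fV: "f l \<in> V" and fM: "z \<in> M \<Longrightarrow> ip (f l) z = 0" and f1: "ip (f l) (f l) = 1" if "l < d" for l z
    using f that by (auto simp: orthonormal_perp_def)
  have "defect M i i = (\<Sum>l<d. (ip (f l) (e i))\<^sup>2)" for i
  proof -
    let ?u = "e i - proj M (e i)"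
    have "defect M i i = (\<Sum>l<d. (ip ?u (f l))\<^sup>2)"
      unfolding defect_diag[OF M(1)] using M(1) by (intro ex) (auto intro: proj_mem_orth(2))
    also have "\<dots> = (\<Sum>l<d. (ip (f l) (e i))\<^sup>2)"
    proof (intro sum.cong refl)
      fix l assume "l \<in> {..<d}"
      then have l: "l < d" by simp
      have "ip (proj M (e i)) (f l) = 0"
        using fM[OF l proj_mem_orth(1)[OF M(1) e_mem]] fV[OF l] M(1) by (simp add: commute)
      then show "(ip ?u (f l))\<^sup>2 = (ip (f l) (e i))\<^sup>2"
        using fV[OF l] M(1) by (simp add: diff_left commute[of "f l" "e i"])
    qed
    finally show ?thesis .
  qed
  then have "(\<Sum>i\<in>A. defect M i i) = (\<Sum>l<d. \<Sum>i\<in>A. (ip (f l) (e i))\<^sup>2)"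
    by (simp add: sum.swap[of _ A])
  also have "\<dots> \<le> (\<Sum>l<d. 1)"
  proof (rule sum_mono)
    fix l assume "l \<in> {..<d}"
    then have l: "l < d" by simp
    show "(\<Sum>i\<in>A. (ip (f l) (e i))\<^sup>2) \<le> 1"
      using Bessel[OF A, of e "f l"] fV[OF l] f1[OF l] by (simp add: e_orth)
  qed
  finally show ?thesis using d by simp
qed

text \<open>
  Of \<open>4 * n\<close> diagonal entries with sum at most \<open>n\<close>, at most \<open>2 * n\<close> exceed \<open>1/2\<close>. All frequencies in
  the block are of order \<open>n\<close>, which makes the variances comparable.
\<close>

lemma half_defect_card:
  assumes M: "closed_sub M" "codim_le n M"
  shows "2 * n \<le> card {i \<in> {4 * n..<8 * n}. defect M i i \<le> 1 / 2}"
proof -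
  let ?B = "{i \<in> {4 * n..<8 * n}. \<not> defect M i i \<le> 1 / 2}"
  have "real (card ?B) * (1 / 2) = (\<Sum>i\<in>?B. 1 / 2)" by simp
  also have "\<dots> \<le> (\<Sum>i\<in>?B. defect M i i)" by (intro sum_mono) auto
  also have "\<dots> \<le> n" by (rule defect_trace[OF M]) auto
  finally have "card ?B \<le> 2 * n" by linarith
  moreover have "card {i \<in> {4 * n..<8 * n}. defect M i i \<le> 1 / 2} + card ?B = 4 * n"
  proof -
    have "card {i \<in> {4 * n..<8 * n}. defect M i i \<le> 1 / 2} + card ?B
        = card ({i \<in> {4 * n..<8 * n}. defect M i i \<le> 1 / 2} \<union> ?B)"
      by (rule card_Un_disjoint[symmetric]) auto
    also have "{i \<in> {4 * n..<8 * n}. defect M i i \<le> 1 / 2} \<union> ?B = {4 * n..<8 * n}" by auto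
    also have "card {4 * n..<8 * n} = 4 * n" by simp
    finally show ?thesis .
  qed
  ultimately show ?thesis by linarith
qed

text \<open>
  The squares of a row of \<open>I - P\<^sub>M\<close> sum up to its diagonal entry, which is at most \<open>1\<close>, so at most \<open>s ^ 4\<close>
  entries of a row exceed \<open>1 / s\<^sup>2\<close>. In the graph of large entries this bounds the degrees, and an
  independent set is what is wanted.
\<close>

lemma almost_orthogonal_coordinates:
  assumes M: "closed_sub M" "codim_le n M" and s: "s \<ge> 1" "s * (s ^ 4 + 1) \<le> 2 * n"
  obtains S where "S \<subseteq> {4 * n..<8 * n}" "card S = s"
    "\<And>i. i \<in> S \<Longrightarrow> defect M i i \<le> 1 / 2"
    "\<And>i j. i \<in> S \<Longrightarrow> j \<in> S \<Longrightarrow> i \<noteq> j \<Longrightarrow> \<bar>defect M i j\<bar> \<le> 1 / (real s)\<^sup>2"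
proof -
  define W where "W = {i \<in> {4 * n..<8 * n}. defect M i i \<le> 1 / 2}"
  define R where "R i j \<longleftrightarrow> 1 / (real s)\<^sup>2 < \<bar>defect M i j\<bar>" for i j
  have "\<exists>S\<subseteq>W. card S = s \<and> (\<forall>i\<in>S. \<forall>j\<in>S. i \<noteq> j \<longrightarrow> \<not> R i j)"
  proof (rule sparse_independent_set)
    show "finite W" by (simp add: W_def)
    show "R j i" if "R i j" for i j using that defect_sym[OF M(1), of i j] by (simp add: R_def)
    show "s * (s ^ 4 + 1) \<le> card W"
      using s(2) half_defect_card[OF M] by (simp add: W_def)
    show "card {j \<in> W. R i j} \<le> s ^ 4" if i: "i \<in> W" for i
    proof -
      have "real (card {j \<in> W. R i j}) * (1 / real s ^ 4) = (\<Sum>j\<in>{j \<in> W. R i j}. 1 / real s ^ 4)" by simp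
      also have "\<dots> \<le> (\<Sum>j\<in>{j \<in> W. R i j}. (defect M i j)\<^sup>2)"
      proof (rule sum_mono)
        fix j assume "j \<in> {j \<in> W. R i j}"
        then have "(1 / (real s)\<^sup>2)\<^sup>2 \<le> \<bar>defect M i j\<bar>\<^sup>2" by (intro power_mono) (auto simp: R_def)
        then show "1 / real s ^ 4 \<le> (defect M i j)\<^sup>2" by (simp add: power_divide flip: power_mult)
      qed
      also have "\<dots> \<le> defect M i i" by (rule defect_square_sum[OF M(1)]) (simp add: W_def)
      also have "\<dots> \<le> 1" using i by (simp add: W_def)
      finally have "real (card {j \<in> W. R i j}) \<le> real s ^ 4" using s(1) by (simp add: field_simps)
      then show ?thesis by (metis of_nat_le_iff of_nat_power)
    qed
  qed
  then obtain S where S: "S \<subseteq> W" "card S = s" "\<forall>i\<in>S. \<forall>j\<in>S. i \<noteq> j \<longrightarrow> \<not> R i j" by blast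
  show ?thesis
  proof (rule that[of S])
    show "S \<subseteq> {4 * n..<8 * n}" using S(1) by (auto simp: W_def)
    show "defect M i i \<le> 1 / 2" if "i \<in> S" for i using S(1) that by (auto simp: W_def)
    show "\<bar>defect M i j\<bar> \<le> 1 / (real s)\<^sup>2" if "i \<in> S" "j \<in> S" "i \<noteq> j" for i j
      using S(3) that by (simp add: R_def not_less)
  qed (rule S(2))
qed

end

context gaussian_space
begin

lemma proj_ip_basis: "closed_sub M \<Longrightarrow> x \<in> V \<Longrightarrow> ip (proj M x) (e i) = ip x (proj M (e i))"
  by (simp add: proj_selfadjoint)

lemma proj_basis_ip: "closed_sub M \<Longrightarrow> ip (proj M (e i)) (e j) = (if i = j then 1 else 0) - defect M i j"
  by (simp add: defect_def diff_left e_orth)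

lemma all_coordinates_small:
  assumes M: "closed_sub M" "codim_le n M" and s: "s \<ge> 1" "s * (s ^ 4 + 1) \<le> 2 * n"
    and lo: "\<And>i. i \<in> {4 * n..<8 * n} \<Longrightarrow> a\<^sup>2 \<le> lam i" and hi: "\<And>i. i \<in> {4 * n..<8 * n} \<Longrightarrow> lam i \<le> b\<^sup>2"
    and ab: "0 < a" "0 < b" and T: "T \<ge> 0"
  shows "prob {x \<in> V. \<forall>i\<in>{4 * n..<8 * n}. \<bar>ip (proj M x) (e i)\<bar> \<le> T}
    \<le> real s * (sqrt 2 * exp (- ((real s)\<^sup>2 / 4))) + (1 - exp (- ((2 * (T + b)) / a)\<^sup>2) / 9) ^ s"
proof -
  obtain S where S: "S \<subseteq> {4 * n..<8 * n}" "card S = s"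
    "\<And>i. i \<in> S \<Longrightarrow> defect M i i \<le> 1 / 2"
    "\<And>i j. i \<in> S \<Longrightarrow> j \<in> S \<Longrightarrow> i \<noteq> j \<Longrightarrow> \<bar>defect M i j\<bar> \<le> 1 / (real s)\<^sup>2"
    using almost_orthogonal_coordinates[OF M s] by blast
  let ?v = "\<lambda>i. proj M (e i)"
  have fin: "finite S" using S(1) finite_subset by blast
  have vV: "?v i \<in> V" for i using M(1) by simp
  have "{x \<in> space \<mu>. \<forall>i\<in>S. \<bar>ip x (?v i)\<bar> \<le> T} \<in> sets \<mu>"
    using fin vV by measurable
  then have m: "{x \<in> V. \<forall>i\<in>S. \<bar>ip x (?v i)\<bar> \<le> T} \<in> sets \<mu>" by (simp add: space_mu)
  have "prob {x \<in> V. \<forall>i\<in>{4 * n..<8 * n}. \<bar>ip (proj M x) (e i)\<bar> \<le> T} \<le> prob {x \<in> V. \<forall>i\<in>S. \<bar>ip x (?v i)\<bar> \<le> T}"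
    using S(1) M(1) m by (intro finite_measure_mono) (auto simp: proj_ip_basis)
  also have "\<dots> \<le> real (card S) * (sqrt 2 * exp (- ((real (card S))\<^sup>2 / 4)))
      + (1 - exp (- ((2 * (T + b)) / a)\<^sup>2) / 9) ^ card S"
  proof (rule joint_bound)
    show "S \<noteq> {}" using S(2) s(1) by auto
    show "1 / 2 \<le> ip (?v i) (e i)" if "i \<in> S" for i using S(3)[OF that] M(1) by (simp add: proj_basis_ip)
    show "\<bar>ip (?v i) (e j)\<bar> \<le> 1 / (real (card S))\<^sup>2" if "i \<in> S" "j \<in> S" "i \<noteq> j" for i j
      using S(4)[OF that] that M(1) S(2) by (simp add: proj_basis_ip)
  qed (use S lo hi ab T fin vV in auto)
  finally show ?thesis using S(2) by simp
qed

text \<open>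
  For a single coordinate with defect at most \<open>1/2\<close> no decoupling is required: \<open>\<langle>x, P\<^sub>M e\<^sub>i\<rangle>\<close> is normal with
  standard deviation at least \<open>a/2\<close>.
\<close>

lemma one_coordinate_large:
  assumes M: "closed_sub M" "codim_le n M" and n: "n \<ge> 1"
    and lo: "\<And>i. i \<in> {4 * n..<8 * n} \<Longrightarrow> a\<^sup>2 \<le> lam i" and a: "0 < a" and T: "T \<ge> 0"
  shows "\<exists>i\<in>{4 * n..<8 * n}. exp (- (2 * T / a)\<^sup>2) / 9 \<le> prob {x \<in> V. T < ip (proj M x) (e i)}"
proof -
  have "card {i \<in> {4 * n..<8 * n}. defect M i i \<le> 1 / 2} \<noteq> 0" using half_defect_card[OF M] n by linarith
  then obtain i where i: "i \<in> {4 * n..<8 * n}" "defect M i i \<le> 1 / 2"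
    by (metis (mono_tags, lifting) card.empty empty_Collect_eq)
  let ?v = "proj M (e i)"
  have v: "?v \<in> V" using M(1) by simp
  have vi: "ip ?v (e i) \<ge> 1 / 2" using i(2) M(1) by (simp add: proj_basis_ip)
  then have v0: "?v \<noteq> 0" by auto
  have "a\<^sup>2 * (1 / 2)\<^sup>2 \<le> lam i * (ip ?v (e i))\<^sup>2"
    using lo[OF i(1)] vi lam_pos[of i] by (intro mult_mono power_mono) auto
  also have "\<dots> \<le> var ?v" by (rule var_ge[OF v])
  finally have "a\<^sup>2 / 4 \<le> var ?v" by (simp add: power_divide)
  then have "T\<^sup>2 / var ?v \<le> T\<^sup>2 / (a\<^sup>2 / 4)"
    using a var_pos[OF v v0] by (intro divide_left_mono) auto
  also have "\<dots> = (2 * T / a)\<^sup>2" by (simp add: power_divide power_mult_distrib)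
  finally have "exp (- (2 * T / a)\<^sup>2) / 9 \<le> exp (- (T\<^sup>2 / var ?v)) / 9" by simp
  also have "\<dots> \<le> prob {x \<in> V. T < ip x ?v}" by (rule tail_lower[OF v v0 T])
  also have "{x \<in> V. T < ip x ?v} = {x \<in> V. T < ip (proj M x) (e i)}"
    using M(1) by (auto simp: proj_ip_basis)
  finally show ?thesis using i(1) by blast
qed

end

text \<open>
  The projection is a contraction, hence continuous.
\<close>

lemma (in hilbert) proj_measurable:
  assumes M: "closed_sub M"
  shows "proj M \<in> measurable borel_V (restrict_space borel_V M)"
proof (rule measurable_restrict_space2)
  show "proj M \<in> space borel_V \<rightarrow> M" using proj_mem_orth(1)[OF M] by simp
  have sub: "{U. openin M.mtopology U} \<subseteq> Pow V"
    using openin_subset[of M.mtopology] by (simp add: subset_eq)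
  show "proj M \<in> measurable borel_V borel_V"
    unfolding borel_V_def
  proof (rule measurable_sigma_sets)
    show "sets (sigma V {U. openin M.mtopology U}) = sigma_sets V {U. openin M.mtopology U}"
      using sub by (rule sets_measure_of)
    show "{U. openin M.mtopology U} \<subseteq> Pow V" by (rule sub)
    show "proj M \<in> space (sigma V {U. openin M.mtopology U}) \<rightarrow> V"
      using M by (auto simp: space_measure_of_conv)
    fix U assume "U \<in> {U. openin M.mtopology U}"
    then have U: "openin M.mtopology U" by simp
    have "openin M.mtopology (proj M -` U \<inter> V)"
      unfolding M.openin_mtopology
    proof (intro conjI allI impI)
      fix x assume x: "x \<in> proj M -` U \<inter> V"
      then obtain \<epsilon> where \<epsilon>: "\<epsilon> > 0" "M.mball (proj M x) \<epsilon> \<subseteq> U"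
        using U unfolding M.openin_mtopology by auto
      have "y \<in> proj M -` U \<inter> V" if "y \<in> M.mball x \<epsilon>" for y
      proof -
        have yV: "y \<in> V" and d: "nrm (x - y) < \<epsilon>" using that by (auto simp: M.in_mball)
        have "nrm (proj M x - proj M y) \<le> nrm (x - y)"
          using proj_contraction[OF M, of "x - y"] proj_diff[OF M, of x y] x yV
          by (simp add: nrm_def)
        then have "proj M y \<in> M.mball (proj M x) \<epsilon>" using d x yV M by (auto simp: M.in_mball)
        then show ?thesis using \<epsilon> yV by auto
      qed
      then show "\<exists>r>0. M.mball x r \<subseteq> proj M -` U \<inter> V" using \<epsilon>(1) by blast
    qed simp
    then show "proj M -` U \<inter> space (sigma V {U. openin M.mtopology U}) \<in> sets (sigma V {U. openin M.mtopology U})"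
      using openin_borel_V by (simp add: borel_V_def space_measure_of_conv)
  qed
qed

section \<open>Gaussian vectors in the span of the high frequencies\<close>

context gaussian_space
begin

definition tail_space :: "nat \<Rightarrow> 'a set" where
  "tail_space J = {x \<in> V. \<forall>j<J. ip x (e j) = 0}"

text \<open>
  Some \<open>z\<close> in \<open>M\<close> has a non-zero coordinate \<open>j < J\<close>, so \<open>P\<^sub>M e\<^sub>j\<close> is not zero. The \<open>j\<close>-th coordinate of \<open>P\<^sub>M x\<close> is
  the inner product of \<open>x\<close> with this vector, a normal variable of positive variance, and vanishes with
  probability zero.
\<close>

lemma tail_space_null:
  assumes M: "closed_sub M" and not: "\<not> M \<subseteq> tail_space J"
  shows "emeasure \<mu> {x \<in> V. proj M x \<in> tail_space J} = 0"
proof -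
  obtain z j where z: "z \<in> M" "j < J" "ip z (e j) \<noteq> 0"
    using not closed_sub_subset[OF M] by (auto simp: tail_space_def)
  let ?h = "proj M (e j)"
  have h: "?h \<in> V" using M by simp
  have "ip ?h z = ip (e j) z" by (rule proj_ip[OF M e_mem z(1)])
  also have "\<dots> \<noteq> 0" using z closed_sub_subset[OF M] by (subst commute) auto
  finally have h0: "?h \<noteq> 0" using z closed_sub_subset[OF M] by auto
  have "{x \<in> space \<mu>. ip x ?h = 0} \<in> sets \<mu>" using h by measurable
  then have m: "{x \<in> V. ip x ?h = 0} \<in> sets \<mu>" by (simp add: space_mu)
  have "emeasure \<mu> {x \<in> V. ip x ?h = 0} = (\<integral>\<^sup>+ x. indicator {x \<in> V. ip x ?h = 0} x \<partial>\<mu>)"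
    using m by simp
  also have "\<dots> = (\<integral>\<^sup>+ x. indicator {0} (ip x ?h) \<partial>\<mu>)"
    by (rule nn_integral_cong) (auto simp: indicator_def space_mu)
  also have "\<dots> = (\<integral>\<^sup>+ t. ennreal (normal_density 0 (sqrt (var ?h)) t) * indicator {0} t \<partial>lborel)"
    by (rule distributed_nn_integral[OF law'[OF h h0], symmetric]) simp
  also have "\<dots> = (\<integral>\<^sup>+ t. 0 \<partial>(lborel :: real measure))"
  proof (rule nn_integral_cong_AE)
    have "AE t in lborel. t \<noteq> (0::real)" by (rule AE_lborel_singleton)
    then show "AE t in lborel. ennreal (normal_density 0 (sqrt (var ?h)) t) * indicator {0} t = 0"
      by eventually_elim simp
  qed
  finally have null: "emeasure \<mu> {x \<in> V. ip x ?h = 0} = 0" by simp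
  have "{x \<in> V. proj M x \<in> tail_space J} \<subseteq> {x \<in> V. ip x ?h = 0}"
    using z(2) by (auto simp: tail_space_def proj_ip_basis[OF M])
  then have "emeasure \<mu> {x \<in> V. proj M x \<in> tail_space J} \<le> emeasure \<mu> {x \<in> V. ip x ?h = 0}"
    using m by (rule emeasure_mono)
  then show ?thesis using null by simp
qed

text \<open>
  The vectors \<open>P\<^sub>M e\<^sub>j\<close> lie in the tail space, where the variance is at most \<open>\<tau>\<^sup>2\<close> times the squared norm, and
  have norm at most one. So every coordinate of \<open>P\<^sub>M x\<close> obeys the exponential moment bound with the
  same \<open>\<tau>\<close>; correlations between the coordinates do not matter for the expectation of the sum. The free
  parameters \<open>q i\<close> weight the coordinates.
\<close>

lemma tail_exp_sum:
  assumes M: "closed_sub M" "M \<subseteq> tail_space J"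
    and \<tau>: "\<tau> > 0" "\<And>j. j \<ge> J \<Longrightarrow> lam j \<le> \<tau>\<^sup>2"
  shows "(\<integral>\<^sup>+ x. (\<Sum>i. ennreal (exp ((ip (proj M x) (e (J + i)))\<^sup>2 / (4 * \<tau>\<^sup>2) - q i))) \<partial>\<mu>)
    \<le> (\<Sum>i. ennreal (sqrt 2 * exp (- q i)))"
proof -
  let ?h = "\<lambda>i. proj M (e (J + i))"
  have h: "?h i \<in> V" for i using M(1) by simp
  have v: "var (?h i) \<le> \<tau>\<^sup>2" for i
  proof -
    have "var (?h i) \<le> \<tau>\<^sup>2 * ip (?h i) (?h i)"
    proof (rule var_le[OF h])
      fix j assume "ip (?h i) (e j) \<noteq> 0"
      moreover have "?h i \<in> tail_space J" using M proj_mem_orth(1)[OF M(1) e_mem] by blast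
      ultimately have "j \<ge> J" by (force simp: tail_space_def not_less[symmetric])
      then show "lam j \<le> \<tau>\<^sup>2" by (rule \<tau>(2))
    qed
    also have "\<dots> \<le> \<tau>\<^sup>2 * 1"
      using proj_contraction[OF M(1), of "e (J + i)"] by (intro mult_left_mono) (auto simp: e_orth)
    finally show ?thesis by simp
  qed
  have "(\<integral>\<^sup>+ x. (\<Sum>i. ennreal (exp ((ip (proj M x) (e (J + i)))\<^sup>2 / (4 * \<tau>\<^sup>2) - q i))) \<partial>\<mu>)
     = (\<integral>\<^sup>+ x. (\<Sum>i. ennreal (exp (- q i)) * ennreal (exp ((ip x (?h i))\<^sup>2 / (4 * \<tau>\<^sup>2)))) \<partial>\<mu>)"
    by (rule nn_integral_cong)
       (simp add: space_mu proj_ip_basis[OF M(1)] ennreal_mult[symmetric] exp_add[symmetric])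
  also have "\<dots> = (\<Sum>i. \<integral>\<^sup>+ x. ennreal (exp (- q i)) * ennreal (exp ((ip x (?h i))\<^sup>2 / (4 * \<tau>\<^sup>2))) \<partial>\<mu>)"
    using h by (intro nn_integral_suminf) measurable
  also have "\<dots> \<le> (\<Sum>i. ennreal (sqrt 2 * exp (- q i)))"
  proof (rule suminf_le)
    fix i
    have "(\<integral>\<^sup>+ x. ennreal (exp (- q i)) * ennreal (exp ((ip x (?h i))\<^sup>2 / (4 * \<tau>\<^sup>2))) \<partial>\<mu>)
       = ennreal (exp (- q i)) * (\<integral>\<^sup>+ x. ennreal (exp ((ip x (?h i))\<^sup>2 / (4 * \<tau>\<^sup>2))) \<partial>\<mu>)"
      using h by (intro nn_integral_cmult) measurable
    also have "\<dots> \<le> ennreal (exp (- q i)) * ennreal (sqrt 2)"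
      by (intro mult_left_mono exp_moment h v \<tau>(1)) simp
    also have "\<dots> = ennreal (sqrt 2 * exp (- q i))" by (simp add: ennreal_mult[symmetric] mult.commute[of "sqrt 2"])
    finally show "(\<integral>\<^sup>+ x. ennreal (exp (- q i)) * ennreal (exp ((ip x (?h i))\<^sup>2 / (4 * \<tau>\<^sup>2))) \<partial>\<mu>)
       \<le> ennreal (sqrt 2 * exp (- q i))" .
  qed auto
  finally show ?thesis .
qed

end

text \<open>
  As \<open>2 * r \<ge> 1\<close> and the frequency grows by one every two indices, the exponents grow at least
  linearly, with slope \<open>2 * \<Lambda> / \<nu>\<close>; the geometric series with ratio \<open>exp (- (2 * \<Lambda> / \<nu>))\<close> is at most \<open>1 + \<nu>\<close>.
\<close>

lemma tail_sum_bound: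
  assumes \<nu>: "\<nu> \<ge> 1" and \<Lambda>: "\<Lambda> \<ge> 1 / 2" and r: "r > 1 / 2"
  shows "(\<Sum>i. ennreal (sqrt 2 * exp (- (4 * \<Lambda> * (kap (2 * (\<nu> - 1) + i) / real \<nu>) powr (2 * r)))))
    \<le> ennreal (sqrt 2 * exp (- 2 * \<Lambda>) * (1 + real \<nu>))"
proof -
  define y where "y = exp (- (2 * \<Lambda> / real \<nu>))"
  have \<nu>0: "real \<nu> > 0" using \<nu> by simp
  have y: "0 < y" "y < 1" using \<Lambda> \<nu>0 by (auto simp: y_def)
  have bound: "sqrt 2 * exp (- (4 * \<Lambda> * (kap (2 * (\<nu> - 1) + i) / real \<nu>) powr (2 * r)))
      \<le> sqrt 2 * exp (- 2 * \<Lambda>) * y ^ i" for i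
  proof -
    define K where "K = real \<nu> + real (i div 2)"
    have "freq (Suc (2 * (\<nu> - 1) + i)) = \<nu> + i div 2" using \<nu> unfolding freq_def by presburger
    then have k: "kap (2 * (\<nu> - 1) + i) = K" unfolding kap_def K_def by simp
    have "(real i - 1) / (2 * real \<nu>) \<le> (2 * real (i div 2)) / (2 * real \<nu>)"
      using \<nu>0 by (intro divide_right_mono) linarith+
    then have k2: "1 + (real i - 1) / (2 * real \<nu>) \<le> K / real \<nu>"
      using \<nu>0 by (simp add: K_def add_divide_distrib)
    have K0: "K > 0" using \<nu>0 by (simp add: K_def add_pos_nonneg)
    have "1 \<le> K / real \<nu>" using \<nu>0 by (simp add: K_def)
    then have "K / real \<nu> \<le> (K / real \<nu>) powr (2 * r)"
      using powr_mono[of 1 "2 * r" "K / real \<nu>"] r K0 by simp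
    with k2 have "1 + (real i - 1) / (2 * real \<nu>) \<le> (K / real \<nu>) powr (2 * r)" by (rule order_trans)
    then have "4 * \<Lambda> * (1 + (real i - 1) / (2 * real \<nu>)) \<le> 4 * \<Lambda> * (K / real \<nu>) powr (2 * r)"
      using \<Lambda> by (intro mult_left_mono) simp_all
    moreover have "4 * \<Lambda> * (1 + (real i - 1) / (2 * real \<nu>)) = 4 * \<Lambda> - 2 * \<Lambda> / real \<nu> + real i * (2 * \<Lambda> / real \<nu>)"
      using \<nu>0 by (simp add: field_simps)
    moreover have "2 * \<Lambda> / real \<nu> \<le> 2 * \<Lambda>" using \<nu> \<Lambda> by (simp add: field_simps)
    ultimately have "2 * \<Lambda> + real i * (2 * \<Lambda> / real \<nu>) \<le> 4 * \<Lambda> * (K / real \<nu>) powr (2 * r)" by linarith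
    then have "exp (- (4 * \<Lambda> * (K / real \<nu>) powr (2 * r))) \<le> exp (- 2 * \<Lambda> + real i * (- (2 * \<Lambda> / real \<nu>)))"
      by simp
    also have "\<dots> = exp (- 2 * \<Lambda>) * y ^ i"
      unfolding exp_add y_def exp_of_nat_mult[symmetric] by simp
    finally show ?thesis unfolding k by simp
  qed
  have "(\<Sum>i. ennreal (sqrt 2 * exp (- (4 * \<Lambda> * (kap (2 * (\<nu> - 1) + i) / real \<nu>) powr (2 * r)))))
     \<le> (\<Sum>i. ennreal (sqrt 2 * exp (- 2 * \<Lambda>) * y ^ i))"
    by (intro suminf_le ennreal_leI bound) auto
  also have "\<dots> = ennreal (\<Sum>i. sqrt 2 * exp (- 2 * \<Lambda>) * y ^ i)"
    using y by (intro suminf_ennreal2) (auto intro!: summable_mult summable_geometric)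
  also have "(\<Sum>i. sqrt 2 * exp (- 2 * \<Lambda>) * y ^ i) = sqrt 2 * exp (- 2 * \<Lambda>) * (1 / (1 - y))"
    using y by (subst suminf_mult) (auto simp: suminf_geometric)
  finally have le: "(\<Sum>i. ennreal (sqrt 2 * exp (- (4 * \<Lambda> * (kap (2 * (\<nu> - 1) + i) / real \<nu>) powr (2 * r)))))
     \<le> ennreal (sqrt 2 * exp (- 2 * \<Lambda>) * (1 / (1 - y)))" .
  have "1 / (1 - y) \<le> 1 + real \<nu>"
  proof -
    have "1 + 2 * \<Lambda> / real \<nu> \<le> exp (2 * \<Lambda> / real \<nu>)" by (rule exp_ge_add_one_self)
    moreover have "1 / real \<nu> \<le> 2 * \<Lambda> / real \<nu>" using \<Lambda> \<nu>0 by (intro divide_right_mono) auto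
    moreover have "exp (2 * \<Lambda> / real \<nu>) = 1 / y" by (simp add: y_def exp_minus divide_inverse)
    ultimately have "1 + 1 / real \<nu> \<le> 1 / y" by linarith
    then have "(1 + 1 / real \<nu>) * (y * real \<nu>) \<le> (1 / y) * (y * real \<nu>)"
      using y \<nu>0 by (intro mult_right_mono) auto
    then have "y * real \<nu> + y \<le> real \<nu>" using y \<nu>0 by (simp add: distrib_right)
    then have "1 \<le> (1 + real \<nu>) * (1 - y)" by (simp add: algebra_simps)
    then show ?thesis using y by (simp add: divide_le_eq)
  qed
  then have "sqrt 2 * exp (- 2 * \<Lambda>) * (1 / (1 - y)) \<le> sqrt 2 * exp (- 2 * \<Lambda>) * (1 + real \<nu>)"
    by (rule mult_left_mono) simp
  then show ?thesis by (intro order_trans[OF le] ennreal_leI)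
qed

section \<open>The optimal subspaces\<close>

definition trig_annihilator :: "nat \<Rightarrow> torus set" where
  "trig_annihilator n = {x. \<forall>j<n. inner_L2 x (trig_torus j) = 0}"

lemma inner_trig_add: "inner_L2 (x + y) (trig_torus j) = inner_L2 x (trig_torus j) + inner_L2 y (trig_torus j)"
  by (simp add: inner_trig fourier_coeff_add algebra_simps)

lemma inner_trig_scaleR: "inner_L2 (c *\<^sub>R x) (trig_torus j) = c * inner_L2 x (trig_torus j)"
  by (simp add: inner_L2_scaleR)

lemma inner_trig_diff: "inner_L2 (x - y) (trig_torus j) = inner_L2 x (trig_torus j) - inner_L2 y (trig_torus j)"
  by (simp add: inner_trig fourier_coeff_diff algebra_simps)

lemma inner_trig_zero [simp]: "inner_L2 0 (trig_torus j) = 0"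
  using inner_trig_scaleR[of 0 0 j] by simp

lemma inner_trig_sum: "inner_L2 (\<Sum>i\<in>I. c i *\<^sub>R trig_torus (g i)) (trig_torus j)
    = (\<Sum>i\<in>I. c i * inner_L2 (trig_torus (g i)) (trig_torus j))"
proof (induction I rule: infinite_finite_induct)
  case (insert i I)
  then show ?case by (simp add: inner_trig_add inner_trig_scaleR)
qed simp_all

lemma abs_inner_trig_le: "\<bar>inner_L2 x (trig_torus j)\<bar> \<le> sqrt 2 * norm_S x"
proof -
  have c: "\<bar>Re (fourier_coeff x k)\<bar> \<le> norm_S x" "\<bar>Im (fourier_coeff x k)\<bar> \<le> norm_S x" for k
    using fourier_le_norm_S[of x k] abs_Re_le_cmod[of "fourier_coeff x k"] abs_Im_le_cmod[of "fourier_coeff x k"]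
    by linarith+
  have n: "norm_S x \<le> sqrt 2 * norm_S x" using mult_right_mono[of 1 "sqrt 2" "norm_S x"] by simp
  consider "j = 0" | "j \<noteq> 0" "odd j" | "j \<noteq> 0" "even j" by blast
  then show ?thesis
  proof cases
    case 1 then show ?thesis using c(1)[of 0] n by (simp add: inner_trig)
  next
    case 2 then show ?thesis using c(1)[of "freq j"] by (simp add: inner_trig abs_mult)
  next
    case 3 then show ?thesis using c(2)[of "freq j"] by (simp add: inner_trig abs_mult)
  qed
qed

lemma trig_annihilator_subspace: "subspace (trig_annihilator n)"
  by (auto simp: subspace_def trig_annihilator_def inner_trig_add inner_trig_scaleR)

text \<open>
  The coefficient functionals are bounded with respect to the norm of \<open>S\<^sub>\<infinity>\<close>.
\<close>

lemma trig_annihilator_closed: "closedin top_S (trig_annihilator n)"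
  unfolding top_S_eq S.closedin_metric
proof (intro conjI allI impI)
  fix x assume "x \<in> UNIV - trig_annihilator n"
  then obtain j where j: "j < n" "inner_L2 x (trig_torus j) \<noteq> 0" by (auto simp: trig_annihilator_def)
  let ?\<epsilon> = "\<bar>inner_L2 x (trig_torus j)\<bar> / sqrt 2"
  have "y \<notin> trig_annihilator n" if "y \<in> S.mball x ?\<epsilon>" for y
  proof
    assume "y \<in> trig_annihilator n"
    then have "\<bar>inner_L2 x (trig_torus j)\<bar> = \<bar>inner_L2 (x - y) (trig_torus j)\<bar>"
      using j by (simp add: trig_annihilator_def inner_trig_diff)
    also have "\<dots> \<le> sqrt 2 * norm_S (x - y)" by (rule abs_inner_trig_le)
    also have "\<dots> < \<bar>inner_L2 x (trig_torus j)\<bar>" using that by (simp add: S.in_mball field_simps)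
    finally show False by simp
  qed
  then show "\<exists>r>0. disjnt (trig_annihilator n) (S.mball x r)"
    using j by (intro exI[of _ ?\<epsilon>]) (auto simp: disjnt_def)
qed simp

lemma trig_annihilator_codim: "has_codim S_inf (trig_annihilator n) n"
  unfolding has_codim_def S_inf_UNIV
proof (intro exI[of _ "trig_torus ` {..<n}"] conjI)
  have inj: "inj trig_torus"
  proof (rule injI)
    fix i j assume "trig_torus i = trig_torus j"
    then show "i = j" using L2.e_orth[of i j] L2.e_orth[of j j] by (simp split: if_splits)
  qed
  then have inj': "inj_on trig_torus {..<n}" using inj_on_subset by blast
  show "finite (trig_torus ` {..<n})" by simp
  show "card (trig_torus ` {..<n}) = n" using inj' by (simp add: card_image)
  have in_span: "\<exists>c. b = (\<Sum>i<n. c i *\<^sub>R trig_torus i)" if b: "b \<in> span (trig_torus ` {..<n})" for b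
  proof -
    obtain u where "b = (\<Sum>v\<in>trig_torus ` {..<n}. u v *\<^sub>R v)"
      using b by (auto simp: span_finite)
    then have "b = (\<Sum>i<n. u (trig_torus i) *\<^sub>R trig_torus i)"
      using inj' by (simp add: sum.reindex)
    then show ?thesis by (intro exI[of _ "\<lambda>i. u (trig_torus i)"])
  qed
  have val: "inner_L2 (\<Sum>i<n. c i *\<^sub>R trig_torus i) (trig_torus j) = c j" if "j < n" for c j
  proof -
    have "(\<Sum>i<n. c i * inner_L2 (trig_torus i) (trig_torus j)) = (\<Sum>i<n. if i = j then c j else 0)"
      by (intro sum.cong) (auto simp: L2.e_orth)
    then show ?thesis using that by (simp add: inner_trig_sum)
  qed
  show "independent (trig_torus ` {..<n})"
  proof (rule independent_if_scalars_zero)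
    fix u v assume s: "(\<Sum>v\<in>trig_torus ` {..<n}. u v *\<^sub>R v) = 0" and "v \<in> trig_torus ` {..<n}"
    then obtain j where j: "j < n" "v = trig_torus j" by auto
    have "(\<Sum>i<n. u (trig_torus i) *\<^sub>R trig_torus i) = 0" using s inj' by (simp add: sum.reindex)
    then show "u v = 0" using val[OF j(1), of "\<lambda>i. u (trig_torus i)"] j(2) by simp
  qed simp
  show "trig_annihilator n \<inter> span (trig_torus ` {..<n}) = {0}"
  proof (intro equalityI subsetI)
    fix b assume b: "b \<in> trig_annihilator n \<inter> span (trig_torus ` {..<n})"
    then obtain c where c: "b = (\<Sum>i<n. c i *\<^sub>R trig_torus i)" using in_span by blast
    have "c j = 0" if "j < n" for j using b val[OF that, of c] that by (auto simp: c trig_annihilator_def)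
    then show "b \<in> {0}" by (simp add: c)
  next
    fix b :: torus assume "b \<in> {0}"
    then show "b \<in> trig_annihilator n \<inter> span (trig_torus ` {..<n})"
      using subspace_0[OF trig_annihilator_subspace] span_zero by auto
  qed
  show "{f + b |f b. f \<in> trig_annihilator n \<and> b \<in> span (trig_torus ` {..<n})} = UNIV"
  proof (intro equalityI subsetI)
    fix x :: torus
    let ?b = "\<Sum>i<n. inner_L2 x (trig_torus i) *\<^sub>R trig_torus i"
    have "x - ?b \<in> trig_annihilator n" by (simp add: trig_annihilator_def inner_trig_diff val)
    moreover have "?b \<in> span (trig_torus ` {..<n})" by (intro span_sum span_scale span_base) auto
    ultimately show "x \<in> {f + b |f b. f \<in> trig_annihilator n \<and> b \<in> span (trig_torus ` {..<n})}"
      by (intro CollectI exI[of _ "x - ?b"] exI[of _ ?b]) auto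
  qed simp
qed

lemma trig_annihilator_gelfand: "trig_annihilator n \<in> gelfand_subspaces n"
  using trig_annihilator_subspace trig_annihilator_closed trig_annihilator_codim
  by (simp add: gelfand_subspaces_def closed_subspace_def)

text \<open>
  If both the cosine and the sine of a frequency are among the first \<open>n\<close> functions, the whole Fourier
  coefficient of \<open>x\<close> vanishes, and so does that of the derivative. Both are needed, as the derivative
  of fractional order mixes cosine and sine.
\<close>

lemma sobolev_annihilator_coords:
  assumes r: "r > 0" and x: "x \<in> W2 r" "x \<in> trig_annihilator n" and j: "2 * freq (Suc j) < n"
  shows "inner_W2 r x (sob_basis r j) = 0"
proof -
  let ?m = "int (freq (Suc j))"
  have "fourier_coeff x ?m = 0"
  proof (rule trig_inner_zero_imp_fourier_zero)
    fix i assume "freq i = nat \<bar>?m\<bar>"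
    then have "i \<le> 2 * freq (Suc j)" by (simp add: freq_def)
    then show "inner_L2 x (trig_torus i) = 0" using j x(2) by (simp add: trig_annihilator_def)
  qed (simp add: Im_fourier_coeff_0)
  then have "fourier_coeff (weyl r x) ?m = 0" by (simp add: fourier_weyl(2)[OF x(1)])
  then show ?thesis unfolding inner_sob_basis[OF r] inner_trig[of _ "Suc j"] by simp
qed

text \<open>
  Split \<open>n + 1\<close> vectors along the complement spanned by \<open>B\<close>: their \<open>n + 1\<close> components in the
  \<open>n\<close>-dimensional span of \<open>B\<close> are linearly dependent, and the same combination of the vectors lies in \<open>F\<close>.
  The case of two equal components is separate, since dependence of a set of vectors ignores repetitions.
\<close>

lemma has_codim_codim_le:
  assumes F: "has_codim S_inf F n" "subspace F" and u: "\<forall>i\<le>n. u i \<in> W"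
    and W: "subspace W"
  shows "\<exists>c. (\<exists>i\<le>n. c i \<noteq> 0) \<and> (\<Sum>i\<le>n. c i *\<^sub>R u i) \<in> W \<inter> F"
proof -
  obtain B where B: "finite B" "card B = n" "{f + b |f b. f \<in> F \<and> b \<in> span B} = UNIV"
    using F(1) by (auto simp: has_codim_def S_inf_UNIV)
  have "\<exists>b. b \<in> span B \<and> u i - b \<in> F" for i
  proof -
    have "u i \<in> {f + b |f b. f \<in> F \<and> b \<in> span B}" using B(3) by simp
    then show ?thesis by force
  qed
  then obtain b where b: "\<And>i. b i \<in> span B" "\<And>i. u i - b i \<in> F" by metis
  have "\<exists>c. (\<exists>i\<le>n. c i \<noteq> 0) \<and> (\<Sum>i\<le>n. c i *\<^sub>R b i) = 0"
  proof (cases "inj_on b {..n}")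
    case True
    have "dependent (b ` {..n})"
    proof (rule ccontr)
      assume "independent (b ` {..n})"
      then have "card (b ` {..n}) \<le> card B"
        using independent_span_bound[OF B(1), of "b ` {..n}"] b(1) by auto
      then show False using True B(2) by (simp add: card_image)
    qed
    then obtain c where c: "\<exists>v\<in>b ` {..n}. c v \<noteq> 0" "(\<Sum>v\<in>b ` {..n}. c v *\<^sub>R v) = 0"
      by (auto simp: dependent_finite)
    then show ?thesis
      using True by (intro exI[of _ "\<lambda>i. c (b i)"]) (auto simp: sum.reindex)
  next
    case False
    then obtain i j where ij: "i \<le> n" "j \<le> n" "i \<noteq> j" "b i = b j" by (auto simp: inj_on_def)
    let ?c = "\<lambda>k. if k = i then 1 else if k = j then -1 else (0::real)"
    have "(\<Sum>k\<le>n. ?c k *\<^sub>R b k) = (\<Sum>k\<in>{i, j}. ?c k *\<^sub>R b k)"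
      using ij by (intro sum.mono_neutral_right) auto
    also have "\<dots> = 0" using ij by simp
    finally show ?thesis using ij by (intro exI[of _ ?c]) auto
  qed
  then obtain c where c: "\<exists>i\<le>n. c i \<noteq> 0" "(\<Sum>i\<le>n. c i *\<^sub>R b i) = 0" by blast
  have "(\<Sum>i\<le>n. c i *\<^sub>R u i) = (\<Sum>i\<le>n. c i *\<^sub>R (u i - b i))"
    using c(2) by (simp add: scaleR_diff_right sum_subtractf)
  then have "(\<Sum>i\<le>n. c i *\<^sub>R u i) \<in> F"
    using b(2) F(2) by (simp add: subspace_sum subspace_scale)
  moreover have "(\<Sum>i\<le>n. c i *\<^sub>R u i) \<in> W" using u W by (intro subspace_sum subspace_scale) auto
  ultimately show ?thesis using c(1) by blast
qed

section \<open>Elementary estimates\<close>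

text \<open>
  From \<open>ln (u\<^sup>2) \<le> u\<^sup>2 - 1\<close>. The right-hand side has the form of the summands that dominate exceedances
  of the threshold, so the same sum dominates \<open>p\<close>-th powers.
\<close>

lemma powr_le_exp_square:
  fixes u p :: real
  assumes "u > 0" "p > 0"
  shows "u powr p \<le> exp (p / 2 * (u\<^sup>2 - 1))"
proof -
  have "2 * ln u = ln (u\<^sup>2)" using assms by (simp add: ln_realpow)
  also have "\<dots> \<le> u\<^sup>2 - 1" using assms by (intro ln_le_minus_one) simp
  finally have "ln u \<le> (u\<^sup>2 - 1) / 2" by simp
  then have "p * ln u \<le> p * ((u\<^sup>2 - 1) / 2)" using assms by (intro mult_left_mono) auto
  then show ?thesis using assms by (simp add: powr_def mult.commute)
qed

lemma term_le_suminf: "f i \<le> (\<Sum>i. f i)" for f :: "nat \<Rightarrow> ennreal"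
  using sum_le_suminf[of f "{i}"] by simp

text \<open>
  With \<open>\<Lambda> = ln (n / \<delta>)\<close> the last bound is at most \<open>\<delta>\<^sup>2 / n\<close> up to a constant, since \<open>exp (- 2 * \<Lambda>)\<close> is
  \<open>(\<delta> / n)\<^sup>2\<close>: there is room for the \<open>1 + n\<close> effective coordinates.
\<close>

lemma log_ratio_bounds:
  assumes n: "n \<ge> 2" and \<delta>: "0 < \<delta>" "\<delta> \<le> 1 / 2"
  defines "\<Lambda> \<equiv> ln (real n / \<delta>)"
  shows "\<Lambda> \<ge> 1 / 2" "\<Lambda> > 0" "sqrt 2 * exp (- 2 * \<Lambda>) * (1 + real n) \<le> \<delta>"
proof -
  have nd: "real n / \<delta> \<ge> 4"
  proof -
    have "4 * \<delta> \<le> real n" using n \<delta> by linarith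
    then show ?thesis using \<delta> by (simp add: le_divide_eq)
  qed
  have one: "1 \<le> \<Lambda>"
  proof -
    have "exp 1 \<le> real n / \<delta>" using exp_le nd by linarith
    then show ?thesis unfolding \<Lambda>_def using nd by (subst ln_ge_iff) auto
  qed
  then show "\<Lambda> \<ge> 1 / 2" "\<Lambda> > 0" by auto
  show "sqrt 2 * exp (- 2 * \<Lambda>) * (1 + real n) \<le> \<delta>"
  proof -
    have "exp (- 2 * \<Lambda>) = (exp (- \<Lambda>))\<^sup>2" by (simp flip: exp_double)
    also have "exp (- \<Lambda>) = \<delta> / real n" unfolding \<Lambda>_def using nd \<delta> n by (simp add: exp_minus)
    finally have e: "exp (- 2 * \<Lambda>) = (\<delta> / real n)\<^sup>2" .
    have "sqrt 2 \<le> 3 / 2" by (intro real_le_lsqrt) (auto simp: power2_eq_square)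
    then have "sqrt 2 * ((\<delta> / real n)\<^sup>2 * (1 + real n)) \<le> 3 / 2 * ((\<delta> / real n)\<^sup>2 * (1 + real n))"
      by (rule mult_right_mono) simp
    also have "\<dots> = \<delta> * (3 / 2 * \<delta> * (1 + real n) / (real n)\<^sup>2)" by (simp add: power2_eq_square)
    finally have "sqrt 2 * ((\<delta> / real n)\<^sup>2 * (1 + real n)) \<le> \<delta> * (3 / 2 * \<delta> * (1 + real n) / (real n)\<^sup>2)" .
    moreover have "3 / 2 * \<delta> * (1 + real n) / (real n)\<^sup>2 \<le> 1"
    proof -
      have "3 / 2 * \<delta> * (1 + real n) \<le> 3 / 4 * (1 + real n)" using \<delta> by (intro mult_right_mono) auto
      also have "\<dots> \<le> 2 * real n" using n by simp
      also have "\<dots> \<le> (real n)\<^sup>2" using n by (simp add: power2_eq_square)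
      finally show ?thesis using n by (simp add: divide_le_eq)
    qed
    then have "\<delta> * (3 / 2 * \<delta> * (1 + real n) / (real n)\<^sup>2) \<le> \<delta> * 1"
      using \<delta> by (intro mult_left_mono) auto
    ultimately show ?thesis unfolding e mult.assoc by linarith
  qed
qed

lemma ennreal_root_le:
  assumes "a \<le> ennreal c" "c \<ge> 0" "p > 0" shows "ennreal_root p a \<le> ennreal (c powr (1 / p))"
proof -
  have top: "a \<noteq> \<infinity>" using assms(1) by (auto simp: top_unique)
  have "enn2real a \<le> c" using assms(1,2) by (rule enn2real_leI[rotated])
  then have "enn2real a powr (1 / p) \<le> c powr (1 / p)" using assms by (intro powr_mono2) auto
  then show ?thesis using top by (simp add: ennreal_root_def ennreal_leI)
qed

lemma ennreal_root_ge:
  assumes "ennreal c \<le> a" "c \<ge> 0" "p > 0" shows "ennreal (c powr (1 / p)) \<le> ennreal_root p a"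
proof (cases a)
  case (real d)
  then have "c \<le> d" using assms by (simp add: ennreal_le_iff)
  then have "c powr (1 / p) \<le> d powr (1 / p)" using assms by (intro powr_mono2) auto
  then show ?thesis using real by (simp add: ennreal_root_def ennreal_leI)
qed (simp add: ennreal_root_def)

text \<open>
  The two terms are those of \<open>joint_bound\<close> for a set of about \<open>n\<close> to the power \<open>1/6\<close> coordinates, each of
  which is large with probability at least \<open>K\<close> times \<open>n\<close> to the power \<open>-1/20\<close>; what matters is that
  \<open>1/20 < 1/6\<close>.
\<close>

lemma small_ball_asymptotics:
  fixes K :: real
  assumes "K > 0"
  shows "\<forall>\<^sub>F n in sequentially. sqrt 2 * real n powr (1/6) * exp (- ((real n powr (1/6) - 1)\<^sup>2 / 4))
     + exp (- (K * real n powr (-1/20) * (real n powr (1/6) - 1))) < 1 / 2"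
  using assms by real_asymp

lemma powr_double: "x powr (2 * r) = (x powr r)\<^sup>2" for x r :: real
proof -
  have "x powr (2 * r) = x powr (r + r)" by simp
  also have "\<dots> = x powr r * x powr r" by (rule powr_add)
  finally show ?thesis by (simp add: power2_eq_square)
qed

section \<open>Two-sided estimates for the widths\<close>

context
  fixes r \<rho> :: real and \<mu> :: "torus measure"
  assumes r: "r > 1 / 2" and \<rho>: "\<rho> > 0" and \<mu>: "gaussian_W2 r \<rho> \<mu>"
begin

lemma r0: "r > 0" using r by simp

interpretation G: gaussian_space "W2 r" "inner_W2 r" "sob_basis r" \<mu> "\<lambda>j. kap j powr - \<rho>"
  by (rule gaussian_space_W2[OF r0 \<rho> \<mu>])

lemma proj_W2_eq: "proj_W2 r M = G.proj M"
  by (simp add: fun_eq_iff proj_W2_def G.proj_def)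

lemma closed_subspace_iff: "closed_subspace (top_W2 r) M \<longleftrightarrow> G.closed_sub M"
  using top_W2_eq[OF r0 \<rho> \<mu>] by (simp add: closed_subspace_def G.closed_sub_def)

lemma borel_eq: "borel_W2 r = G.borel_V"
  by (rule borel_W2_eq[OF r0 \<rho> \<mu>])

lemma proj_measurable_mu:
  "G.closed_sub M \<Longrightarrow> G.proj M \<in> measurable \<mu> (restrict_space G.borel_V M)"
  using G.proj_measurable[of M] by (simp add: measurable_cong_sets[OF G.sets_mu refl])

lemma emeasure_on_subspace:
  assumes M: "G.closed_sub M" and A: "A \<in> sets G.borel_V"
  shows "emeasure (measure_on_subspace r \<mu> M) (A \<inter> M) = emeasure \<mu> {x \<in> W2 r. G.proj M x \<in> A}"
proof -
  have "A \<inter> M \<in> sets (restrict_space G.borel_V M)" using A by (auto simp: sets_restrict_space)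
  then have "emeasure (measure_on_subspace r \<mu> M) (A \<inter> M) = emeasure \<mu> (G.proj M -` (A \<inter> M) \<inter> space \<mu>)"
    unfolding measure_on_subspace_def proj_W2_eq borel_eq by (rule emeasure_distr[OF proj_measurable_mu[OF M]])
  also have "G.proj M -` (A \<inter> M) \<inter> space \<mu> = {x \<in> W2 r. G.proj M x \<in> A}"
    using G.proj_mem_orth(1)[OF M] by (auto simp: G.space_mu)
  finally show ?thesis .
qed

lemma proj_vimage_sets:
  assumes M: "G.closed_sub M" and A: "A \<in> sets G.borel_V"
  shows "{x \<in> W2 r. G.proj M x \<in> A} \<in> sets \<mu>"
proof -
  have "A \<inter> M \<in> sets (restrict_space G.borel_V M)" using A by (auto simp: sets_restrict_space)
  then have "G.proj M -` (A \<inter> M) \<inter> space \<mu> \<in> sets \<mu>"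
    by (rule measurable_sets[OF proj_measurable_mu[OF M]])
  moreover have "G.proj M -` (A \<inter> M) \<inter> space \<mu> = {x \<in> W2 r. G.proj M x \<in> A}"
    using G.proj_mem_orth(1)[OF M] by (auto simp: G.space_mu)
  ultimately show ?thesis by simp
qed

lemma nn_integral_on_subspace:
  assumes M: "G.closed_sub M" and f: "f \<in> borel_measurable G.borel_V"
  shows "(\<integral>\<^sup>+ x. f x \<partial>(measure_on_subspace r \<mu> M)) = (\<integral>\<^sup>+ x. f (G.proj M x) \<partial>\<mu>)"
  unfolding measure_on_subspace_def proj_W2_eq borel_eq
  by (rule nn_integral_distr[OF proj_measurable_mu[OF M]]) (simp add: measurable_restrict_space1[OF f])

lemma norm_S_le_nrm:
  assumes z: "z \<in> W2 r" shows "norm_S z \<le> G.nrm z"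
proof (rule norm_S_le_coords[OF r0 z])
  fix j
  have "kap j powr - r \<le> 1" using powr_mono[of "-r" 0 "kap j"] kap_ge_1[of j] r0 by simp
  then have "kap j powr - r * \<bar>inner_W2 r z (sob_basis r j)\<bar> \<le> \<bar>inner_W2 r z (sob_basis r j)\<bar>"
    using mult_right_mono[of "kap j powr - r" 1 "\<bar>inner_W2 r z (sob_basis r j)\<bar>"] by simp
  also have "\<dots> \<le> G.nrm z * G.nrm (sob_basis r j)" using z by (intro G.abs_ip_le) auto
  also have "\<dots> = G.nrm z" using G.e_orth[of j j] by (simp add: G.nrm_def)
  finally show "kap j powr - r * \<bar>inner_W2 r z (sob_basis r j)\<bar> \<le> G.nrm z" .
qed

lemma norm_S_measurable: "norm_S \<in> borel_measurable G.borel_V"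
proof (rule G.lipschitz_measurable)
  fix x y assume xy: "x \<in> W2 r" "y \<in> W2 r"
  have "\<bar>norm_S x - norm_S y\<bar> \<le> norm_S (x - y)"
    using norm_S_triangle[of "x - y" y] norm_S_triangle[of "y - x" x] norm_S_minus_commute[of x y] by simp
  also have "\<dots> \<le> 1 * G.nrm (x - y)" using norm_S_le_nrm[of "x - y"] xy by simp
  finally show "\<bar>norm_S x - norm_S y\<bar> \<le> 1 * G.nrm (x - y)" .
qed

text \<open>
  The Hilbert norm dominates the norm of \<open>S\<^sub>\<infinity>\<close>, so the Sobolev space carries the finer topology.
\<close>

lemma sobolev_part_closed_sub:
  assumes F: "closed_subspace top_S F" shows "G.closed_sub (W2 r \<inter> F)"
proof -
  have sub: "subspace F" and cl: "closedin S.mtopology F" using F by (auto simp: closed_subspace_def top_S_eq)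
  have "closedin G.M.mtopology (W2 r \<inter> F)"
    unfolding G.M.closedin_metric
  proof (intro conjI allI impI)
    fix x assume x: "x \<in> W2 r - W2 r \<inter> F"
    then obtain \<epsilon> where \<epsilon>: "\<epsilon> > 0" "disjnt F (S.mball x \<epsilon>)" using cl by (auto simp: S.closedin_metric)
    have "y \<in> S.mball x \<epsilon>" if "y \<in> G.M.mball x \<epsilon>" for y
      using that norm_S_le_nrm[of "x - y"] x by (auto simp: S.in_mball G.M.in_mball)
    then show "\<exists>\<epsilon>>0. disjnt (W2 r \<inter> F) (G.M.mball x \<epsilon>)"
      using \<epsilon> by (intro exI[of _ \<epsilon>]) (auto simp: disjnt_iff)
  qed auto
  then show ?thesis using sub W2_subspace by (simp add: G.closed_sub_def subspace_inter)
qed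

lemma sobolev_part_codim:
  assumes F: "F \<in> gelfand_subspaces n" shows "G.codim_le n (W2 r \<inter> F)"
  unfolding G.codim_le_def
proof (intro allI impI)
  fix u assume u: "\<forall>i\<le>n. u i \<in> W2 r"
  show "\<exists>c. (\<exists>i\<le>n. c i \<noteq> 0) \<and> (\<Sum>i\<le>n. c i *\<^sub>R u i) \<in> W2 r \<inter> F"
    by (rule has_codim_codim_le[OF _ _ u W2_subspace])
       (use F in \<open>simp_all add: gelfand_subspaces_def closed_subspace_def\<close>)
qed

subsection \<open>Upper bounds\<close>

text \<open>
  The threshold for the norm. With \<open>\<nu> = (n + 1) div 2\<close>, the lowest frequency that the annihilator of the
  first \<open>n\<close> trigonometric functions leaves, \<open>\<nu>\<close> to the power \<open>-(r + \<rho>/2)\<close> is the standard deviation of the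
  weighted coordinates at frequency \<open>\<nu>\<close>; the factor \<open>4\<close> leaves room for summing over all frequencies.
\<close>

definition radius :: "nat \<Rightarrow> real \<Rightarrow> real" where
  "radius n \<Lambda> = 4 * real ((n + 1) div 2) powr - (\<rho> / 2) * real ((n + 1) div 2) powr - r * sqrt \<Lambda>"

text \<open>
  The first index of frequency \<open>(n + 1) div 2\<close>.
\<close>

definition cut :: "nat \<Rightarrow> nat" where "cut n = 2 * ((n + 1) div 2 - 1)"

text \<open>
  The common majorant of the upper bounds. With \<open>\<nu>\<close> as in \<open>radius\<close>, a weighted coordinate has
  absolute value \<open>u\<close> times the radius exactly if the exponent of its summand is \<open>q * (u\<^sup>2 - 1)\<close>, where
  \<open>q = 4 * \<Lambda> * (k / \<nu>)\<close> to the power \<open>2 * r\<close> for the frequency \<open>k\<close>. Hence a summand is at least \<open>1\<close> as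
  soon as its coordinate exceeds the radius, and the larger \<open>u\<close> is, the larger it becomes; at the
  same time the expectation of the sum is small.
\<close>

definition excess :: "nat \<Rightarrow> real \<Rightarrow> torus \<Rightarrow> ennreal" where
  "excess n \<Lambda> z = (\<Sum>i. ennreal (exp ((inner_W2 r z (sob_basis r (cut n + i)))\<^sup>2
      / (4 * (real ((n + 1) div 2) powr - (\<rho> / 2))\<^sup>2)
      - 4 * \<Lambda> * (kap (cut n + i) / real ((n + 1) div 2)) powr (2 * r))))"

lemma kap_ge_cut: "n \<ge> 1 \<Longrightarrow> j \<ge> cut n \<Longrightarrow> kap j \<ge> real ((n + 1) div 2)"
proof -
  assume "n \<ge> 1" "j \<ge> cut n"
  then have "(n + 1) div 2 \<le> freq (Suc j)" unfolding cut_def freq_def by presburger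
  then show ?thesis by (simp add: kap_def)
qed

lemma excess_integral:
  assumes n: "n \<ge> 1" and \<Lambda>: "\<Lambda> \<ge> 1 / 2" and M: "G.closed_sub M" "M \<subseteq> G.tail_space (cut n)"
  shows "(\<integral>\<^sup>+ x. excess n \<Lambda> (G.proj M x) \<partial>\<mu>) \<le> ennreal (sqrt 2 * exp (- 2 * \<Lambda>) * (1 + real n))"
proof -
  let ?\<nu> = "(n + 1) div 2"
  have \<nu>: "?\<nu> \<ge> 1" "?\<nu> \<le> n" using n by auto
  have "(\<integral>\<^sup>+ x. excess n \<Lambda> (G.proj M x) \<partial>\<mu>)
     \<le> (\<Sum>i. ennreal (sqrt 2 * exp (- (4 * \<Lambda> * (kap (cut n + i) / real ?\<nu>) powr (2 * r)))))"
    unfolding excess_def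
  proof (rule G.tail_exp_sum[OF M])
    show "0 < real ?\<nu> powr - (\<rho> / 2)" using \<nu> by simp
    fix j assume "j \<ge> cut n"
    then have "kap j powr - \<rho> \<le> real ?\<nu> powr - \<rho>"
      using kap_ge_cut[OF n] \<nu>(1) \<rho> by (intro powr_mono2') auto
    also have "\<dots> = (real ?\<nu> powr - (\<rho> / 2))\<^sup>2" by (simp flip: powr_double)
    finally show "kap j powr - \<rho> \<le> (real ?\<nu> powr - (\<rho> / 2))\<^sup>2" .
  qed
  also have "\<dots> \<le> ennreal (sqrt 2 * exp (- 2 * \<Lambda>) * (1 + real ?\<nu>))"
    unfolding cut_def by (rule tail_sum_bound[OF \<nu>(1) \<Lambda> r])
  also have "\<dots> \<le> ennreal (sqrt 2 * exp (- 2 * \<Lambda>) * (1 + real n))"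
    using \<nu>(2) by (intro ennreal_leI mult_left_mono) auto
  finally show ?thesis .
qed

text \<open>
  Substituting the radius in the exponent of the \<open>j\<close>-th summand gives \<open>q * (u\<^sup>2 - 1)\<close>; the frequencies in the
  tail are at least \<open>\<nu>\<close>, so \<open>q \<ge> 4 * \<Lambda>\<close>.
\<close>

lemma excess_ge:
  assumes n: "n \<ge> 1" and \<Lambda>: "\<Lambda> > 0" and z: "z \<in> G.tail_space (cut n)"
    and u: "u = kap j powr - r * \<bar>inner_W2 r z (sob_basis r j)\<bar> / radius n \<Lambda>" "u > 1"
  shows "\<exists>q\<ge>4 * \<Lambda>. ennreal (exp (q * (u\<^sup>2 - 1))) \<le> excess n \<Lambda> z"
proof -
  let ?\<nu> = "real ((n + 1) div 2)" and ?\<xi> = "inner_W2 r z (sob_basis r j)"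
  have \<nu>: "?\<nu> > 0" using n by simp
  have rad: "radius n \<Lambda> > 0" using \<nu> \<Lambda> by (simp add: radius_def)
  have "?\<xi> \<noteq> 0" using u by auto
  then have j: "cut n \<le> j" using z unfolding G.tail_space_def by (metis (mono_tags, lifting) linorder_not_le mem_Collect_eq)
  obtain i where i: "j = cut n + i" using le_Suc_ex[OF j] by blast
  define q where "q = 4 * \<Lambda> * (kap j / ?\<nu>) powr (2 * r)"
  have "1 \<le> kap j / ?\<nu>" using kap_ge_cut[OF n j] \<nu> by simp
  then have "1 \<le> (kap j / ?\<nu>) powr (2 * r)" using r by (intro ge_one_powr_ge_zero) auto
  then have q: "q \<ge> 4 * \<Lambda>" using \<Lambda> mult_left_mono[of 1 "(kap j / ?\<nu>) powr (2 * r)" "4 * \<Lambda>"] by (simp add: q_def)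
  have rad2: "(radius n \<Lambda>)\<^sup>2 = 16 * (?\<nu> powr - (\<rho> / 2))\<^sup>2 * (?\<nu> powr - r)\<^sup>2 * \<Lambda>"
    using \<Lambda> by (simp add: radius_def power_mult_distrib)
  have q2: "q = 4 * \<Lambda> * ((kap j powr r)\<^sup>2 * (?\<nu> powr - r)\<^sup>2)"
  proof -
    have "(kap j / ?\<nu>) powr r = kap j powr r * ?\<nu> powr - r"
      using \<nu> less_imp_le[OF kap_pos[of j]] by (simp only: powr_divide powr_minus_divide times_divide_eq_right mult_1_right of_nat_0_le_iff)
    then show ?thesis unfolding q_def powr_double by (simp only: power_mult_distrib)
  qed
  have kk: "kap j powr r * kap j powr - r = 1" by (simp flip: powr_add)
  have "q * u\<^sup>2 = q * (kap j powr - r)\<^sup>2 * ?\<xi>\<^sup>2 / (radius n \<Lambda>)\<^sup>2"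
    by (simp add: u(1) power_mult_distrib power_divide)
  also have "q * (kap j powr - r)\<^sup>2 = 4 * \<Lambda> * (?\<nu> powr - r)\<^sup>2 * (kap j powr r * kap j powr - r)\<^sup>2"
    unfolding q2 by (simp add: power_mult_distrib)
  also have "4 * \<Lambda> * (?\<nu> powr - r)\<^sup>2 * (kap j powr r * kap j powr - r)\<^sup>2 * ?\<xi>\<^sup>2 / (radius n \<Lambda>)\<^sup>2
      = ?\<xi>\<^sup>2 / (4 * (?\<nu> powr - (\<rho> / 2))\<^sup>2)"
  proof -
    have cancel: "4 * \<Lambda> * A\<^sup>2 * 1\<^sup>2 * ?\<xi>\<^sup>2 / (16 * B\<^sup>2 * A\<^sup>2 * \<Lambda>) = ?\<xi>\<^sup>2 / (4 * B\<^sup>2)" if "A > 0" "B > 0" for A B :: real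
      using that \<Lambda> by (simp add: field_simps)
    show ?thesis unfolding kk rad2 by (rule cancel) (use \<nu> in simp_all)
  qed
  finally have eq: "q * (u\<^sup>2 - 1) = ?\<xi>\<^sup>2 / (4 * (?\<nu> powr - (\<rho> / 2))\<^sup>2) - q"
    by (simp add: right_diff_distrib)
  have "ennreal (exp (q * (u\<^sup>2 - 1))) = ennreal (exp ((inner_W2 r z (sob_basis r (cut n + i)))\<^sup>2
      / (4 * (?\<nu> powr - (\<rho> / 2))\<^sup>2) - 4 * \<Lambda> * (kap (cut n + i) / ?\<nu>) powr (2 * r)))"
    unfolding eq unfolding q_def i ..
  also have "\<dots> \<le> excess n \<Lambda> z"
    unfolding excess_def by (rule term_le_suminf)
  finally show ?thesis using q by blast
qed

lemma radius_pos: "n \<ge> 1 \<Longrightarrow> \<Lambda> > 0 \<Longrightarrow> radius n \<Lambda> > 0"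
  by (simp add: radius_def)

lemma excess_ge_1:
  assumes n: "n \<ge> 1" and \<Lambda>: "\<Lambda> > 0" and z: "z \<in> G.tail_space (cut n)" and big: "radius n \<Lambda> < norm_S z"
  shows "1 \<le> excess n \<Lambda> z"
proof -
  have zW: "z \<in> W2 r" using z by (simp add: G.tail_space_def)
  obtain j where "radius n \<Lambda> < kap j powr - r * \<bar>inner_W2 r z (sob_basis r j)\<bar>"
    using norm_S_le_coords[OF r0 zW, of "radius n \<Lambda>"] big by (meson not_le)
  moreover define u where "u = kap j powr - r * \<bar>inner_W2 r z (sob_basis r j)\<bar> / radius n \<Lambda>"
  ultimately have u: "u > 1" using radius_pos[OF n \<Lambda>] by simp
  obtain q where q: "q \<ge> 4 * \<Lambda>" "ennreal (exp (q * (u\<^sup>2 - 1))) \<le> excess n \<Lambda> z"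
    using excess_ge[OF n \<Lambda> z u_def u] by blast
  have "0 \<le> u\<^sup>2 - 1" using power_mono[of 1 u 2] u by simp
  then have "0 \<le> q * (u\<^sup>2 - 1)" using q(1) \<Lambda> by (intro mult_nonneg_nonneg) linarith+
  then have "ennreal 1 \<le> ennreal (exp (q * (u\<^sup>2 - 1)))"
    by (intro ennreal_leI) (simp only: one_le_exp_iff)
  then have "ennreal 1 \<le> excess n \<Lambda> z" using q(2) by (rule order_trans)
  then show ?thesis by simp
qed

text \<open>
  If the largest weighted coordinate is \<open>u > 1\<close> times the radius, then \<open>u\<close> to the power \<open>p\<close> is at most
  \<open>exp (p / 2 * (u\<^sup>2 - 1))\<close>, which its summand dominates as long as \<open>p / 2 \<le> 4 * \<Lambda>\<close>; the summand \<open>1\<close> covers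
  the elements inside the radius.
\<close>

lemma norm_powr_le_excess:
  assumes n: "n \<ge> 1" and \<Lambda>: "\<Lambda> > 0" and z: "z \<in> G.tail_space (cut n)" and p: "p > 0" "p / 2 \<le> 4 * \<Lambda>"
  shows "ennreal (norm_S z powr p) \<le> ennreal (radius n \<Lambda> powr p) * (1 + excess n \<Lambda> z)"
proof (cases "excess n \<Lambda> z")
  case top
  then show ?thesis using radius_pos[OF n \<Lambda>] by (simp add: ennreal_mult_top)
next
  case (real d)
  have zW: "z \<in> W2 r" using z by (simp add: G.tail_space_def)
  define R where "R = radius n \<Lambda>"
  have R: "R > 0" using radius_pos[OF n \<Lambda>] by (simp add: R_def)
  have "norm_S z \<le> R * max 1 (d powr (1 / p))"
  proof (rule norm_S_le_coords[OF r0 zW])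
    fix j
    define u where "u = kap j powr - r * \<bar>inner_W2 r z (sob_basis r j)\<bar> / R"
    have "u \<le> max 1 (d powr (1 / p))"
    proof (cases "u > 1")
      case True
      obtain q where q: "q \<ge> 4 * \<Lambda>" "ennreal (exp (q * (u\<^sup>2 - 1))) \<le> excess n \<Lambda> z"
        using excess_ge[OF n \<Lambda> z u_def[unfolded R_def] True] by blast
      have u2: "u\<^sup>2 - 1 \<ge> 0" using power_mono[of 1 u 2] True by simp
      have "u powr p \<le> exp (p / 2 * (u\<^sup>2 - 1))" using True p by (intro powr_le_exp_square) auto
      also have "\<dots> \<le> exp (q * (u\<^sup>2 - 1))"
        using mult_right_mono[OF _ u2, of "p / 2" q] q(1) p by simp
      also have "\<dots> \<le> d" using q(2) real by (simp add: ennreal_le_iff)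
      finally have "(u powr p) powr (1 / p) \<le> d powr (1 / p)" using p by (intro powr_mono2) auto
      then show ?thesis using p True by (simp add: powr_powr)
    qed auto
    then have "R * u \<le> R * max 1 (d powr (1 / p))" using R by (intro mult_left_mono) auto
    then show "kap j powr - r * \<bar>inner_W2 r z (sob_basis r j)\<bar> \<le> R * max 1 (d powr (1 / p))"
      using R by (simp add: u_def)
  qed
  then have "norm_S z powr p \<le> (R * max 1 (d powr (1 / p))) powr p" using p by (intro powr_mono2) auto
  also have "\<dots> = R powr p * max 1 (d powr (1 / p)) powr p" using R by (simp add: powr_mult)
  also have "max 1 (d powr (1 / p)) powr p \<le> 1 + d"
  proof (cases "d powr (1 / p) \<le> 1")
    case True then show ?thesis using real(1) by simp
  next
    case False then show ?thesis using real(1) p by (simp add: powr_powr)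
  qed
  finally have "norm_S z powr p \<le> R powr p * (1 + d)" by (simp add: mult_left_mono)
  then have "ennreal (norm_S z powr p) \<le> ennreal (R powr p * (1 + d))" by (rule ennreal_leI)
  also have "\<dots> = ennreal (R powr p) * (1 + excess n \<Lambda> z)"
    using real(1) by (simp add: real(2) ennreal_mult)
  finally show ?thesis unfolding R_def .
qed

text \<open>
  The first \<open>n\<close> functions contain the cosine and the sine of every frequency below \<open>(n + 1) div 2\<close>.
\<close>

lemma annihilator_tail: "W2 r \<inter> trig_annihilator n \<subseteq> G.tail_space (cut n)"
proof
  fix x assume x: "x \<in> W2 r \<inter> trig_annihilator n"
  have "inner_W2 r x (sob_basis r j) = 0" if "j < cut n" for j
  proof -
    have "freq (Suc j) = j div 2 + 1" by (simp add: freq_def)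
    moreover have "j div 2 < (n + 1) div 2 - 1"
      using that by (intro less_mult_imp_div_less) (simp add: cut_def mult.commute)
    moreover have "2 * ((n + 1) div 2) \<le> n + 1" by simp
    ultimately have "2 * freq (Suc j) < n" by linarith
    then show ?thesis using x by (intro sobolev_annihilator_coords[OF r0, of x n]) auto
  qed
  then show "x \<in> G.tail_space (cut n)" using x by (simp add: G.tail_space_def)
qed

lemma tail_space_sets: "G.tail_space J \<in> sets G.borel_V"
proof -
  have [measurable]: "(\<lambda>x. inner_W2 r x (sob_basis r j)) \<in> borel_measurable G.borel_V" for j
    by (rule G.ip_measurable) simp
  have "{x \<in> space G.borel_V. \<forall>j\<in>{..<J}. inner_W2 r x (sob_basis r j) = 0} \<in> sets G.borel_V" by measurable
  also have "{x \<in> space G.borel_V. \<forall>j\<in>{..<J}. inner_W2 r x (sob_basis r j) = 0} = G.tail_space J"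
    by (auto simp: G.tail_space_def)
  finally show ?thesis .
qed

text \<open>
  The elements of the tail space with norm above the radius form an exceptional set \<open>E\<close>: for \<open>M\<close> inside
  the tail space \<open>excess\<close> dominates the indicator of \<open>E\<close>, and for other \<open>M\<close> almost no \<open>P\<^sub>M x\<close> lies in the tail
  space at all. The condition on \<open>\<mu>\<close> itself is the case \<open>M = W\<close>.
\<close>

lemma prob_width_upper:
  assumes n: "n \<ge> 2" and \<delta>: "0 < \<delta>" "\<delta> \<le> 1 / 2"
  shows "prob_gelfand_width r \<mu> n \<delta> \<le> ennreal (radius n (ln (real n / \<delta>)))"
proof -
  define \<Lambda> where "\<Lambda> = ln (real n / \<delta>)"
  note \<Lambda> = log_ratio_bounds(1,2)[OF n \<delta>, folded \<Lambda>_def] and small = log_ratio_bounds(3)[OF n \<delta>, folded \<Lambda>_def]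
  define E where "E = {x \<in> G.tail_space (cut n). radius n \<Lambda> < norm_S x}"
  have E_sets: "E \<in> sets G.borel_V"
  proof -
    have "{x \<in> space G.borel_V. radius n \<Lambda> < norm_S x} \<in> sets G.borel_V"
      using norm_S_measurable by measurable
    then have "G.tail_space (cut n) \<inter> {x \<in> space G.borel_V. radius n \<Lambda> < norm_S x} \<in> sets G.borel_V"
      by (rule sets.Int[OF tail_space_sets])
    moreover have "G.tail_space (cut n) \<inter> {x \<in> space G.borel_V. radius n \<Lambda> < norm_S x} = E"
      by (auto simp: E_def G.tail_space_def)
    ultimately show ?thesis by simp
  qed
  have bound: "emeasure \<mu> {x \<in> W2 r. G.proj M x \<in> E} \<le> ennreal \<delta>" if M: "G.closed_sub M" for M
  proof (cases "M \<subseteq> G.tail_space (cut n)")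
    case False
    have ts: "{x \<in> W2 r. G.proj M x \<in> G.tail_space (cut n)} \<in> sets \<mu>"
      by (rule proj_vimage_sets[OF M tail_space_sets])
    have "emeasure \<mu> {x \<in> W2 r. G.proj M x \<in> E} \<le> emeasure \<mu> {x \<in> W2 r. G.proj M x \<in> G.tail_space (cut n)}"
      by (rule emeasure_mono[OF _ ts]) (auto simp: E_def)
    then show ?thesis using G.tail_space_null[OF M False] by simp
  next
    case True
    have Em: "{x \<in> W2 r. G.proj M x \<in> E} \<in> sets \<mu>"
      by (rule proj_vimage_sets[OF M E_sets])
    have "emeasure \<mu> {x \<in> W2 r. G.proj M x \<in> E} = (\<integral>\<^sup>+ x. indicator {x \<in> W2 r. G.proj M x \<in> E} x \<partial>\<mu>)"
      using Em by simp
    also have "\<dots> \<le> (\<integral>\<^sup>+ x. excess n \<Lambda> (G.proj M x) \<partial>\<mu>)"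
    proof (rule nn_integral_mono)
      fix x
      show "indicator {x \<in> W2 r. G.proj M x \<in> E} x \<le> excess n \<Lambda> (G.proj M x)"
        using excess_ge_1[of n \<Lambda> "G.proj M x"] n \<Lambda> by (auto simp: indicator_def E_def)
    qed
    also have "\<dots> \<le> ennreal (sqrt 2 * exp (- 2 * \<Lambda>) * (1 + real n))"
      using n by (intro excess_integral \<Lambda> M True) auto
    also have "\<dots> \<le> ennreal \<delta>" using small by (rule ennreal_leI)
    finally show ?thesis .
  qed
  have W: "G.closed_sub (W2 r)"
    using W2_subspace closedin_topspace[of G.M.mtopology] by (simp add: G.closed_sub_def)
  have projW: "G.proj (W2 r) x = x" if "x \<in> W2 r" for x
    using that by (intro G.proj_eqI[OF W]) auto
  have "{x \<in> W2 r. G.proj (W2 r) x \<in> E} = E"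
    using projW by (auto simp: E_def G.tail_space_def)
  then have \<mu>E: "emeasure \<mu> E \<le> ennreal \<delta>" using bound[OF W] by simp
  have "0 \<notin> E" using radius_pos[of n \<Lambda>] n \<Lambda> by (simp add: E_def)
  then have Eex: "E \<in> exceptional_sets r \<mu> \<delta>"
    using \<mu>E E_sets bound by (auto simp: exceptional_sets_def borel_eq closed_subspace_iff emeasure_on_subspace)
  have "prob_gelfand_width r \<mu> n \<delta> \<le> (SUP x\<in>(W2 r - E) \<inter> trig_annihilator n. ennreal (norm_S x))"
    unfolding prob_gelfand_width_def
    by (rule INF_lower2[OF Eex], rule INF_lower2[OF trig_annihilator_gelfand]) simp
  also have "\<dots> \<le> ennreal (radius n \<Lambda>)"
  proof (rule SUP_least)
    fix x assume "x \<in> (W2 r - E) \<inter> trig_annihilator n"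
    then have "x \<in> G.tail_space (cut n)" "x \<notin> E" using annihilator_tail by auto
    then show "ennreal (norm_S x) \<le> ennreal (radius n \<Lambda>)" by (auto simp: E_def intro: ennreal_leI)
  qed
  finally show ?thesis by (simp add: \<Lambda>_def)
qed

lemma excess_measurable: "excess n \<Lambda> \<in> borel_measurable G.borel_V"
proof -
  have [measurable]: "(\<lambda>x. inner_W2 r x (sob_basis r j)) \<in> borel_measurable G.borel_V" for j
    by (rule G.ip_measurable) simp
  show ?thesis unfolding excess_def[abs_def] by measurable
qed

text \<open>
  Here \<open>\<delta> = 1/2\<close> is taken only to fix \<open>\<Lambda> = ln (2 * n)\<close>; then the expectation of \<open>excess\<close> is at most one.
\<close>

lemma avg_width_upper:
  assumes n: "n \<ge> 2" and p: "p > 0" "p / 2 \<le> 4 * ln (real n / (1 / 2))"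
  shows "avg_gelfand_width r \<mu> n p \<le> ennreal (2 powr (1 / p) * radius n (ln (real n / (1 / 2))))"
proof -
  define \<Lambda> where "\<Lambda> = ln (real n / (1 / 2))"
  have d: "0 < (1 / 2 :: real)" "(1 / 2 :: real) \<le> 1 / 2" by auto
  note \<Lambda> = log_ratio_bounds(1,2)[OF n d, folded \<Lambda>_def] and small = log_ratio_bounds(3)[OF n d, folded \<Lambda>_def]
  define R where "R = radius n \<Lambda>"
  have n1: "n \<ge> 1" using n by simp
  have R: "R > 0" unfolding R_def by (rule radius_pos[OF n1 \<Lambda>(2)])
  define M where "M = W2 r \<inter> trig_annihilator n"
  have M: "G.closed_sub M" unfolding M_def
    using trig_annihilator_gelfand[of n] by (intro sobolev_part_closed_sub) (simp add: gelfand_subspaces_def)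
  have MT: "M \<subseteq> G.tail_space (cut n)" unfolding M_def by (rule annihilator_tail)
  have m: "(\<lambda>x. excess n \<Lambda> (G.proj M x)) \<in> borel_measurable \<mu>"
    by (rule measurable_compose[OF proj_measurable_mu[OF M] measurable_restrict_space1[OF excess_measurable]])
  have "(\<lambda>z. ennreal (norm_S z powr p)) \<in> borel_measurable G.borel_V"
    using norm_S_measurable by measurable
  then have "(\<integral>\<^sup>+ x. ennreal (norm_S x powr p) \<partial>(measure_on_subspace r \<mu> M))
      = (\<integral>\<^sup>+ x. ennreal (norm_S (G.proj M x) powr p) \<partial>\<mu>)"
    by (rule nn_integral_on_subspace[OF M])
  also have "\<dots> \<le> (\<integral>\<^sup>+ x. ennreal (R powr p) * (1 + excess n \<Lambda> (G.proj M x)) \<partial>\<mu>)"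
  proof (rule nn_integral_mono)
    fix x assume "x \<in> space \<mu>"
    then have "G.proj M x \<in> G.tail_space (cut n)"
      using G.proj_mem_orth(1)[OF M] MT by (auto simp: G.space_mu)
    then show "ennreal (norm_S (G.proj M x) powr p) \<le> ennreal (R powr p) * (1 + excess n \<Lambda> (G.proj M x))"
      unfolding R_def using p by (intro norm_powr_le_excess[OF n1 \<Lambda>(2)]) (simp_all add: \<Lambda>_def)
  qed
  also have "\<dots> = ennreal (R powr p) * (\<integral>\<^sup>+ x. 1 + excess n \<Lambda> (G.proj M x) \<partial>\<mu>)"
    using m by (intro nn_integral_cmult) measurable
  also have "(\<integral>\<^sup>+ x. 1 + excess n \<Lambda> (G.proj M x) \<partial>\<mu>) = (\<integral>\<^sup>+ x. 1 \<partial>\<mu>) + (\<integral>\<^sup>+ x. excess n \<Lambda> (G.proj M x) \<partial>\<mu>)"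
    using m by (intro nn_integral_add) auto
  also have "(\<integral>\<^sup>+ x. 1 \<partial>\<mu>) = 1" by (simp add: G.emeasure_space_1)
  finally have "(\<integral>\<^sup>+ x. ennreal (norm_S x powr p) \<partial>(measure_on_subspace r \<mu> M))
      \<le> ennreal (R powr p) * (1 + (\<integral>\<^sup>+ x. excess n \<Lambda> (G.proj M x) \<partial>\<mu>))" .
  also have "\<dots> \<le> ennreal (R powr p) * (1 + ennreal 1)"
  proof (intro mult_left_mono add_left_mono)
    have "(\<integral>\<^sup>+ x. excess n \<Lambda> (G.proj M x) \<partial>\<mu>) \<le> ennreal (sqrt 2 * exp (- 2 * \<Lambda>) * (1 + real n))"
      by (rule excess_integral[OF n1 \<Lambda>(1) M MT])
    also have "\<dots> \<le> ennreal 1" using small by (intro ennreal_leI) linarith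
    finally show "(\<integral>\<^sup>+ x. excess n \<Lambda> (G.proj M x) \<partial>\<mu>) \<le> ennreal 1" .
  qed simp
  also have "\<dots> = ennreal (R powr p * 2)" by (simp add: ennreal_mult)
  finally have "ennreal_root p (\<integral>\<^sup>+ x. ennreal (norm_S x powr p) \<partial>(measure_on_subspace r \<mu> M))
      \<le> ennreal ((R powr p * 2) powr (1 / p))"
    using p by (intro ennreal_root_le) auto
  also have "(R powr p * 2) powr (1 / p) = 2 powr (1 / p) * R"
    using R p by (simp add: powr_mult powr_powr)
  finally show ?thesis
    unfolding avg_gelfand_width_def M_def R_def \<Lambda>_def
    by (intro INF_lower2[OF trig_annihilator_gelfand])
qed

lemma radius_le:
  assumes n: "n \<ge> 1" and \<Lambda>: "\<Lambda> \<ge> 0"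
  shows "radius n \<Lambda> \<le> 4 * 2 powr (r + \<rho> / 2) * (real n powr - (r + \<rho> / 2) * sqrt \<Lambda>)"
proof -
  let ?\<nu> = "real ((n + 1) div 2)"
  have \<nu>: "real n / 2 \<le> ?\<nu>" by linarith
  have "?\<nu> powr - (\<rho> / 2) * ?\<nu> powr - r = ?\<nu> powr (- (\<rho> / 2) + - r)" by (rule powr_add[symmetric])
  also have "- (\<rho> / 2) + - r = - (r + \<rho> / 2)" by simp
  also have "?\<nu> powr - (r + \<rho> / 2) \<le> (real n / 2) powr - (r + \<rho> / 2)"
    using \<nu> n r \<rho> by (intro powr_mono2') auto
  also have "(real n / 2) powr - (r + \<rho> / 2) = 2 powr (r + \<rho> / 2) * real n powr - (r + \<rho> / 2)"
  proof -
    have "(real n / 2) powr - s = 2 powr s * real n powr - s" for s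
      unfolding powr_divide powr_minus[of 2 s] by (simp add: divide_inverse)
    then show ?thesis .
  qed
  finally have "4 * (?\<nu> powr - (\<rho> / 2) * ?\<nu> powr - r) * sqrt \<Lambda>
      \<le> 4 * (2 powr (r + \<rho> / 2) * real n powr - (r + \<rho> / 2)) * sqrt \<Lambda>"
    using \<Lambda> by (intro mult_right_mono mult_left_mono) auto
  then show ?thesis by (simp only: radius_def mult.assoc)
qed

subsection \<open>Lower bounds\<close>

text \<open>
  The constant is chosen such that, by \<open>low_scaled\<close>, a norm below \<open>low n \<Lambda>\<close> forces every coordinate of the
  block \<open>4 * n \<le> i < 8 * n\<close> below \<open>sqrt (\<Lambda> / 320)\<close> times the smallest standard deviation in the block. After
  the factor \<open>2\<close> from the diagonal entries this contributes the exponent \<open>\<Lambda> / 80\<close> to a single normal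
  tail, so for \<open>\<Lambda> \<le> 2 * ln n\<close> the tail decays more slowly than the number of usable coordinates grows.
\<close>

definition low :: "nat \<Rightarrow> real \<Rightarrow> real" where
  "low n \<Lambda> = 1 / (sqrt 2 * sqrt 320 * 4 powr (r + \<rho> / 2)) * (real n powr - (r + \<rho> / 2) * sqrt \<Lambda>)"

lemma low_nonneg: "\<Lambda> \<ge> 0 \<Longrightarrow> low n \<Lambda> \<ge> 0"
  by (simp add: low_def)

lemma block_kap:
  assumes "i \<in> {4 * n..<8 * n}" shows "2 * real n \<le> kap i" "kap i \<le> 4 * real n"
proof -
  have "freq (Suc i) = i div 2 + 1" by (simp add: freq_def)
  moreover have "2 * n \<le> i div 2" "i div 2 < 4 * n" using assms by auto
  ultimately show "2 * real n \<le> kap i" "kap i \<le> 4 * real n" by (simp_all add: kap_def)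
qed

lemma block_coordinate_le:
  assumes i: "i \<in> {4 * n..<8 * n}" and z: "z \<in> W2 r"
  shows "\<bar>inner_W2 r z (sob_basis r i)\<bar> \<le> sqrt 2 * (4 * real n) powr r * norm_S z"
proof -
  have "\<bar>inner_W2 r z (sob_basis r i)\<bar> = kap i powr r * (kap i powr - r * \<bar>inner_W2 r z (sob_basis r i)\<bar>)"
    by (simp add: powr_minus_divide)
  also have "\<dots> \<le> kap i powr r * (sqrt 2 * norm_S z)"
    by (intro mult_left_mono coords_le_norm_S[OF r0 z]) simp
  also have "\<dots> \<le> (4 * real n) powr r * (sqrt 2 * norm_S z)"
    using block_kap[OF i] r0 by (intro mult_right_mono powr_mono2) (auto simp: less_imp_le)
  finally show ?thesis by (simp only: mult.assoc mult.left_commute[of "sqrt 2"])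
qed

lemma low_scaled:
  assumes n: "n \<ge> 1"
  shows "sqrt 2 * (4 * real n) powr r * low n \<Lambda> = sqrt \<Lambda> / sqrt 320 * (4 * real n) powr - (\<rho> / 2)"
proof -
  define P where "P = 4 powr (r + \<rho> / 2)"
  define Q where "Q = real n powr - (r + \<rho> / 2)"
  have P: "P > 0" by (simp add: P_def)
  have "(4 * real n) powr r = (4 * real n) powr - (\<rho> / 2) * (4 * real n) powr (r + \<rho> / 2)"
    by (simp flip: powr_add)
  also have "(4 * real n) powr (r + \<rho> / 2) = P * real n powr (r + \<rho> / 2)"
    by (simp add: powr_mult P_def)
  finally have "sqrt 2 * (4 * real n) powr r * low n \<Lambda>
      = (4 * real n) powr - (\<rho> / 2) * (real n powr (r + \<rho> / 2) * Q) * (P * (sqrt 2 * (1 / (sqrt 2 * sqrt 320 * P)))) * sqrt \<Lambda>"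
    by (simp add: low_def P_def Q_def)
  also have "real n powr (r + \<rho> / 2) * Q = 1" using n by (simp add: Q_def flip: powr_add)
  also have "P * (sqrt 2 * (1 / (sqrt 2 * sqrt 320 * P))) = 1 / sqrt 320" using P by (simp add: field_simps)
  finally show ?thesis by simp
qed

lemma large_norm_sets:
  assumes M: "G.closed_sub M" shows "{x \<in> W2 r. l \<le> norm_S (G.proj M x)} \<in> sets \<mu>"
proof -
  have "{z \<in> space G.borel_V. l \<le> norm_S z} \<in> sets G.borel_V" using norm_S_measurable by measurable
  then have "{x \<in> W2 r. G.proj M x \<in> {z \<in> W2 r. l \<le> norm_S z}} \<in> sets \<mu>"
    by (intro proj_vimage_sets[OF M]) simp
  moreover have "{x \<in> W2 r. G.proj M x \<in> {z \<in> W2 r. l \<le> norm_S z}} = {x \<in> W2 r. l \<le> norm_S (G.proj M x)}"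
    using M by auto
  ultimately show ?thesis by simp
qed

lemma block_lam:
  assumes n: "n \<ge> 1" and i: "i \<in> {4 * n..<8 * n}"
  shows "((4 * real n) powr - (\<rho> / 2))\<^sup>2 \<le> kap i powr - \<rho>" "kap i powr - \<rho> \<le> ((2 * real n) powr - (\<rho> / 2))\<^sup>2"
proof -
  have sq: "(x powr - (\<rho> / 2))\<^sup>2 = x powr - \<rho>" for x by (simp flip: powr_double)
  show "((4 * real n) powr - (\<rho> / 2))\<^sup>2 \<le> kap i powr - \<rho>"
    unfolding sq using block_kap[OF i] \<rho> by (intro powr_mono2') auto
  show "kap i powr - \<rho> \<le> ((2 * real n) powr - (\<rho> / 2))\<^sup>2"
    unfolding sq using block_kap[OF i] \<rho> n by (intro powr_mono2') auto
qed

text \<open>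
  The estimate \<open>joint_bound\<close> for \<open>s\<close> coordinates, with \<open>s\<close> the integer part of \<open>n\<close> to the power \<open>1/6\<close>, so that
  \<open>s\<close> to the power \<open>5\<close> is below \<open>n\<close>, as the choice of almost orthogonal coordinates demands. The
  perturbation \<open>b\<close> is comparable with the standard deviation \<open>a\<close> and only adds the constant \<open>C\<close> to the
  argument of the normal tail.
\<close>

lemma small_ball_prob:
  "\<forall>\<^sub>F n in sequentially. \<forall>M \<Lambda>. G.closed_sub M \<longrightarrow> G.codim_le n M \<longrightarrow> 0 \<le> \<Lambda> \<longrightarrow> \<Lambda> \<le> 2 * ln (real n) \<longrightarrow>
     1 / 2 < G.prob {x \<in> W2 r. low n \<Lambda> \<le> norm_S (G.proj M x)}"
proof -
  define C where "C = 2 * 2 powr (\<rho> / 2)"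
  define K where "K = exp (- 2 * C\<^sup>2) / 9"
  have K: "K > 0" by (simp add: K_def)
  show ?thesis
    using small_ball_asymptotics[OF K] eventually_ge_at_top[of 1]
  proof eventually_elim
    case (elim n)
    then have n: "n \<ge> 1" by simp
    define w where "w = real n powr (1/6)"
    have w1: "w \<ge> 1" using n by (simp add: w_def ge_one_powr_ge_zero)
    have w6: "w ^ 6 = real n" using n by (simp add: w_def powr_power)
    define s where "s = nat \<lfloor>w\<rfloor>"
    have s: "s \<ge> 1" "real s \<le> w" "w - 1 \<le> real s" using w1 unfolding s_def by linarith+
    have "real s ^ 6 \<le> w ^ 6" using s(2) by (intro power_mono) auto
    then have "s ^ 6 \<le> n" unfolding w6 by (metis of_nat_le_iff of_nat_power)
    moreover have "s * s ^ 4 \<le> s ^ 6" using s(1) power_increasing[of 5 6 s] by (simp add: eval_nat_numeral)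
    moreover have "s \<le> s ^ 6" using s(1) power_increasing[of 1 6 s] by simp
    ultimately have s2: "s * (s ^ 4 + 1) \<le> 2 * n" by (simp add: distrib_left)
    show ?case
    proof (intro allI impI)
      fix M \<Lambda> assume M: "G.closed_sub M" "G.codim_le n M" and \<Lambda>: "0 \<le> \<Lambda>" "\<Lambda> \<le> 2 * ln (real n)"
      define a where "a = (4 * real n) powr - (\<rho> / 2)"
      define b where "b = (2 * real n) powr - (\<rho> / 2)"
      define T where "T = sqrt 2 * (4 * real n) powr r * low n \<Lambda>"
      define y where "y = exp (- ((2 * (T + b)) / a)\<^sup>2) / 9"
      have ab: "a > 0" "b > 0" using n by (auto simp: a_def b_def)
      have T: "T = sqrt \<Lambda> / sqrt 320 * a" unfolding T_def a_def by (rule low_scaled[OF n])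
      have T0: "T \<ge> 0" using T ab \<Lambda> by simp
      have "b = 2 powr (\<rho> / 2) * a"
      proof -
        have "4 * real n = 2 * (2 * real n)" by simp
        then have "a = 2 powr - (\<rho> / 2) * b" unfolding a_def b_def by (simp only: powr_mult)
        then have "2 powr (\<rho> / 2) * a = (2 powr (\<rho> / 2) * 2 powr - (\<rho> / 2)) * b" by simp
        also have "2 powr (\<rho> / 2) * 2 powr - (\<rho> / 2) = (1::real)" by (simp flip: powr_add)
        finally show ?thesis by simp
      qed
      then have arg: "(2 * (T + b)) / a = 2 * (sqrt \<Lambda> / sqrt 320) + C"
        using ab T by (simp add: C_def field_simps)
      have "((2 * (T + b)) / a)\<^sup>2 \<le> 2 * (2 * (sqrt \<Lambda> / sqrt 320))\<^sup>2 + 2 * C\<^sup>2"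
      proof -
        have "(u + v)\<^sup>2 \<le> 2 * u\<^sup>2 + 2 * v\<^sup>2" for u v :: real
          using zero_le_power2[of "u - v"] by (simp add: power2_eq_square algebra_simps)
        then show ?thesis unfolding arg by blast
      qed
      also have "2 * (2 * (sqrt \<Lambda> / sqrt 320))\<^sup>2 = \<Lambda> / 40"
        using \<Lambda> by (simp add: power_mult_distrib power_divide)
      finally have sq: "((2 * (T + b)) / a)\<^sup>2 \<le> ln (real n) * (1/20) + 2 * C\<^sup>2" using \<Lambda>(2) by linarith
      have "K * real n powr (-1/20) = exp (- 2 * C\<^sup>2) * exp ((-1/20) * ln (real n)) / 9"
        using n by (simp add: K_def powr_def)
      also have "exp (- 2 * C\<^sup>2) * exp ((-1/20) * ln (real n)) = exp (- (ln (real n) * (1/20) + 2 * C\<^sup>2))"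
        by (simp flip: exp_add)
      also have "\<dots> / 9 \<le> y" unfolding y_def using sq by (intro divide_right_mono) auto
      finally have y: "K * real n powr (-1/20) \<le> y" .
      have "exp (- ((2 * (T + b)) / a)\<^sup>2) \<le> 1" by simp
      then have y1: "0 \<le> y" "y \<le> 1" unfolding y_def by (simp, linarith)
      let ?A = "{x \<in> W2 r. \<forall>i\<in>{4 * n..<8 * n}. \<bar>inner_W2 r (G.proj M x) (sob_basis r i)\<bar> \<le> T}"
      have "G.prob ?A \<le> real s * (sqrt 2 * exp (- ((real s)\<^sup>2 / 4))) + (1 - y) ^ s"
        unfolding y_def
        by (rule G.all_coordinates_small[OF M s(1) s2])
           (use block_lam[OF n] ab T0 in \<open>simp_all add: a_def b_def\<close>)
      also have "real s * (sqrt 2 * exp (- ((real s)\<^sup>2 / 4))) \<le> w * (sqrt 2 * exp (- ((w - 1)\<^sup>2 / 4)))"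
      proof (rule mult_mono)
        have "(w - 1)\<^sup>2 \<le> (real s)\<^sup>2" using s(3) w1 by (intro power_mono) auto
        then show "sqrt 2 * exp (- ((real s)\<^sup>2 / 4)) \<le> sqrt 2 * exp (- ((w - 1)\<^sup>2 / 4))" by simp
      qed (use s w1 in auto)
      also have "(1 - y) ^ s \<le> exp (- (K * real n powr (-1/20) * (w - 1)))"
      proof -
        have "(1 - y) ^ s \<le> exp (- y) ^ s"
          using y1 exp_ge_add_one_self[of "- y"] by (intro power_mono) auto
        also have "\<dots> = exp (- (y * real s))" by (simp add: mult.commute flip: exp_of_nat_mult)
        also have "\<dots> \<le> exp (- (K * real n powr (-1/20) * (w - 1)))"
        proof -
          have "K * real n powr (-1/20) * (w - 1) \<le> y * real s"
            using y s(3) w1 y1 by (intro mult_mono) auto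
          then show ?thesis by simp
        qed
        finally show ?thesis .
      qed
      finally have "G.prob ?A \<le> w * (sqrt 2 * exp (- ((w - 1)\<^sup>2 / 4))) + exp (- (K * real n powr (-1/20) * (w - 1)))"
        by simp
      also have "w * (sqrt 2 * exp (- ((w - 1)\<^sup>2 / 4))) = sqrt 2 * w * exp (- ((w - 1)\<^sup>2 / 4))" by simp
      also have "sqrt 2 * w * exp (- ((w - 1)\<^sup>2 / 4)) + exp (- (K * real n powr (-1/20) * (w - 1))) < 1 / 2"
        unfolding w_def using elim(1) .
      finally have A: "G.prob ?A < 1 / 2" .
      let ?L = "{x \<in> W2 r. low n \<Lambda> \<le> norm_S (G.proj M x)}"
      have L: "?L \<in> sets \<mu>" by (rule large_norm_sets[OF M(1)])
      have "1 - G.prob ?L = G.prob (space \<mu> - ?L)" using G.prob_compl[OF L] by simp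
      also have "\<dots> \<le> G.prob ?A"
      proof (rule G.finite_measure_mono)
        show "space \<mu> - ?L \<subseteq> ?A"
        proof
          fix x assume "x \<in> space \<mu> - ?L"
          then have x: "x \<in> W2 r" "norm_S (G.proj M x) \<le> low n \<Lambda>" by (auto simp: G.space_mu)
          have "\<bar>inner_W2 r (G.proj M x) (sob_basis r i)\<bar> \<le> T" if "i \<in> {4 * n..<8 * n}" for i
          proof -
            have "\<bar>inner_W2 r (G.proj M x) (sob_basis r i)\<bar> \<le> sqrt 2 * (4 * real n) powr r * norm_S (G.proj M x)"
              by (rule block_coordinate_le[OF that]) (rule G.proj_in_V[OF M(1) x(1)])
            also have "\<dots> \<le> T" unfolding T_def using x(2) by (intro mult_left_mono) auto
            finally show ?thesis .
          qed
          then show "x \<in> ?A" using x(1) by simp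
        qed
        have [measurable]: "(\<lambda>x. inner_W2 r x (G.proj M (sob_basis r i))) \<in> borel_measurable \<mu>" for i
          by (rule G.ip_measurable_mu) (rule G.proj_in_V[OF M(1) G.e_mem])
        have "{x \<in> space \<mu>. \<forall>i\<in>{4 * n..<8 * n}. \<bar>inner_W2 r x (G.proj M (sob_basis r i))\<bar> \<le> T} \<in> sets \<mu>"
          by measurable
        also have "{x \<in> space \<mu>. \<forall>i\<in>{4 * n..<8 * n}. \<bar>inner_W2 r x (G.proj M (sob_basis r i))\<bar> \<le> T} = ?A"
          using G.proj_ip_basis[OF M(1)] by (auto simp: G.space_mu)
        finally show "?A \<in> sets \<mu>" .
      qed
      finally show "1 / 2 < G.prob ?L" using A by simp
    qed
  qed
qed

text \<open>
  For \<open>\<delta> < 1 / n\<close> one has \<open>\<Lambda> \<le> - 2 * ln \<delta>\<close>, so a single coordinate is large with probability at least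
  \<open>sqrt \<delta> / 9\<close>, and this exceeds \<open>\<delta>\<close> because \<open>\<delta> < 1 / 81\<close>.
\<close>

lemma tail_prob:
  assumes n: "n \<ge> 81" and \<delta>: "0 < \<delta>" "\<delta> < 1 / real n" and M: "G.closed_sub M" "G.codim_le n M"
  shows "\<delta> < G.prob {x \<in> W2 r. low n (ln (real n / \<delta>)) \<le> norm_S (G.proj M x)}"
proof -
  define \<Lambda> where "\<Lambda> = ln (real n / \<delta>)"
  have n1: "n \<ge> 1" using n by simp
  have \<delta>1: "\<delta> < 1 / 81"
  proof -
    have "1 / real n \<le> 1 / 81" using n by (intro divide_left_mono) auto
    then show ?thesis using \<delta> by linarith
  qed
  have \<Lambda>_eq: "\<Lambda> = ln (real n) - ln \<delta>" unfolding \<Lambda>_def using n \<delta> by (simp add: ln_div)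
  have "ln \<delta> < ln (1 / real n)" using \<delta> n by (subst ln_less_cancel_iff) auto
  then have lnn: "ln (real n) \<le> - ln \<delta>" using n by (simp add: ln_div)
  have "0 \<le> ln (real n)" using n by (intro ln_ge_zero) auto
  then have \<Lambda>: "0 \<le> \<Lambda>" "\<Lambda> \<le> - 2 * ln \<delta>" using lnn \<Lambda>_eq by linarith+
  define a where "a = (4 * real n) powr - (\<rho> / 2)"
  define T where "T = sqrt 2 * (4 * real n) powr r * low n \<Lambda>"
  have a: "a > 0" using n by (simp add: a_def)
  have T: "T = sqrt \<Lambda> / sqrt 320 * a" unfolding T_def a_def by (rule low_scaled[OF n1])
  have T0: "T \<ge> 0" using T a \<Lambda> by simp
  have lo: "a\<^sup>2 \<le> kap i powr - \<rho>" if "i \<in> {4 * n..<8 * n}" for i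
    unfolding a_def by (rule block_lam(1)[OF n1 that])
  obtain i where i: "i \<in> {4 * n..<8 * n}"
    "exp (- (2 * T / a)\<^sup>2) / 9 \<le> G.prob {x \<in> W2 r. T < inner_W2 r (G.proj M x) (sob_basis r i)}"
    using G.one_coordinate_large[OF M n1 lo a T0] by blast
  have "(2 * T / a)\<^sup>2 = \<Lambda> / 80"
    using a \<Lambda> by (simp add: T power_mult_distrib power_divide)
  then have "exp (ln \<delta> / 2) \<le> exp (- (2 * T / a)\<^sup>2)" using \<Lambda> by simp
  moreover have "9 * \<delta> < exp (ln \<delta> / 2)"
  proof -
    define e where "e = exp (ln \<delta> / 2)"
    have e: "e > 0" "e * e = \<delta>" using \<delta> by (simp_all add: e_def flip: exp_add)
    have "e < 1 / 9"
    proof (rule ccontr)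
      assume "\<not> e < 1 / 9"
      then have "(1 / 9) * (1 / 9) \<le> e * e" by (intro mult_mono) auto
      then show False using e \<delta>1 by simp
    qed
    then have "9 * e * e < 1 * e" using e(1) by (intro mult_strict_right_mono) auto
    then have "9 * (e * e) < e" by (simp only: mult.assoc mult_1_left)
    then have "9 * \<delta> < e" unfolding e(2) .
    then show ?thesis unfolding e_def .
  qed
  ultimately have "\<delta> < exp (- (2 * T / a)\<^sup>2) / 9" by linarith
  also have "\<dots> \<le> G.prob {x \<in> W2 r. T < inner_W2 r (G.proj M x) (sob_basis r i)}" by (rule i(2))
  also have "\<dots> \<le> G.prob {x \<in> W2 r. low n \<Lambda> \<le> norm_S (G.proj M x)}"
  proof (rule G.finite_measure_mono[OF _ large_norm_sets[OF M(1)]])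
    show "{x \<in> W2 r. T < inner_W2 r (G.proj M x) (sob_basis r i)} \<subseteq> {x \<in> W2 r. low n \<Lambda> \<le> norm_S (G.proj M x)}"
    proof
      fix x assume "x \<in> {x \<in> W2 r. T < inner_W2 r (G.proj M x) (sob_basis r i)}"
      then have x: "x \<in> W2 r" "T < inner_W2 r (G.proj M x) (sob_basis r i)" by auto
      have "\<bar>inner_W2 r (G.proj M x) (sob_basis r i)\<bar> \<le> sqrt 2 * (4 * real n) powr r * norm_S (G.proj M x)"
        by (rule block_coordinate_le[OF i(1)]) (rule G.proj_in_V[OF M(1) x(1)])
      then have "sqrt 2 * (4 * real n) powr r * low n \<Lambda> < sqrt 2 * (4 * real n) powr r * norm_S (G.proj M x)"
        using x(2) unfolding T_def by linarith
      then have "low n \<Lambda> < norm_S (G.proj M x)"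
        by (rule mult_left_less_imp_less) simp
      then show "x \<in> {x \<in> W2 r. low n \<Lambda> \<le> norm_S (G.proj M x)}" using x(1) by simp
    qed
  qed
  finally show ?thesis by (simp add: \<Lambda>_def)
qed

text \<open>
  If the norm of \<open>P\<^sub>M x\<close> is at least \<open>l\<close> with probability above \<open>\<delta>\<close>, then an exceptional set, which has
  \<open>\<mu>\<^sub>M\<close>-measure at most \<open>\<delta>\<close>, cannot contain all elements of \<open>M\<close> of norm at least \<open>l\<close>.
\<close>

lemma prob_width_lower_from_prob:
  assumes l: "l \<ge> 0"
    and P: "\<And>M. G.closed_sub M \<Longrightarrow> G.codim_le n M \<Longrightarrow> \<delta> < G.prob {x \<in> W2 r. l \<le> norm_S (G.proj M x)}"
    and \<delta>: "\<delta> \<ge> 0"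
  shows "ennreal l \<le> prob_gelfand_width r \<mu> n \<delta>"
  unfolding prob_gelfand_width_def
proof (intro INF_greatest)
  fix E F assume E: "E \<in> exceptional_sets r \<mu> \<delta>" and F: "F \<in> gelfand_subspaces n"
  define M where "M = W2 r \<inter> F"
  have M: "G.closed_sub M" unfolding M_def
    using F by (intro sobolev_part_closed_sub) (simp add: gelfand_subspaces_def)
  have cod: "G.codim_le n M" unfolding M_def by (rule sobolev_part_codim[OF F])
  have Es: "E \<in> sets G.borel_V" using E by (simp add: exceptional_sets_def borel_eq)
  have small: "emeasure \<mu> {x \<in> W2 r. G.proj M x \<in> E} \<le> ennreal \<delta>"
  proof -
    have "emeasure (measure_on_subspace r \<mu> M) (E \<inter> M) \<le> ennreal \<delta>"
      using E M by (simp add: exceptional_sets_def closed_subspace_iff)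
    then show ?thesis by (simp only: emeasure_on_subspace[OF M Es])
  qed
  show "ennreal l \<le> (SUP x\<in>(W2 r - E) \<inter> F. ennreal (norm_S x))"
  proof (rule ccontr)
    assume "\<not> ?thesis"
    then have lt: "(SUP x\<in>(W2 r - E) \<inter> F. ennreal (norm_S x)) < ennreal l" by simp
    have "{x \<in> W2 r. l \<le> norm_S (G.proj M x)} \<subseteq> {x \<in> W2 r. G.proj M x \<in> E}"
    proof
      fix x assume x: "x \<in> {x \<in> W2 r. l \<le> norm_S (G.proj M x)}"
      then have pM: "G.proj M x \<in> M" using G.proj_mem_orth(1)[OF M] by simp
      have "G.proj M x \<in> E"
      proof (rule ccontr)
        assume "G.proj M x \<notin> E"
        then have "ennreal (norm_S (G.proj M x)) \<le> (SUP x\<in>(W2 r - E) \<inter> F. ennreal (norm_S x))"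
          using pM by (intro SUP_upper) (auto simp: M_def)
        then have "ennreal (norm_S (G.proj M x)) < ennreal l" using lt by (rule le_less_trans)
        then show False using x l by (simp add: ennreal_less_iff)
      qed
      then show "x \<in> {x \<in> W2 r. G.proj M x \<in> E}" using x by simp
    qed
    then have "emeasure \<mu> {x \<in> W2 r. l \<le> norm_S (G.proj M x)} \<le> ennreal \<delta>"
      using small emeasure_mono[OF _ proj_vimage_sets[OF M Es]] order_trans by blast
    then have "G.prob {x \<in> W2 r. l \<le> norm_S (G.proj M x)} \<le> \<delta>"
      using \<delta> by (simp add: G.emeasure_eq_measure)
    then show False using P[OF M cod] by simp
  qed
qed

text \<open>
  Markov's inequality.
\<close>

lemma avg_width_lower_from_prob:
  assumes l: "l \<ge> 0" and p: "p > 0"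
    and P: "\<And>M. G.closed_sub M \<Longrightarrow> G.codim_le n M \<Longrightarrow> 1 / 2 < G.prob {x \<in> W2 r. l \<le> norm_S (G.proj M x)}"
  shows "ennreal ((1 / 2) powr (1 / p) * l) \<le> avg_gelfand_width r \<mu> n p"
  unfolding avg_gelfand_width_def
proof (intro INF_greatest)
  fix F assume F: "F \<in> gelfand_subspaces n"
  define M where "M = W2 r \<inter> F"
  have M: "G.closed_sub M" unfolding M_def
    using F by (intro sobolev_part_closed_sub) (simp add: gelfand_subspaces_def)
  have cod: "G.codim_le n M" unfolding M_def by (rule sobolev_part_codim[OF F])
  let ?L = "{x \<in> W2 r. l \<le> norm_S (G.proj M x)}"
  have "(\<lambda>z. ennreal (norm_S z powr p)) \<in> borel_measurable G.borel_V"
    using norm_S_measurable by measurable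
  then have I: "(\<integral>\<^sup>+ x. ennreal (norm_S x powr p) \<partial>(measure_on_subspace r \<mu> M))
      = (\<integral>\<^sup>+ x. ennreal (norm_S (G.proj M x) powr p) \<partial>\<mu>)"
    by (rule nn_integral_on_subspace[OF M])
  have "ennreal (1 / 2 * l powr p) \<le> ennreal (l powr p * G.prob ?L)"
    using P[OF M cod] mult_right_mono[of "1 / 2" "G.prob ?L" "l powr p"]
    by (intro ennreal_leI) (simp add: mult.commute)
  also have "\<dots> = ennreal (l powr p) * emeasure \<mu> ?L"
    by (simp add: ennreal_mult G.emeasure_eq_measure)
  also have "\<dots> = (\<integral>\<^sup>+ x. ennreal (l powr p) * indicator ?L x \<partial>\<mu>)"
    by (rule nn_integral_cmult_indicator[OF large_norm_sets[OF M], symmetric])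
  also have "\<dots> \<le> (\<integral>\<^sup>+ x. ennreal (norm_S (G.proj M x) powr p) \<partial>\<mu>)"
  proof (rule nn_integral_mono)
    fix x
    have "l powr p \<le> norm_S (G.proj M x) powr p" if "l \<le> norm_S (G.proj M x)"
      using that l p by (intro powr_mono2) auto
    then show "ennreal (l powr p) * indicator ?L x \<le> ennreal (norm_S (G.proj M x) powr p)"
      by (auto simp: indicator_def ennreal_leI)
  qed
  finally have "ennreal (1 / 2 * l powr p) \<le> (\<integral>\<^sup>+ x. ennreal (norm_S x powr p) \<partial>(measure_on_subspace r \<mu> M))"
    unfolding I .
  then have "ennreal ((1 / 2 * l powr p) powr (1 / p))
      \<le> ennreal_root p (\<integral>\<^sup>+ x. ennreal (norm_S x powr p) \<partial>(measure_on_subspace r \<mu> M))"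
    using p by (intro ennreal_root_ge) auto
  also have "(1 / 2 * l powr p) powr (1 / p) = (1 / 2) powr (1 / p) * l"
  proof -
    have "(l powr p) powr (1 / p) = l" using l p by (simp add: powr_powr)
    moreover have "(1 / 2 * l powr p) powr (1 / p) = (1 / 2) powr (1 / p) * (l powr p) powr (1 / p)"
      by (rule powr_mult)
    ultimately show ?thesis by simp
  qed
  finally show "ennreal ((1 / 2) powr (1 / p) * l)
      \<le> ennreal_root p (\<integral>\<^sup>+ x. ennreal (norm_S x powr p) \<partial>(measure_on_subspace r \<mu> (W2 r \<inter> F)))"
    by (simp add: M_def)
qed

text \<open>
  The lower bound splits at \<open>\<delta> = 1 / n\<close>: above it \<open>\<Lambda> \<le> 2 * ln n\<close> and many coordinates are used, below it
  a single one.
\<close>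

lemma prob_width_comparable:
  "\<exists>N::nat. comparable_on ({N..} \<times> {0<..1 / 2})
     (\<lambda>(n, \<delta>). prob_gelfand_width r \<mu> n \<delta>)
     (\<lambda>(n, \<delta>). real n powr - (r + \<rho> / 2) * sqrt (ln (real n / \<delta>)))"
proof -
  obtain N0 where N0: "\<And>n M \<Lambda>. n \<ge> N0 \<Longrightarrow> G.closed_sub M \<Longrightarrow> G.codim_le n M \<Longrightarrow> 0 \<le> \<Lambda> \<Longrightarrow> \<Lambda> \<le> 2 * ln (real n) \<Longrightarrow>
     1 / 2 < G.prob {x \<in> W2 r. low n \<Lambda> \<le> norm_S (G.proj M x)}"
    using small_ball_prob unfolding eventually_sequentially by blast
  define c1 where "c1 = 1 / (sqrt 2 * sqrt 320 * 4 powr (r + \<rho> / 2))"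
  define c2 where "c2 = 4 * 2 powr (r + \<rho> / 2)"
  have "ennreal (c1 * (real n powr - (r + \<rho> / 2) * sqrt (ln (real n / \<delta>)))) \<le> prob_gelfand_width r \<mu> n \<delta> \<and>
      prob_gelfand_width r \<mu> n \<delta> \<le> ennreal (c2 * (real n powr - (r + \<rho> / 2) * sqrt (ln (real n / \<delta>))))"
    if n: "n \<ge> max N0 81" and \<delta>: "0 < \<delta>" "\<delta> \<le> 1 / 2" for n \<delta>
  proof
    define \<Lambda> where "\<Lambda> = ln (real n / \<delta>)"
    have n2: "n \<ge> 2" "n \<ge> 1" "n \<ge> 81" "n \<ge> N0" using n by auto
    have \<Lambda>: "\<Lambda> \<ge> 0" using log_ratio_bounds(2)[OF n2(1) \<delta>] by (simp add: \<Lambda>_def)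
    have "\<delta> < G.prob {x \<in> W2 r. low n \<Lambda> \<le> norm_S (G.proj M x)}" if M: "G.closed_sub M" "G.codim_le n M" for M
    proof (cases "\<delta> < 1 / real n")
      case True
      show ?thesis unfolding \<Lambda>_def by (rule tail_prob[OF n2(3) \<delta>(1) True M])
    next
      case False
      have "real n / \<delta> \<le> real n * real n"
        using False n2(2) \<delta> by (simp add: field_simps)
      then have "\<Lambda> \<le> ln (real n * real n)" unfolding \<Lambda>_def using n2(2) \<delta> by (subst ln_le_cancel_iff) auto
      also have "\<dots> = 2 * ln (real n)" using n2(2) by (simp add: ln_mult)
      finally show ?thesis using N0[OF n2(4) M \<Lambda>] \<delta> by linarith
    qed
    then have "ennreal (low n \<Lambda>) \<le> prob_gelfand_width r \<mu> n \<delta>"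
      using \<delta> by (intro prob_width_lower_from_prob low_nonneg[OF \<Lambda>]) auto
    then show "ennreal (c1 * (real n powr - (r + \<rho> / 2) * sqrt (ln (real n / \<delta>)))) \<le> prob_gelfand_width r \<mu> n \<delta>"
      by (simp only: low_def c1_def \<Lambda>_def)
    have "prob_gelfand_width r \<mu> n \<delta> \<le> ennreal (radius n \<Lambda>)"
      unfolding \<Lambda>_def by (rule prob_width_upper[OF n2(1) \<delta>])
    also have "\<dots> \<le> ennreal (c2 * (real n powr - (r + \<rho> / 2) * sqrt \<Lambda>))"
      unfolding c2_def by (intro ennreal_leI radius_le n2(2) \<Lambda>)
    finally show "prob_gelfand_width r \<mu> n \<delta> \<le> ennreal (c2 * (real n powr - (r + \<rho> / 2) * sqrt (ln (real n / \<delta>))))"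
      by (simp only: \<Lambda>_def)
  qed
  moreover have "c1 > 0" "c2 > 0" by (simp_all add: c1_def c2_def)
  ultimately show ?thesis
    unfolding comparable_on_def by (intro exI[of _ "max N0 81"] exI[of _ c1] exI[of _ c2]) auto
qed

text \<open>
  The threshold for \<open>n\<close> grows with \<open>p\<close>, since \<open>norm_powr_le_excess\<close> needs \<open>p / 2 \<le> 4 * \<Lambda>\<close>; this holds once
  \<open>n \<ge> exp p\<close>.
\<close>

lemma avg_width_comparable:
  assumes p: "p > 0"
  shows "\<exists>N::nat. comparable_on {N..} (\<lambda>n. avg_gelfand_width r \<mu> n p)
     (\<lambda>n. real n powr - (r + \<rho> / 2) * sqrt (ln (real n)))"
proof -
  obtain N0 where N0: "\<And>n M \<Lambda>. n \<ge> N0 \<Longrightarrow> G.closed_sub M \<Longrightarrow> G.codim_le n M \<Longrightarrow> 0 \<le> \<Lambda> \<Longrightarrow> \<Lambda> \<le> 2 * ln (real n) \<Longrightarrow>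
     1 / 2 < G.prob {x \<in> W2 r. low n \<Lambda> \<le> norm_S (G.proj M x)}"
    using small_ball_prob unfolding eventually_sequentially by blast
  obtain N1 :: nat where N1: "exp p \<le> real N1" using real_arch_simple by blast
  define c1 where "c1 = (1 / 2) powr (1 / p) * (1 / (sqrt 2 * sqrt 320 * 4 powr (r + \<rho> / 2)))"
  define c2 where "c2 = 2 powr (1 / p) * (4 * 2 powr (r + \<rho> / 2)) * sqrt 2"
  have "ennreal (c1 * (real n powr - (r + \<rho> / 2) * sqrt (ln (real n)))) \<le> avg_gelfand_width r \<mu> n p \<and>
      avg_gelfand_width r \<mu> n p \<le> ennreal (c2 * (real n powr - (r + \<rho> / 2) * sqrt (ln (real n))))"
    if n: "n \<ge> max (max N0 N1) 2" for n
  proof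
    have n2: "n \<ge> 2" "n \<ge> 1" "n \<ge> N0" "n \<ge> N1" using n by auto
    have l0: "0 \<le> ln (real n)" using n2 by (intro ln_ge_zero) auto
    have "ennreal ((1 / 2) powr (1 / p) * low n (ln (real n))) \<le> avg_gelfand_width r \<mu> n p"
      by (rule avg_width_lower_from_prob[OF low_nonneg[OF l0] p]) (rule N0[OF n2(3)], use l0 in auto)
    then show "ennreal (c1 * (real n powr - (r + \<rho> / 2) * sqrt (ln (real n)))) \<le> avg_gelfand_width r \<mu> n p"
      by (simp only: low_def c1_def mult.assoc)
    define \<Lambda> where "\<Lambda> = ln (real n / (1 / 2))"
    have \<Lambda>: "\<Lambda> = ln 2 + ln (real n)" unfolding \<Lambda>_def using n2 by (simp add: ln_mult mult.commute)
    have "ln (2::real) \<le> ln (real n)" using n2 by (subst ln_le_cancel_iff) auto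
    then have \<Lambda>2: "\<Lambda> \<le> 2 * ln (real n)" and \<Lambda>0: "\<Lambda> \<ge> 0" using \<Lambda> l0 by auto
    have "exp p \<le> real n" using N1 n2(4) by linarith
    then have "p \<le> ln (real n)" using n2 by (subst ln_ge_iff) auto
    moreover have "0 \<le> ln (2::real)" by simp
    ultimately have "p / 2 \<le> 4 * \<Lambda>" using \<Lambda> p by linarith
    then have "avg_gelfand_width r \<mu> n p \<le> ennreal (2 powr (1 / p) * radius n \<Lambda>)"
      unfolding \<Lambda>_def by (rule avg_width_upper[OF n2(1) p])
    also have "\<dots> \<le> ennreal (c2 * (real n powr - (r + \<rho> / 2) * sqrt (ln (real n))))"
    proof (rule ennreal_leI)
      have "2 powr (1 / p) * radius n \<Lambda> \<le> 2 powr (1 / p) * (4 * 2 powr (r + \<rho> / 2) * (real n powr - (r + \<rho> / 2) * sqrt \<Lambda>))"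
        by (intro mult_left_mono radius_le n2(2) \<Lambda>0) simp
      also have "\<dots> \<le> 2 powr (1 / p) * (4 * 2 powr (r + \<rho> / 2) * (real n powr - (r + \<rho> / 2) * (sqrt 2 * sqrt (ln (real n)))))"
        using \<Lambda>2 by (intro mult_left_mono) (auto simp flip: real_sqrt_mult)
      also have "\<dots> = c2 * (real n powr - (r + \<rho> / 2) * sqrt (ln (real n)))"
        unfolding c2_def by (simp only: mult.assoc mult.left_commute[of "sqrt 2"])
      finally show "2 powr (1 / p) * radius n \<Lambda> \<le> c2 * (real n powr - (r + \<rho> / 2) * sqrt (ln (real n)))" .
    qed
    finally show "avg_gelfand_width r \<mu> n p \<le> ennreal (c2 * (real n powr - (r + \<rho> / 2) * sqrt (ln (real n))))" .
  qed
  moreover have "c1 > 0" "c2 > 0" by (simp_all add: c1_def c2_def)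
  ultimately show ?thesis
    unfolding comparable_on_def by (intro exI[of _ "max (max N0 N1) 2"] exI[of _ c1] exI[of _ c2]) auto
qed

end

theorem theorem4p1:
  fixes r \<rho> p :: real and \<mu> :: "torus measure"
  assumes "\<rho> > 1" and "r > 1 / 2" and "p > 0"
    and "gaussian_W2 r \<rho> \<mu>"
  shows
    "(\<exists>N::nat. comparable_on ({N..} \<times> {0<..1 / 2})
        (\<lambda>(n, \<delta>). prob_gelfand_width r \<mu> n \<delta>)
        (\<lambda>(n, \<delta>). real n powr - (r + \<rho> / 2) * sqrt (ln (real n / \<delta>)))) \<and>
     (\<exists>N::nat. comparable_on {N..}
        (\<lambda>n. avg_gelfand_width r \<mu> n p)
        (\<lambda>n. real n powr - (r + \<rho> / 2) * sqrt (ln (real n))))"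
  using prob_width_comparable[of r \<rho> \<mu>] avg_width_comparable[of r \<rho> \<mu> p] assms by simp

end
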